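(* For parameters $\epsilon,\delta>0$ and $t\in\mathbb{N}$, there exists a randomized algorithm that, given membership query access to $f:\mathbb{F}_2^n\to\{-1,1\}$, makes $\mathrm{poly}(\log t,1/\epsilon,\log(1/\delta))$ queries to $f$ and outputs numbers $\sigma_1\ge\dots\ge\sigma_t$ in $[0,1]$ such that $$\Pr\big[\,\big||\hat f(\gamma_i)|-\sigma_i\big|\le\epsilon \text{ for all } i\in[t]\,\big]\ge1-\delta-o(1),$$ where $\gamma_1,\dots,\gamma_t\in\mathbb{F}_2^n$ are the vectors corresponding to the $t$ largest Fourier coefficients of $f$ in absolute value, in descending order of magnitude. (The running time is $\mathrm{poly}(n,t,1/\epsilon,\log(1/\delta))$.)
   Context: For $f:\mathbb{F}_2^n\to\{-1,1\}$, $\hat f(\gamma)=\mathbb{E}_{x}[f(x)(-1)^{\langle\gamma,x\rangle}]$ with $x$ uniform in $\mathbb{F}_2^n$, so that $f=\sum_\gamma\hat f(\gamma)(-1)^{\langle\gamma,x\rangle}$. The term $o(1)$ is with respect to $n\to\infty$. *)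

theory Defs
  imports
    "HOL-Probability.Probability"
    "HOL-Library.Z2"
    "Jordan_Normal_Form.Matrix"
begin

text \<open>
  The space \<open>F\<^sub>2\<^sup>n\<close> is \<open>carrier_vec n :: bit Matrix.vec set\<close>; a Boolean function on it is a map
  \<open>f :: bit Matrix.vec \<Rightarrow> int\<close> with values in \<open>{-1, 1}\<close> on \<open>carrier_vec n\<close>.
\<close>

definition chi :: "bit Matrix.vec \<Rightarrow> bit Matrix.vec \<Rightarrow> real" where
  "chi \<gamma> x = (if scalar_prod \<gamma> x = 0 then 1 else - 1)"

definition fourier :: "nat \<Rightarrow> (bit Matrix.vec \<Rightarrow> int) \<Rightarrow> bit Matrix.vec \<Rightarrow> real" where
  "fourier n f \<gamma> =
     measure_pmf.expectation (pmf_of_set (carrier_vec n)) (\<lambda>x. real_of_int (f x) * chi \<gamma> x)"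

lemma UNIV_bit: "(UNIV :: bit set) = {0, 1}"
proof (rule UNIV_eq_I)
  fix b :: bit
  show "b \<in> {0, 1}"
    by (rule bit.exhaust[of b]) (simp_all only: insert_iff simp_thms)
qed

lemma bit_carrier_vec_eq_image:
  "(carrier_vec n :: bit Matrix.vec set) = Matrix.vec n ` ({..<n} \<rightarrow>\<^sub>E UNIV)"
proof (intro equalityI subsetI)
  fix x :: "bit Matrix.vec" assume x: "x \<in> carrier_vec n"
  have "x = Matrix.vec n (restrict (vec_index x) {..<n})"
  proof (rule eq_vecI)
    show "dim_vec x = dim_vec (Matrix.vec n (restrict (vec_index x) {..<n}))"
      using x by (simp only: dim_vec carrier_vecD)
  next
    fix i assume "i < dim_vec (Matrix.vec n (restrict (vec_index x) {..<n}))"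
    then show "vec_index x i = vec_index (Matrix.vec n (restrict (vec_index x) {..<n})) i"
      by (simp only: dim_vec index_vec restrict_apply' lessThan_iff)
  qed
  moreover have "restrict (vec_index x) {..<n} \<in> {..<n} \<rightarrow>\<^sub>E UNIV"
    by (rule restrict_PiE_iff[THEN iffD2]) (rule ballI UNIV_I)+
  ultimately show "x \<in> Matrix.vec n ` ({..<n} \<rightarrow>\<^sub>E UNIV)"
    by (rule image_eqI)
next
  fix x :: "bit Matrix.vec" assume "x \<in> Matrix.vec n ` ({..<n} \<rightarrow>\<^sub>E UNIV)"
  then show "x \<in> carrier_vec n"
    by (elim imageE) (simp only: vec_carrier)
qed

lemma finite_bit_carrier_vec: "finite (carrier_vec n :: bit Matrix.vec set)"
  unfolding bit_carrier_vec_eq_image UNIV_bit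
  by (rule finite_imageI, rule finite_PiE, rule finite_lessThan) (rule finite.intros)+

lemma card_bit_carrier_vec: "card (carrier_vec n :: bit Matrix.vec set) = 2 ^ n"
proof -
  have "inj_on (Matrix.vec n) ({..<n} \<rightarrow>\<^sub>E (UNIV :: bit set))"
  proof (rule inj_onI)
    fix g h :: "nat \<Rightarrow> bit"
    assume g: "g \<in> {..<n} \<rightarrow>\<^sub>E UNIV" and h: "h \<in> {..<n} \<rightarrow>\<^sub>E UNIV"
      and eq: "Matrix.vec n g = Matrix.vec n h"
    have "g i = h i" if "i < n" for i
      using arg_cong[OF eq, of "\<lambda>v. vec_index v i"] that by (simp only: index_vec)
    then show "g = h" by (rule PiE_ext[OF g h]) (simp only: lessThan_iff)
  qed
  then show ?thesis
    by (simp only: bit_carrier_vec_eq_image card_image card_PiE finite_lessThan)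
      (simp add: UNIV_bit numeral_2_eq_2)
qed

lemma fourier_eq_sum:
  "fourier n f \<gamma> = (\<Sum>x\<in>carrier_vec n. real_of_int (f x) * chi \<gamma> x) / 2 ^ n"
proof -
  have "(carrier_vec n :: bit Matrix.vec set) \<noteq> {}"
    using zero_carrier_vec by blast
  then show ?thesis
    unfolding fourier_def
    by (subst integral_pmf_of_set) (simp_all add: finite_bit_carrier_vec card_bit_carrier_vec)
qed

text \<open>
  \<open>\<gamma>s\<close> lists \<open>t\<close> distinct frequencies carrying the \<open>t\<close> largest Fourier coefficients in absolute
  value, in descending order. Ties make the list non-unique, but not the absolute values along
  it. Such a list exists if and only if \<open>t \<le> 2 ^ n\<close>.
\<close>

definition top_frequencies ::
    "nat \<Rightarrow> (bit Matrix.vec \<Rightarrow> int) \<Rightarrow> nat \<Rightarrow> bit Matrix.vec list \<Rightarrow> bool" where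
  "top_frequencies n f t \<gamma>s \<longleftrightarrow>
     length \<gamma>s = t \<and> distinct \<gamma>s \<and> set \<gamma>s \<subseteq> carrier_vec n \<and>
     sorted_wrt (\<lambda>\<alpha> \<beta>. \<bar>fourier n f \<alpha>\<bar> \<ge> \<bar>fourier n f \<beta>\<bar>) \<gamma>s \<and>
     (\<forall>\<alpha>\<in>set \<gamma>s. \<forall>\<beta>\<in>carrier_vec n - set \<gamma>s. \<bar>fourier n f \<alpha>\<bar> \<ge> \<bar>fourier n f \<beta>\<bar>)"

text \<open>
  Randomized algorithms with membership queries are programs for a random access machine with
  integer registers, an integer-addressed memory, fair coin tosses and an oracle for \<open>f\<close>; every
  step costs one unit. Arithmetic is limited to addition and subtraction (no multiplication), so
  one step lengthens the numbers involved by at most a constant number of bits (depending on the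
  program), and the step count is polynomially related to Turing machine time.
\<close>

datatype exp =
    Num int
  | Reg nat
  | Mem exp
  | Add exp exp
  | Sub exp exp

datatype com =
    Skip
  | Assign nat exp
  | Store exp exp
  | Flip nat
  | Query nat exp
  | Output exp exp
  | Seq com com
  | IfPos exp com com
  | WhilePos exp com

record state =
  regs :: "nat \<Rightarrow> int"
  mem :: "int \<Rightarrow> int"
  num_queries :: nat
  outputs :: "real list"

fun eval_exp :: "state \<Rightarrow> exp \<Rightarrow> int" where
  "eval_exp s (Num k) = k"
| "eval_exp s (Reg r) = regs s r"
| "eval_exp s (Mem a) = mem s (eval_exp s a)"
| "eval_exp s (Add a b) = eval_exp s a + eval_exp s b"
| "eval_exp s (Sub a b) = eval_exp s a - eval_exp s b"

text \<open>
  A configuration is a stack of commands still to be executed together with a state. \<open>Query r a\<close>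
  asks for the value of \<open>f\<close> at the vector whose \<open>n\<close> coordinates are the parities of the memory
  cells from address \<open>a\<close> on; \<open>Output a b\<close> appends the rational number \<open>a / b\<close> to the output.
\<close>

type_synonym config = "com list \<times> state"

fun step :: "nat \<Rightarrow> (bit Matrix.vec \<Rightarrow> int) \<Rightarrow> config \<Rightarrow> config pmf" where
  "step n f ([], s) = return_pmf ([], s)"
| "step n f (Skip # cs, s) = return_pmf (cs, s)"
| "step n f (Assign r a # cs, s) =
     return_pmf (cs, s\<lparr>regs := (regs s)(r := eval_exp s a)\<rparr>)"
| "step n f (Store a b # cs, s) =
     return_pmf (cs, s\<lparr>mem := (mem s)(eval_exp s a := eval_exp s b)\<rparr>)"
| "step n f (Flip r # cs, s) =
     map_pmf (\<lambda>b. (cs, s\<lparr>regs := (regs s)(r := if b then 1 else 0)\<rparr>)) (bernoulli_pmf (1 / 2))"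
| "step n f (Query r a # cs, s) =
     return_pmf (cs, s\<lparr>
       regs := (regs s)(r := f (Matrix.vec n (\<lambda>i. of_int (mem s (eval_exp s a + int i))))),
       num_queries := num_queries s + 1\<rparr>)"
| "step n f (Output a b # cs, s) =
     return_pmf (cs, s\<lparr>
       outputs := outputs s @ [real_of_int (eval_exp s a) / real_of_int (eval_exp s b)]\<rparr>)"
| "step n f (Seq c d # cs, s) = return_pmf (c # d # cs, s)"
| "step n f (IfPos a c d # cs, s) =
     return_pmf ((if eval_exp s a > 0 then c else d) # cs, s)"
| "step n f (WhilePos a c # cs, s) =
     return_pmf (if eval_exp s a > 0 then c # WhilePos a c # cs else cs, s)"

text \<open>
  The inputs \<open>n\<close>, \<open>t\<close>, \<open>\<epsilon>\<close>, \<open>\<delta>\<close> are passed in registers 0 to 3. As \<open>\<epsilon>\<close> and \<open>\<delta>\<close> are arbitrary reals,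
  the machine receives \<open>\<lceil>1/\<epsilon>\<rceil>\<close> and \<open>\<lceil>log\<^sub>2 (1/\<delta>)\<rceil>\<close>.
\<close>

definition init_config :: "com \<Rightarrow> nat \<Rightarrow> nat \<Rightarrow> real \<Rightarrow> real \<Rightarrow> config" where
  "init_config p n t \<epsilon> \<delta> =
     ([p], \<lparr>regs = (\<lambda>_. 0)(0 := int n, 1 := int t, 2 := \<lceil>1 / \<epsilon>\<rceil>, 3 := \<lceil>log 2 (1 / \<delta>)\<rceil>),
            mem = (\<lambda>_. 0), num_queries = 0, outputs = []\<rparr>)"

fun run :: "nat \<Rightarrow> (bit Matrix.vec \<Rightarrow> int) \<Rightarrow> nat \<Rightarrow> config \<Rightarrow> config pmf" where
  "run n f 0 cfg = return_pmf cfg"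
| "run n f (Suc k) cfg = bind_pmf (step n f cfg) (run n f k)"

definition halted :: "config \<Rightarrow> bool" where
  "halted cfg \<longleftrightarrow> fst cfg = []"

end

theory Submission imports Defs begin

text \<open>
  Draw \<open>x, v\<^sub>1, \<dots>, v\<^sub>k\<close> uniformly and restrict \<open>f\<close> to \<open>g y = f (x + \<Sum>\<^sub>i y\<^sub>i v\<^sub>i)\<close> on \<open>K = 2\<^sup>k\<close>
  points, where \<open>K\<close> is polynomial in \<open>1/\<epsilon>\<close>. The coefficient of \<open>g\<close> at \<open>a\<close> is the sum of
  \<open>\<plusminus> fourier n f \<gamma>\<close> over the frequencies \<open>\<gamma>\<close> with \<open>\<gamma> \<bullet> v\<^sub>i = a\<^sub>i\<close> for all \<open>i\<close>. Pairwise independence of this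
  hashing separates the heavy frequencies and makes each heavy coefficient reappear up to \<open>\<epsilon>\<close>. No
  other coefficient of \<open>g\<close> exceeds \<open>\<epsilon>\<close>: writing \<open>c\<^sub>a\<close> for the coefficients of \<open>g\<close>, the mean of \<open>\<Sum>\<^sub>a c\<^sub>a\<^sup>4\<close> is at
  most \<open>3/K\<close> above \<open>\<Sum>\<^sub>\<gamma> (fourier n f \<gamma>)\<^sup>4\<close>, which the heavy coefficients already account for.
  Hence the sorted absolute values of the coefficients of \<open>g\<close>, computed from \<open>K\<close> queries by a fast
  Walsh-Hadamard transform, are accurate with probability 15/16. The coordinatewise median over
  \<open>R = \<lceil>log\<^sub>2 (1/\<delta>)\<rceil>\<close> rounds fails with probability at most \<open>2\<^sup>-\<^sup>R \<le> \<delta>\<close>, so no \<open>o(1)\<close> term is left.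
\<close>

subsection \<open>The Fourier transform of random affine restrictions\<close>

text \<open>Second moments cannot exclude spurious entries: the squares of the \<open>K\<close>
  restricted coefficients always sum to 1, so a union bound over \<open>K\<close> indices, each with
  second moment of order \<open>1/K\<close>, gives nothing. With fourth powers the light frequencies
  contribute at most their largest squared coefficient, and the excess is only of order
  \<open>1/K\<close>. The fourth moment is therefore put into one nonnegative
  \<open>potential\<close>, together with penalties for collisions and for misestimated heavy
  coefficients, so that a single use of Markov's inequality controls all indices at once. A stray
  entry of size \<open>1/e\<close> costs \<open>1/e^4\<close>, so the mean has to be of order
  \<open>1/e^4\<close>. This makes a frequency heavy once its squared coefficient exceeds order
  \<open>1/e^4\<close>; there are order \<open>e^4\<close> of them, hence order \<open>e^8\<close>
  pairs that may collide, and \<open>K\<close> of order \<open>e^12\<close> suffices. The random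
  shift \<open>x\<close> makes distinct characters orthogonal on average, so frequencies sharing an
  index add up in squares. \<open>K\<close> involves neither \<open>n\<close> nor \<open>t\<close>;
  an output whose position exceeds \<open>K\<close> is 0.\<close>

abbreviation cube :: "nat \<Rightarrow> bit Matrix.vec set" where
  "cube n \<equiv> carrier_vec n"

lemma chi_add_right:
  assumes "\<gamma> \<in> cube n" "x \<in> cube n" "y \<in> cube n"
  shows "chi \<gamma> (x + y) = chi \<gamma> x * chi \<gamma> y"
  unfolding chi_def scalar_prod_add_distrib[OF assms]
  by (cases "scalar_prod \<gamma> x"; cases "scalar_prod \<gamma> y") auto

lemma chi_commute: "\<gamma> \<in> cube n \<Longrightarrow> x \<in> cube n \<Longrightarrow> chi \<gamma> x = chi x \<gamma>"
  unfolding chi_def by (simp add: comm_scalar_prod[of \<gamma> n x])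

lemma chi_cases: "chi \<gamma> x = 1 \<or> chi \<gamma> x = -1"
  by (simp add: chi_def)

lemma chi_sq [simp]: "chi \<gamma> x * chi \<gamma> x = 1" "(chi \<gamma> x)\<^sup>2 = 1"
  by (auto simp: chi_def)

lemma abs_chi [simp]: "\<bar>chi \<gamma> x\<bar> = 1"
  by (auto simp: chi_def)

lemma bit_vec_add_cancel [simp]:
  assumes "x \<in> cube n" "v \<in> cube n"
  shows "x + v + v = x"
  using assms by (intro eq_vecI) (auto simp: add.assoc)

lemma sum_translate:
  assumes "v \<in> cube n"
  shows "(\<Sum>x\<in>cube n. F (x + v)) = (\<Sum>x\<in>cube n. F x)"
  by (rule sum.reindex_bij_witness[of _ "\<lambda>x. x + v" "\<lambda>x. x + v"]) (use assms in auto)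

lemma chi_unit_vec: "\<gamma> \<in> cube n \<Longrightarrow> i < n \<Longrightarrow> chi \<gamma> (unit_vec n i) = (if vec_index \<gamma> i = 0 then 1 else -1)"
  by (simp add: chi_def)

text \<open>Translating by the basis vector of a coordinate in which the frequencies differ flips
  the sign of every summand, so the sum equals its own negative.\<close>

lemma sum_chi_mult:
  assumes "\<gamma> \<in> cube n" "\<beta> \<in> cube n"
  shows "(\<Sum>x\<in>cube n. chi \<gamma> x * chi \<beta> x) = (if \<gamma> = \<beta> then 2 ^ n else 0)"
proof (cases "\<gamma> = \<beta>")
  case True
  then show ?thesis by (simp add: card_bit_carrier_vec)
next
  case False
  then obtain i where i: "i < n" "vec_index \<gamma> i \<noteq> vec_index \<beta> i"
    using assms by (metis carrier_vecD eq_vecI)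
  let ?S = "\<Sum>x\<in>cube n. chi \<gamma> x * chi \<beta> x"
  have "chi \<gamma> (unit_vec n i) * chi \<beta> (unit_vec n i) = -1"
    using i assms by (cases "vec_index \<gamma> i"; cases "vec_index \<beta> i") (auto simp: chi_unit_vec)
  then have "chi \<gamma> (x + unit_vec n i) * chi \<beta> (x + unit_vec n i) = - (chi \<gamma> x * chi \<beta> x)"
    if "x \<in> cube n" for x
    using that assms
    by (simp add: chi_add_right[of _ n] algebra_simps)
  then have "?S = - ?S"
    by (subst sum_translate[symmetric, of "unit_vec n i"]) (simp_all add: sum_negf)
  then show ?thesis using False by simp
qed

section \<open>Averages, Fourier inversion and Parseval on the cube\<close>

definition avg :: "nat \<Rightarrow> (bit Matrix.vec \<Rightarrow> real) \<Rightarrow> real" where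
  "avg n F = (\<Sum>x\<in>cube n. F x) / 2 ^ n"

lemma avg_cong: "(\<And>x. x \<in> cube n \<Longrightarrow> F x = G x) \<Longrightarrow> avg n F = avg n G"
  by (simp add: avg_def)

lemma avg_const [simp]: "avg n (\<lambda>_. c) = c"
  by (simp add: avg_def card_bit_carrier_vec)

lemma avg_add: "avg n (\<lambda>x. F x + G x) = avg n F + avg n G"
  by (simp add: avg_def sum.distrib add_divide_distrib)

lemma avg_diff: "avg n (\<lambda>x. F x - G x) = avg n F - avg n G"
  by (simp add: avg_def sum_subtractf diff_divide_distrib)

lemma avg_cmult: "avg n (\<lambda>x. c * F x) = c * avg n F"
  by (simp add: avg_def sum_distrib_left)

lemma avg_sum: "avg n (\<lambda>x. \<Sum>i\<in>I. F i x) = (\<Sum>i\<in>I. avg n (F i))"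
  unfolding avg_def by (subst sum.swap) (simp add: sum_divide_distrib)

lemma avg_swap: "avg n (\<lambda>x. avg m (F x)) = avg m (\<lambda>y. avg n (\<lambda>x. F x y))"
  unfolding avg_def by (simp add: sum_divide_distrib[symmetric] sum.swap[of _ "cube m"])

lemma avg_translate: "v \<in> cube n \<Longrightarrow> avg n (\<lambda>x. F (x + v)) = avg n F"
  by (simp add: avg_def sum_translate)

lemma avg_translate': "x \<in> cube n \<Longrightarrow> avg n (\<lambda>v. F (x + v)) = avg n F"
proof -
  assume x: "x \<in> cube n"
  have "avg n (\<lambda>v. F (x + v)) = avg n (\<lambda>v. F (v + x))"
    using x by (intro avg_cong) (simp add: comm_add_vec[of _ n])
  then show ?thesis using x by (simp add: avg_translate)
qed

lemma avg_chi_mult: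
  "\<gamma> \<in> cube n \<Longrightarrow> \<beta> \<in> cube n \<Longrightarrow> avg n (\<lambda>x. chi \<gamma> x * chi \<beta> x) = (if \<gamma> = \<beta> then 1 else 0)"
  by (simp add: avg_def sum_chi_mult)

lemma fourier_eq_avg: "fourier n f \<gamma> = avg n (\<lambda>x. real_of_int (f x) * chi \<gamma> x)"
  by (simp add: fourier_eq_sum avg_def)

lemma fourier_inversion:
  assumes "x \<in> cube n"
  shows "(\<Sum>\<gamma>\<in>cube n. fourier n f \<gamma> * chi \<gamma> x) = real_of_int (f x)"
proof -
  have "(\<Sum>\<gamma>\<in>cube n. fourier n f \<gamma> * chi \<gamma> x)
      = (\<Sum>\<gamma>\<in>cube n. avg n (\<lambda>y. real_of_int (f y) * (chi y \<gamma> * chi x \<gamma>)))"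
  proof (intro sum.cong refl)
    fix \<gamma> :: "bit Matrix.vec" assume \<gamma>: "\<gamma> \<in> cube n"
    have "fourier n f \<gamma> * chi \<gamma> x = avg n (\<lambda>y. chi \<gamma> x * (real_of_int (f y) * chi \<gamma> y))"
      by (simp only: fourier_eq_avg avg_cmult mult.commute)
    also have "\<dots> = avg n (\<lambda>y. real_of_int (f y) * (chi y \<gamma> * chi x \<gamma>))"
      using assms \<gamma> by (intro avg_cong) (simp add: chi_commute[of \<gamma> n])
    finally show "fourier n f \<gamma> * chi \<gamma> x = avg n (\<lambda>y. real_of_int (f y) * (chi y \<gamma> * chi x \<gamma>))" .
  qed
  also have "\<dots> = avg n (\<lambda>y. real_of_int (f y) * (\<Sum>\<gamma>\<in>cube n. chi y \<gamma> * chi x \<gamma>))"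
    by (simp add: avg_sum[symmetric] sum_distrib_left)
  also have "\<dots> = avg n (\<lambda>y. if y = x then real_of_int (f y) * 2 ^ n else 0)"
    using assms by (intro avg_cong) (simp add: sum_chi_mult)
  also have "\<dots> = real_of_int (f x)"
    using assms by (simp add: avg_def finite_bit_carrier_vec)
  finally show ?thesis .
qed

text \<open>The sum ranges over a subset \<open>S\<close> because it is later applied to the set of
  frequencies with one hash value.\<close>

lemma avg_fourier_poly_mult_chi:
  assumes "S \<subseteq> cube n" "\<beta> \<in> cube n"
  shows "avg n (\<lambda>x. (\<Sum>\<gamma>\<in>S. c \<gamma> * chi \<gamma> x) * chi \<beta> x) = (if \<beta> \<in> S then c \<beta> else 0)"
proof -
  have fin: "finite S" using assms(1) finite_bit_carrier_vec finite_subset by blast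
  have "avg n (\<lambda>x. (\<Sum>\<gamma>\<in>S. c \<gamma> * chi \<gamma> x) * chi \<beta> x)
      = (\<Sum>\<gamma>\<in>S. c \<gamma> * avg n (\<lambda>x. chi \<gamma> x * chi \<beta> x))"
    by (simp add: sum_distrib_right avg_sum avg_cmult mult.assoc)
  also have "\<dots> = (\<Sum>\<gamma>\<in>S. if \<gamma> = \<beta> then c \<gamma> else 0)"
    using assms by (intro sum.cong) (auto simp: avg_chi_mult)
  finally show ?thesis using fin by simp
qed

lemma avg_fourier_poly_sq:
  assumes "S \<subseteq> cube n"
  shows "avg n (\<lambda>x. (\<Sum>\<gamma>\<in>S. c \<gamma> * chi \<gamma> x)\<^sup>2) = (\<Sum>\<gamma>\<in>S. (c \<gamma>)\<^sup>2)"
proof -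
  have "avg n (\<lambda>x. (\<Sum>\<gamma>\<in>S. c \<gamma> * chi \<gamma> x)\<^sup>2)
      = avg n (\<lambda>x. \<Sum>\<beta>\<in>S. c \<beta> * ((\<Sum>\<gamma>\<in>S. c \<gamma> * chi \<gamma> x) * chi \<beta> x))"
    by (simp add: power2_eq_square sum_distrib_left mult_ac)
  also have "\<dots> = (\<Sum>\<beta>\<in>S. c \<beta> * avg n (\<lambda>x. (\<Sum>\<gamma>\<in>S. c \<gamma> * chi \<gamma> x) * chi \<beta> x))"
    by (simp only: avg_sum avg_cmult)
  also have "\<dots> = (\<Sum>\<beta>\<in>S. (c \<beta>)\<^sup>2)"
    using assms by (intro sum.cong) (auto simp: avg_fourier_poly_mult_chi subset_iff power2_eq_square)
  finally show ?thesis .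
qed

lemma parseval:
  assumes "\<forall>x\<in>cube n. f x \<in> {- 1, 1}"
  shows "(\<Sum>\<gamma>\<in>cube n. (fourier n f \<gamma>)\<^sup>2) = 1"
proof -
  have "(\<Sum>\<gamma>\<in>cube n. (fourier n f \<gamma>)\<^sup>2) = avg n (\<lambda>x. (real_of_int (f x))\<^sup>2)"
    unfolding avg_fourier_poly_sq[OF subset_refl, symmetric]
    by (intro avg_cong) (simp add: fourier_inversion)
  also have "\<dots> = avg n (\<lambda>x. 1)"
    using assms by (intro avg_cong) force
  finally show ?thesis by simp
qed

lemma fourier_abs_le_1:
  assumes "\<forall>x\<in>cube n. f x \<in> {- 1, 1}" "\<gamma> \<in> cube n"
  shows "\<bar>fourier n f \<gamma>\<bar> \<le> 1"
proof -
  have "(fourier n f \<gamma>)\<^sup>2 \<le> 1"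
    unfolding parseval[OF assms(1), symmetric]
    using assms(2) by (intro member_le_sum) (auto simp: finite_bit_carrier_vec)
  then show ?thesis by (simp add: abs_square_le_1)
qed

text \<open>Plain nested sums instead of an expectation over \<open>replicate_pmf\<close>: linearity
  and exchange of averages become inductions without integrability conditions. The head is averaged
  innermost, matching the recursion of \<open>butterfly\<close> and \<open>hash\<close>;
  \<open>expectation_replicate_cube\<close> connects both views.\<close>

fun avgs :: "nat \<Rightarrow> nat \<Rightarrow> (bit Matrix.vec list \<Rightarrow> real) \<Rightarrow> real" where
  "avgs n 0 F = F []"
| "avgs n (Suc k) F = avgs n k (\<lambda>vs. avg n (\<lambda>v. F (v # vs)))"

definition tuples :: "nat \<Rightarrow> nat \<Rightarrow> bit Matrix.vec list set" where
  "tuples n k = {vs. length vs = k \<and> set vs \<subseteq> cube n}"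

lemma tuples_Cons [simp]: "v # vs \<in> tuples n (Suc k) \<longleftrightarrow> v \<in> cube n \<and> vs \<in> tuples n k"
  by (auto simp: tuples_def)

lemma avgs_cong: "(\<And>vs. vs \<in> tuples n k \<Longrightarrow> F vs = G vs) \<Longrightarrow> avgs n k F = avgs n k G"
proof (induction k arbitrary: F G)
  case 0
  then show ?case by (simp add: tuples_def)
next
  case (Suc k)
  show ?case by (simp, rule Suc.IH, rule avg_cong, rule Suc.prems) simp
qed

lemma avgs_const [simp]: "avgs n k (\<lambda>_. c) = c"
  by (induction k) auto

lemma avgs_add: "avgs n k (\<lambda>x. F x + G x) = avgs n k F + avgs n k G"
  by (induction k arbitrary: F G) (auto simp: avg_add)

lemma avgs_diff: "avgs n k (\<lambda>x. F x - G x) = avgs n k F - avgs n k G"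
  by (induction k arbitrary: F G) (auto simp: avg_diff)

lemma avgs_cmult: "avgs n k (\<lambda>x. c * F x) = c * avgs n k F"
  by (induction k arbitrary: F) (auto simp: avg_cmult)

lemma avgs_sum: "avgs n k (\<lambda>x. \<Sum>i\<in>I. F i x) = (\<Sum>i\<in>I. avgs n k (F i))"
  by (induction k arbitrary: F) (auto simp: avg_sum)

lemma avgs_avg_swap: "avgs n k (\<lambda>vs. avg m (\<lambda>x. F x vs)) = avg m (\<lambda>x. avgs n k (F x))"
  by (induction k arbitrary: F) (auto simp: avg_swap[of n])

text \<open>Up to normalisation, \<open>butterfly f vs x a\<close> is the \<open>a\<close>-th Fourier coefficient of
  \<open>y \<mapsto> f (x + \<Sum>\<^sub>i y\<^sub>i v\<^sub>i)\<close>, and \<open>hash vs \<gamma>\<close> is the index \<open>a\<close> whose binary digits are the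
  products \<open>\<gamma> \<bullet> v\<^sub>i\<close>.\<close>

fun butterfly :: "(bit Matrix.vec \<Rightarrow> int) \<Rightarrow> bit Matrix.vec list \<Rightarrow> bit Matrix.vec \<Rightarrow> nat \<Rightarrow> int" where
  "butterfly f [] x a = f x"
| "butterfly f (v # vs) x a =
     (if even a then butterfly f vs x (a div 2) + butterfly f vs (x + v) (a div 2)
      else butterfly f vs x (a div 2) - butterfly f vs (x + v) (a div 2))"

fun hash :: "bit Matrix.vec list \<Rightarrow> bit Matrix.vec \<Rightarrow> nat" where
  "hash [] \<gamma> = 0"
| "hash (v # vs) \<gamma> = 2 * hash vs \<gamma> + (if chi \<gamma> v = 1 then 0 else 1)"

lemma hash_less: "hash vs \<gamma> < 2 ^ length vs"
  by (induction vs) auto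

lemma hash_Cons_eq_iff:
  "hash (v # vs) \<gamma> = hash (v # vs) \<beta> \<longleftrightarrow> chi \<gamma> v = chi \<beta> v \<and> hash vs \<gamma> = hash vs \<beta>"
  using chi_cases[of \<gamma> v] chi_cases[of \<beta> v] by (auto; presburger)

text \<open>Two frequencies agree on a uniform direction \<open>v\<close> with probability 1/2,
  since the indicator of agreement is \<open>(1 + chi \<gamma> v * chi \<beta> v) / 2\<close> and
  the product of two distinct characters has mean 0. Directions are independent, so each contributes
  a factor 1/2.\<close>

lemma hash_collision:
  assumes "\<gamma> \<in> cube n" "\<beta> \<in> cube n" "\<gamma> \<noteq> \<beta>"
  shows "avgs n k (\<lambda>vs. of_bool (hash vs \<gamma> = hash vs \<beta>)) = 1 / 2 ^ k"
proof (induction k)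
  case 0
  then show ?case by simp
next
  case (Suc k)
  have eq: "of_bool (hash (v # vs) \<gamma> = hash (v # vs) \<beta>)
      = of_bool (hash vs \<gamma> = hash vs \<beta>) * ((1 + chi \<gamma> v * chi \<beta> v) / (2::real))" for v vs
    using chi_cases[of \<gamma> v] chi_cases[of \<beta> v] by (auto simp: hash_Cons_eq_iff simp del: hash.simps)
  have half: "avg n (\<lambda>v. (1 + chi \<gamma> v * chi \<beta> v) / 2) = 1 / 2"
    using avg_cmult[of n "1/2" "\<lambda>v. 1 + chi \<gamma> v * chi \<beta> v"] assms by (simp add: avg_add avg_chi_mult)
  have "avgs n (Suc k) (\<lambda>vs. of_bool (hash vs \<gamma> = hash vs \<beta>))
      = avgs n k (\<lambda>vs. 1 / 2 * of_bool (hash vs \<gamma> = hash vs \<beta>))"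
    unfolding avgs.simps eq avg_cmult half by (simp add: mult.commute)
  then show ?case
    unfolding avgs_cmult Suc by simp
qed

text \<open>One butterfly step is a projection: averaging the values at \<open>x\<close> and
  \<open>x + v\<close> with sign \<open>s\<close> multiplies the term of \<open>\<gamma>\<close> by
  \<open>(1 + s * chi \<gamma> v) / 2\<close>, which is 1 if \<open>chi \<gamma> v = s\<close> and 0
  otherwise. Every step thus imposes one more digit of the hash.\<close>

lemma butterfly_eq_fourier:
  assumes "set vs \<subseteq> cube n" "x \<in> cube n" "a < 2 ^ length vs"
  shows "real_of_int (butterfly f vs x a) / 2 ^ length vs
       = (\<Sum>\<gamma> | \<gamma> \<in> cube n \<and> hash vs \<gamma> = a. fourier n f \<gamma> * chi \<gamma> x)"
  using assms
proof (induction vs arbitrary: x a)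
  case Nil
  then show ?case by (simp add: fourier_inversion)
next
  case (Cons v vs)
  have a: "a div 2 < 2 ^ length vs" using Cons.prems by auto
  have v: "v \<in> cube n" "set vs \<subseteq> cube n" using Cons.prems by auto
  define s :: real where "s = (if even a then 1 else -1)"
  define S where "S = {\<gamma> \<in> cube n. hash vs \<gamma> = a div 2}"
  have fin: "finite S" by (simp add: S_def finite_bit_carrier_vec)
  have IH: "real_of_int (butterfly f vs y (a div 2)) / 2 ^ length vs = (\<Sum>\<gamma>\<in>S. fourier n f \<gamma> * chi \<gamma> y)"
    if "y \<in> cube n" for y
    using Cons.IH[OF v(2) that a] by (simp add: S_def)
  have "real_of_int (butterfly f (v # vs) x a) / 2 ^ length (v # vs)
      = (real_of_int (butterfly f vs x (a div 2)) / 2 ^ length vs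
         + s * (real_of_int (butterfly f vs (x + v) (a div 2)) / 2 ^ length vs)) / 2"
    by (simp add: s_def field_simps)
  also have "\<dots> = (\<Sum>\<gamma>\<in>S. fourier n f \<gamma> * chi \<gamma> x * ((1 + s * chi \<gamma> v) / 2))"
    using v(1) Cons.prems(2)
    by (simp add: IH sum_distrib_left sum.distrib[symmetric] sum_divide_distrib S_def
        chi_add_right[of _ n] algebra_simps add_divide_distrib)
  also have "\<dots> = (\<Sum>\<gamma>\<in>S. if chi \<gamma> v = s then fourier n f \<gamma> * chi \<gamma> x else 0)"
  proof (intro sum.cong refl)
    fix \<gamma>
    show "fourier n f \<gamma> * chi \<gamma> x * ((1 + s * chi \<gamma> v) / 2)
        = (if chi \<gamma> v = s then fourier n f \<gamma> * chi \<gamma> x else 0)"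
      using chi_cases[of \<gamma> v] by (auto simp: s_def)
  qed
  also have "\<dots> = (\<Sum>\<gamma> | \<gamma> \<in> S \<and> chi \<gamma> v = s. fourier n f \<gamma> * chi \<gamma> x)"
    using fin by (simp add: sum.If_cases Int_def conj_commute)
  also have "{\<gamma>. \<gamma> \<in> S \<and> chi \<gamma> v = s} = {\<gamma>. \<gamma> \<in> cube n \<and> hash (v # vs) \<gamma> = a}"
  proof -
    have "hash vs \<gamma> = a div 2 \<and> chi \<gamma> v = s \<longleftrightarrow> hash (v # vs) \<gamma> = a" for \<gamma>
      using chi_cases[of \<gamma> v] by (auto simp: s_def; presburger)
    then show ?thesis by (auto simp: S_def)
  qed
  finally show ?case .
qed

lemma abs_butterfly_le:
  assumes "\<forall>x\<in>cube n. f x \<in> {- 1, 1}" "set vs \<subseteq> cube n" "x \<in> cube n"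
  shows "\<bar>butterfly f vs x a\<bar> \<le> 2 ^ length vs"
  using assms(2,3)
proof (induction vs arbitrary: x a)
  case Nil
  then show ?case using assms(1) by force
next
  case (Cons v vs)
  have "\<bar>butterfly f vs x (a div 2)\<bar> \<le> 2 ^ length vs"
    "\<bar>butterfly f vs (x + v) (a div 2)\<bar> \<le> 2 ^ length vs"
    using Cons.prems by (auto intro: Cons.IH)
  then show ?case by (simp add: abs_le_iff)
qed

subsection \<open>Moments of the restricted coefficients\<close>

definition coset_coeff :: "(bit Matrix.vec \<Rightarrow> int) \<Rightarrow> bit Matrix.vec list \<Rightarrow> bit Matrix.vec \<Rightarrow> nat \<Rightarrow> real" where
  "coset_coeff f vs x a = real_of_int (butterfly f vs x a) / 2 ^ length vs"

lemma coset_coeff_Cons: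
  "coset_coeff f (v # vs) x (2 * a) = (coset_coeff f vs x a + coset_coeff f vs (x + v) a) / 2"
  "coset_coeff f (v # vs) x (Suc (2 * a)) = (coset_coeff f vs x a - coset_coeff f vs (x + v) a) / 2"
  by (simp_all add: coset_coeff_def field_simps)

lemma sum_lessThan_double: "(\<Sum>a<2 * m. F a) = (\<Sum>a<m. F (2 * a) + F (Suc (2 * a)))" for m :: nat
  by (induction m) (auto simp: algebra_simps)

text \<open>The odd mixed terms cancel in the sum over the two signs. For uniform \<open>v\<close>
  the value \<open>p (x + v)\<close> is independent of \<open>p x\<close>, so the remaining mixed
  term factors into the square of the second moment.\<close>

lemma avg_fourth_power_step:
  "avg n (\<lambda>v. avg n (\<lambda>x. ((p x + p (x + v)) / 2) ^ 4 + ((p x - p (x + v)) / 2) ^ 4))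
   = avg n (\<lambda>x. p x ^ 4) / 4 + 3 / 4 * (avg n (\<lambda>x. (p x)\<^sup>2))\<^sup>2"
proof -
  have alg: "((a + b) / 2) ^ 4 + ((a - b) / 2) ^ 4 = 1 / 8 * a ^ 4 + (3 / 4 * (a\<^sup>2 * b\<^sup>2) + 1 / 8 * b ^ 4)"
    for a b :: real by (simp add: power4_eq_xxxx power2_eq_square field_simps)
  have "avg n (\<lambda>v. avg n (\<lambda>x. (p x)\<^sup>2 * (p (x + v))\<^sup>2)) = avg n (\<lambda>x. (p x)\<^sup>2 * avg n (\<lambda>v. (p (x + v))\<^sup>2))"
    by (subst avg_swap) (simp add: avg_cmult)
  also have "\<dots> = avg n (\<lambda>x. avg n (\<lambda>x. (p x)\<^sup>2) * (p x)\<^sup>2)"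
    by (intro avg_cong) (simp add: avg_translate'[of _ n "\<lambda>y. (p y)\<^sup>2"])
  also have "\<dots> = (avg n (\<lambda>x. (p x)\<^sup>2))\<^sup>2"
    by (simp add: avg_cmult power2_eq_square)
  finally have mixed: "avg n (\<lambda>v. avg n (\<lambda>x. (p x)\<^sup>2 * (p (x + v))\<^sup>2)) = (avg n (\<lambda>x. (p x)\<^sup>2))\<^sup>2" .
  have "avg n (\<lambda>v. avg n (\<lambda>x. p (x + v) ^ 4)) = avg n (\<lambda>v. avg n (\<lambda>x. p x ^ 4))"
    by (intro avg_cong avg_translate[of _ n "\<lambda>x. p x ^ 4"])
  then show ?thesis
    unfolding alg avg_add avg_cmult mixed by simp
qed

context
  fixes n :: nat and f :: "bit Matrix.vec \<Rightarrow> int"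
  assumes boolean: "\<forall>x\<in>cube n. f x \<in> {- 1, 1}"
begin

lemma coset_coeff_eq_fourier:
  assumes "vs \<in> tuples n k" "x \<in> cube n" "a < 2 ^ k"
  shows "coset_coeff f vs x a = (\<Sum>\<gamma> | \<gamma> \<in> cube n \<and> hash vs \<gamma> = a. fourier n f \<gamma> * chi \<gamma> x)"
  unfolding coset_coeff_def using assms
  by (intro butterfly_eq_fourier) (auto simp: tuples_def)

text \<open>Averaging over the origin \<open>x\<close> removes the cross terms between distinct
  characters and leaves the Fourier weight of the hash class.\<close>

lemma avg_coset_coeff_sq:
  assumes "vs \<in> tuples n k" "a < 2 ^ k"
  shows "avg n (\<lambda>x. (coset_coeff f vs x a)\<^sup>2) = (\<Sum>\<gamma>\<in>cube n. (fourier n f \<gamma>)\<^sup>2 * of_bool (hash vs \<gamma> = a))"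
proof -
  have "avg n (\<lambda>x. (coset_coeff f vs x a)\<^sup>2)
      = avg n (\<lambda>x. (\<Sum>\<gamma> | \<gamma> \<in> cube n \<and> hash vs \<gamma> = a. fourier n f \<gamma> * chi \<gamma> x)\<^sup>2)"
    using assms by (intro avg_cong) (simp add: coset_coeff_eq_fourier)
  also have "\<dots> = (\<Sum>\<gamma> | \<gamma> \<in> cube n \<and> hash vs \<gamma> = a. (fourier n f \<gamma>)\<^sup>2)"
    by (rule avg_fourier_poly_sq) auto
  also have "\<dots> = (\<Sum>\<gamma>\<in>cube n. (fourier n f \<gamma>)\<^sup>2 * of_bool (hash vs \<gamma> = a))"
    by (rule sum.mono_neutral_cong_left) (auto simp: finite_bit_carrier_vec)
  finally show ?thesis .
qed

lemma avgs_hash_eq_le: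
  assumes "\<gamma> \<in> cube n" "\<beta> \<in> cube n"
  shows "avgs n k (\<lambda>vs. of_bool (hash vs \<gamma> = hash vs \<beta>)) \<le> of_bool (\<gamma> = \<beta>) + 1 / 2 ^ k"
  using hash_collision[OF assms] by (cases "\<gamma> = \<beta>") auto

text \<open>Squaring the weight of a hash class gives a sum over ordered pairs of frequencies that
  share it. The diagonal pairs yield the fourth powers; the others collide with probability
  \<open>1 / 2 ^ k\<close> and have total weight at most 1 by Parseval.\<close>

lemma second_moment_sq_le:
  "avgs n k (\<lambda>vs. \<Sum>a<2 ^ k. (avg n (\<lambda>x. (coset_coeff f vs x a)\<^sup>2))\<^sup>2)
   \<le> (\<Sum>\<gamma>\<in>cube n. (fourier n f \<gamma>) ^ 4) + 1 / 2 ^ k"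
proof -
  define w where "w \<gamma> = (fourier n f \<gamma>)\<^sup>2" for \<gamma>
  have w: "(\<Sum>\<gamma>\<in>cube n. w \<gamma>) = 1" unfolding w_def by (rule parseval[OF boolean])
  have "avgs n k (\<lambda>vs. \<Sum>a<2 ^ k. (avg n (\<lambda>x. (coset_coeff f vs x a)\<^sup>2))\<^sup>2)
      = avgs n k (\<lambda>vs. \<Sum>\<gamma>\<in>cube n. \<Sum>\<beta>\<in>cube n. (w \<gamma> * w \<beta>) * of_bool (hash vs \<gamma> = hash vs \<beta>))"
  proof (rule avgs_cong)
    fix vs assume vs: "vs \<in> tuples n k"
    have "(\<Sum>a<2 ^ k. (avg n (\<lambda>x. (coset_coeff f vs x a)\<^sup>2))\<^sup>2)
        = (\<Sum>a<2 ^ k. \<Sum>\<gamma>\<in>cube n. \<Sum>\<beta>\<in>cube n.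
            (w \<gamma> * w \<beta>) * (of_bool (hash vs \<gamma> = a) * of_bool (hash vs \<beta> = a)))"
    proof (intro sum.cong refl)
      fix a :: nat assume "a \<in> {..<2 ^ k}"
      then have "avg n (\<lambda>x. (coset_coeff f vs x a)\<^sup>2) = (\<Sum>\<gamma>\<in>cube n. w \<gamma> * of_bool (hash vs \<gamma> = a))"
        using avg_coset_coeff_sq[OF vs, of a] by (simp add: w_def)
      then show "(avg n (\<lambda>x. (coset_coeff f vs x a)\<^sup>2))\<^sup>2 = (\<Sum>\<gamma>\<in>cube n. \<Sum>\<beta>\<in>cube n.
            (w \<gamma> * w \<beta>) * (of_bool (hash vs \<gamma> = a) * of_bool (hash vs \<beta> = a)))"
        by (simp only: power2_eq_square sum_product) (simp only: mult_ac)
    qed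
    also have "\<dots> = (\<Sum>\<gamma>\<in>cube n. \<Sum>\<beta>\<in>cube n. \<Sum>a<2 ^ k.
            (w \<gamma> * w \<beta>) * (of_bool (hash vs \<gamma> = a) * of_bool (hash vs \<beta> = a)))"
      by (subst sum.swap) (intro sum.cong refl sum.swap)
    also have "\<dots> = (\<Sum>\<gamma>\<in>cube n. \<Sum>\<beta>\<in>cube n. (w \<gamma> * w \<beta>) * of_bool (hash vs \<gamma> = hash vs \<beta>))"
    proof (intro sum.cong refl)
      fix \<gamma> \<beta> :: "bit Matrix.vec"
      have "hash vs \<gamma> < 2 ^ k" using vs hash_less[of vs \<gamma>] by (simp add: tuples_def)
      moreover have "(\<Sum>a<2 ^ k. of_bool (hash vs \<gamma> = a) * of_bool (hash vs \<beta> = a))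
          = (\<Sum>a<2 ^ k. if hash vs \<gamma> = a then of_bool (hash vs \<gamma> = hash vs \<beta>) else (0::real))"
        by (intro sum.cong) auto
      ultimately show "(\<Sum>a<2 ^ k. (w \<gamma> * w \<beta>) * (of_bool (hash vs \<gamma> = a) * of_bool (hash vs \<beta> = a)))
          = (w \<gamma> * w \<beta>) * of_bool (hash vs \<gamma> = hash vs \<beta>)"
        unfolding sum_distrib_left[symmetric] by simp
    qed
    finally show "(\<Sum>a<2 ^ k. (avg n (\<lambda>x. (coset_coeff f vs x a)\<^sup>2))\<^sup>2)
        = (\<Sum>\<gamma>\<in>cube n. \<Sum>\<beta>\<in>cube n. (w \<gamma> * w \<beta>) * of_bool (hash vs \<gamma> = hash vs \<beta>))" .
  qed
  also have "\<dots> = (\<Sum>\<gamma>\<in>cube n. \<Sum>\<beta>\<in>cube n. (w \<gamma> * w \<beta>) *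
      avgs n k (\<lambda>vs. of_bool (hash vs \<gamma> = hash vs \<beta>)))"
    by (simp only: avgs_sum avgs_cmult)
  also have "\<dots> \<le> (\<Sum>\<gamma>\<in>cube n. \<Sum>\<beta>\<in>cube n. (w \<gamma> * w \<beta>) * (of_bool (\<gamma> = \<beta>) + 1 / 2 ^ k))"
    by (intro sum_mono mult_left_mono avgs_hash_eq_le) (auto simp: w_def)
  also have "\<dots> = (\<Sum>\<gamma>\<in>cube n. \<Sum>\<beta>\<in>cube n. if \<gamma> = \<beta> then w \<gamma> * w \<beta> else 0)
      + (\<Sum>\<gamma>\<in>cube n. \<Sum>\<beta>\<in>cube n. w \<gamma> * w \<beta>) / 2 ^ k"
    unfolding sum_divide_distrib sum.distrib[symmetric]
    by (intro sum.cong refl) (simp add: distrib_left)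
  also have "(\<Sum>\<gamma>\<in>cube n. \<Sum>\<beta>\<in>cube n. w \<gamma> * w \<beta>) = 1"
    unfolding sum_product[symmetric] w by simp
  also have "(\<Sum>\<gamma>\<in>cube n. \<Sum>\<beta>\<in>cube n. if \<gamma> = \<beta> then w \<gamma> * w \<beta> else 0)
      = (\<Sum>\<gamma>\<in>cube n. (fourier n f \<gamma>) ^ 4)"
    by (intro sum.cong refl) (simp add: finite_bit_carrier_vec w_def flip: power_add)
  finally show ?thesis .
qed

text \<open>Adding a direction turns the fourth moment \<open>A\<close> into \<open>A/4 + 3B/4\<close>, where \<open>B\<close> is the sum of the
  squared second moments; \<open>B\<close> tends to the sum of the fourth powers.\<close>

lemma fourth_moment_le:
  "avgs n k (\<lambda>vs. avg n (\<lambda>x. \<Sum>a<2 ^ k. (coset_coeff f vs x a) ^ 4))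
   \<le> (\<Sum>\<gamma>\<in>cube n. (fourier n f \<gamma>) ^ 4) + 3 / 2 ^ k"
proof (induction k)
  case 0
  have "avg n (\<lambda>x. (coset_coeff f [] x 0) ^ 4) = avg n (\<lambda>x. 1)"
    using boolean by (intro avg_cong) (force simp: coset_coeff_def)
  moreover have "0 \<le> (\<Sum>\<gamma>\<in>cube n. (fourier n f \<gamma>) ^ 4)"
    by (intro sum_nonneg) simp
  ultimately show ?case by (simp add: lessThan_Suc)
next
  case (Suc k)
  have step: "avg n (\<lambda>v. avg n (\<lambda>x. \<Sum>a<2 ^ Suc k. (coset_coeff f (v # vs) x a) ^ 4))
      = 1 / 4 * avg n (\<lambda>x. \<Sum>a<2 ^ k. (coset_coeff f vs x a) ^ 4)
        + 3 / 4 * (\<Sum>a<2 ^ k. (avg n (\<lambda>x. (coset_coeff f vs x a)\<^sup>2))\<^sup>2)" for vs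
    unfolding power_Suc sum_lessThan_double coset_coeff_Cons avg_sum
      avg_fourth_power_step[of n "\<lambda>x. coset_coeff f vs x _"]
    by (simp add: sum.distrib sum_distrib_left)
  \<comment> \<open>The recursion turns an excess \<open>c / 2 ^ k\<close> into
    \<open>(c / 4 + 3 / 4) / 2 ^ k\<close>, which equals \<open>c / 2 ^ Suc k\<close> exactly for
    \<open>c = 3\<close>; hence the constant.\<close>
  show ?case
    unfolding avgs.simps step avgs_add avgs_cmult
    using Suc second_moment_sq_le[of k] by (simp add: field_simps)
qed

text \<open>The factor \<open>chi \<gamma> x\<close> undoes the sign that the random origin puts on
  the term of \<open>\<gamma>\<close>. This makes the estimate unbiased for every choice of
  directions, without changing its absolute value.\<close>

definition est :: "bit Matrix.vec list \<Rightarrow> bit Matrix.vec \<Rightarrow> bit Matrix.vec \<Rightarrow> real" where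
  "est vs x \<gamma> = coset_coeff f vs x (hash vs \<gamma>) * chi \<gamma> x"

lemma avg_est:
  assumes "vs \<in> tuples n k" "\<gamma> \<in> cube n"
  shows "avg n (\<lambda>x. est vs x \<gamma>) = fourier n f \<gamma>"
proof -
  have h: "hash vs \<gamma> < 2 ^ k" using assms(1) hash_less[of vs \<gamma>] by (simp add: tuples_def)
  have "avg n (\<lambda>x. est vs x \<gamma>) = avg n (\<lambda>x.
      (\<Sum>\<beta> | \<beta> \<in> cube n \<and> hash vs \<beta> = hash vs \<gamma>. fourier n f \<beta> * chi \<beta> x) * chi \<gamma> x)"
    unfolding est_def using assms h by (intro avg_cong) (simp add: coset_coeff_eq_fourier)
  also have "\<dots> = fourier n f \<gamma>"
    using assms by (subst avg_fourier_poly_mult_chi) auto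
  finally show ?thesis .
qed

text \<open>For fixed directions the inner average is a variance, namely the Fourier weight of the
  other frequencies in the hash class of \<open>\<gamma>\<close>. Each of them falls there with
  probability \<open>1 / 2 ^ k\<close>, and the total weight is 1.\<close>

lemma est_deviation:
  assumes "\<gamma> \<in> cube n"
  shows "avgs n k (\<lambda>vs. avg n (\<lambda>x. (est vs x \<gamma> - fourier n f \<gamma>)\<^sup>2)) \<le> 1 / 2 ^ k"
proof -
  let ?F = "fourier n f"
  have "avgs n k (\<lambda>vs. avg n (\<lambda>x. (est vs x \<gamma> - ?F \<gamma>)\<^sup>2))
      = avgs n k (\<lambda>vs. (\<Sum>\<beta>\<in>cube n. (?F \<beta>)\<^sup>2 * of_bool (hash vs \<beta> = hash vs \<gamma>)) - (?F \<gamma>)\<^sup>2)"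
  proof (rule avgs_cong)
    fix vs assume vs: "vs \<in> tuples n k"
    then have h: "hash vs \<gamma> < 2 ^ k" using hash_less[of vs \<gamma>] by (simp add: tuples_def)
    have "avg n (\<lambda>x. (est vs x \<gamma> - ?F \<gamma>)\<^sup>2)
        = avg n (\<lambda>x. (coset_coeff f vs x (hash vs \<gamma>))\<^sup>2 - (2 * ?F \<gamma> * est vs x \<gamma> - (?F \<gamma>)\<^sup>2))"
      by (intro avg_cong) (simp add: power2_diff est_def power_mult_distrib)
    also have "\<dots> = avg n (\<lambda>x. (coset_coeff f vs x (hash vs \<gamma>))\<^sup>2) - (?F \<gamma>)\<^sup>2"
      unfolding avg_diff avg_cmult using vs assms by (simp add: avg_est power2_eq_square)
    finally show "avg n (\<lambda>x. (est vs x \<gamma> - ?F \<gamma>)\<^sup>2)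
        = (\<Sum>\<beta>\<in>cube n. (?F \<beta>)\<^sup>2 * of_bool (hash vs \<beta> = hash vs \<gamma>)) - (?F \<gamma>)\<^sup>2"
      using avg_coset_coeff_sq[OF vs h] by simp
  qed
  also have "\<dots> = (\<Sum>\<beta>\<in>cube n. (?F \<beta>)\<^sup>2 * avgs n k (\<lambda>vs. of_bool (hash vs \<beta> = hash vs \<gamma>))) - (?F \<gamma>)\<^sup>2"
    by (simp only: avgs_diff avgs_sum avgs_cmult avgs_const)
  also have "\<dots> \<le> (\<Sum>\<beta>\<in>cube n. (?F \<beta>)\<^sup>2 * (of_bool (\<beta> = \<gamma>) + 1 / 2 ^ k)) - (?F \<gamma>)\<^sup>2"
    using assms by (intro diff_right_mono sum_mono mult_left_mono avgs_hash_eq_le) auto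
  also have "\<dots> = (\<Sum>\<beta>\<in>cube n. if \<beta> = \<gamma> then (?F \<beta>)\<^sup>2 else 0) + (\<Sum>\<beta>\<in>cube n. (?F \<beta>)\<^sup>2) / 2 ^ k - (?F \<gamma>)\<^sup>2"
    unfolding sum_divide_distrib sum.distrib[symmetric]
    by (intro arg_cong2[of _ _ _ _ minus] sum.cong refl) (simp add: distrib_left)
  also have "\<dots> = 1 / 2 ^ k"
    using assms by (simp add: finite_bit_carrier_vec parseval[OF boolean])
  finally show ?thesis .
qed

text \<open>The second sum linearises the fourth powers of the heavy estimates at their means, so that
  its mean is exact; by convexity it is a lower bound for the heavy part of the first sum unless
  heavy frequencies collide, which the third sum penalises by more than the possible loss of 4.\<close>

definition potential :: "bit Matrix.vec set \<Rightarrow> nat \<Rightarrow> bit Matrix.vec list \<Rightarrow> bit Matrix.vec \<Rightarrow> real" where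
  "potential H k vs x =
     (\<Sum>a<2 ^ k. (coset_coeff f vs x a) ^ 4)
     - (\<Sum>\<gamma>\<in>H. 4 * (fourier n f \<gamma>) ^ 3 * est vs x \<gamma> - 3 * (fourier n f \<gamma>) ^ 4)
     + 5 * (\<Sum>\<gamma>\<in>H. \<Sum>\<beta>\<in>H - {\<gamma>}. of_bool (hash vs \<gamma> = hash vs \<beta>))
     + (\<Sum>\<gamma>\<in>H. (est vs x \<gamma> - fourier n f \<gamma>)\<^sup>2)"

text \<open>By unbiasedness the linearised sum has the heavy fourth powers as its mean, and they
  cancel in the bound on the fourth moment. What remains is the light part and three errors over
  \<open>2 ^ k\<close>: 3 from the fourth moment, \<open>5 * (card H)\<^sup>2\<close> from colliding
  pairs and \<open>card H\<close> from the variances.\<close>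

lemma potential_mean:
  assumes H: "H \<subseteq> cube n"
  shows "avgs n k (\<lambda>vs. avg n (potential H k vs))
    \<le> (\<Sum>\<gamma>\<in>cube n - H. (fourier n f \<gamma>) ^ 4) + (3 + 5 * (real (card H))\<^sup>2 + real (card H)) / 2 ^ k"
proof -
  let ?F = "fourier n f"
  have fin: "finite H" using H finite_bit_carrier_vec finite_subset by blast
  have "avgs n k (\<lambda>vs. avg n (\<lambda>x. \<Sum>\<gamma>\<in>H. 4 * (?F \<gamma>) ^ 3 * est vs x \<gamma> - 3 * (?F \<gamma>) ^ 4))
      = avgs n k (\<lambda>vs. \<Sum>\<gamma>\<in>H. (?F \<gamma>) ^ 4)"
  proof (rule avgs_cong)
    fix vs assume "vs \<in> tuples n k"
    then show "avg n (\<lambda>x. \<Sum>\<gamma>\<in>H. 4 * (?F \<gamma>) ^ 3 * est vs x \<gamma> - 3 * (?F \<gamma>) ^ 4) = (\<Sum>\<gamma>\<in>H. (?F \<gamma>) ^ 4)"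
      unfolding avg_sum avg_diff avg_cmult
      using H by (intro sum.cong refl) (auto simp: avg_est power3_eq_cube power4_eq_xxxx)
  qed
  then have 1: "avgs n k (\<lambda>vs. avg n (\<lambda>x. \<Sum>\<gamma>\<in>H. 4 * (?F \<gamma>) ^ 3 * est vs x \<gamma> - 3 * (?F \<gamma>) ^ 4))
      = (\<Sum>\<gamma>\<in>H. (?F \<gamma>) ^ 4)" by simp
  have "avgs n k (\<lambda>vs. avg n (\<lambda>x. 5 * (\<Sum>\<gamma>\<in>H. \<Sum>\<beta>\<in>H - {\<gamma>}. of_bool (hash vs \<gamma> = hash vs \<beta>))))
      = 5 * (\<Sum>\<gamma>\<in>H. \<Sum>\<beta>\<in>H - {\<gamma>}. 1 / 2 ^ k)"
    unfolding avg_const avgs_cmult avgs_sum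
    using H by (intro arg_cong[of _ _ "(*) 5"] sum.cong refl hash_collision) auto
  also have "\<dots> \<le> 5 * (\<Sum>\<gamma>\<in>H. \<Sum>\<beta>\<in>H. 1 / 2 ^ k)"
    using fin by (intro mult_left_mono sum_mono sum_mono2) auto
  finally have 2: "avgs n k (\<lambda>vs. avg n (\<lambda>x. 5 * (\<Sum>\<gamma>\<in>H. \<Sum>\<beta>\<in>H - {\<gamma>}. of_bool (hash vs \<gamma> = hash vs \<beta>))))
      \<le> 5 * (real (card H))\<^sup>2 / 2 ^ k"
    by (simp add: power2_eq_square)
  have 3: "avgs n k (\<lambda>vs. avg n (\<lambda>x. \<Sum>\<gamma>\<in>H. (est vs x \<gamma> - ?F \<gamma>)\<^sup>2)) \<le> card H / 2 ^ k"
  proof -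
    have "avgs n k (\<lambda>vs. avg n (\<lambda>x. \<Sum>\<gamma>\<in>H. (est vs x \<gamma> - ?F \<gamma>)\<^sup>2)) \<le> (\<Sum>\<gamma>\<in>H. 1 / 2 ^ k)"
      unfolding avg_sum avgs_sum using H by (intro sum_mono est_deviation) auto
    then show ?thesis by simp
  qed
  have 4: "(\<Sum>\<gamma>\<in>cube n. (?F \<gamma>) ^ 4) - (\<Sum>\<gamma>\<in>H. (?F \<gamma>) ^ 4) = (\<Sum>\<gamma>\<in>cube n - H. (?F \<gamma>) ^ 4)"
    by (rule sum_diff[symmetric]) (use H finite_bit_carrier_vec in auto)
  show ?thesis
    using 1 2 3 4 fourth_moment_le[of k]
    unfolding potential_def avg_add avg_diff avgs_add avgs_diff add_divide_distrib by linarith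
qed

lemma abs_coset_coeff_le_1:
  assumes "vs \<in> tuples n k" "x \<in> cube n"
  shows "\<bar>coset_coeff f vs x a\<bar> \<le> 1"
proof -
  have "\<bar>butterfly f vs x a\<bar> \<le> 2 ^ length vs"
    using assms boolean by (intro abs_butterfly_le) (auto simp: tuples_def)
  then have "real_of_int \<bar>butterfly f vs x a\<bar> \<le> real_of_int (2 ^ length vs)"
    by (simp only: of_int_le_iff)
  then show ?thesis by (simp add: coset_coeff_def)
qed

lemma collision_potential_ge_1:
  assumes H: "H \<subseteq> cube n" and vs: "vs \<in> tuples n k" and x: "x \<in> cube n" and coll: "\<not> inj_on (hash vs) H"
  shows "potential H k vs x \<ge> 1"
proof -
  let ?F = "fourier n f"
  have fin: "finite H" using H finite_bit_carrier_vec finite_subset by blast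
  obtain \<gamma> \<beta> where c: "\<gamma> \<in> H" "\<beta> \<in> H - {\<gamma>}" "hash vs \<gamma> = hash vs \<beta>"
    using coll by (auto simp: inj_on_def)
  have "1 \<le> (\<Sum>\<beta>\<in>H - {\<gamma>}. of_bool (hash vs \<gamma> = hash vs \<beta>) :: real)"
    using member_le_sum[of \<beta> "H - {\<gamma>}" "\<lambda>\<beta>. of_bool (hash vs \<gamma> = hash vs \<beta>) :: real"] c fin by simp
  also have "\<dots> \<le> (\<Sum>\<gamma>\<in>H. \<Sum>\<beta>\<in>H - {\<gamma>}. of_bool (hash vs \<gamma> = hash vs \<beta>))"
    using c fin by (intro member_le_sum[of \<gamma> H "\<lambda>\<gamma>. \<Sum>\<beta>\<in>H - {\<gamma>}. of_bool (hash vs \<gamma> = hash vs \<beta>)"] sum_nonneg) auto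
  finally have 1: "1 \<le> (\<Sum>\<gamma>\<in>H. \<Sum>\<beta>\<in>H - {\<gamma>}. of_bool (hash vs \<gamma> = hash vs \<beta>) :: real)" .
  have "(\<Sum>\<gamma>\<in>H. 4 * (?F \<gamma>) ^ 3 * est vs x \<gamma> - 3 * (?F \<gamma>) ^ 4) \<le> (\<Sum>\<gamma>\<in>H. 4 * (?F \<gamma>)\<^sup>2)"
  proof (rule sum_mono)
    fix \<gamma> assume "\<gamma> \<in> H"
    then have F: "\<bar>?F \<gamma>\<bar> \<le> 1" using H fourier_abs_le_1[OF boolean] by auto
    have u: "\<bar>est vs x \<gamma>\<bar> \<le> 1"
      unfolding est_def abs_mult using abs_coset_coeff_le_1[OF vs x] by simp
    have "(?F \<gamma>) ^ 3 * est vs x \<gamma> \<le> \<bar>(?F \<gamma>) ^ 3 * est vs x \<gamma>\<bar>" by simp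
    also have "\<dots> = (?F \<gamma>)\<^sup>2 * (\<bar>?F \<gamma>\<bar> * \<bar>est vs x \<gamma>\<bar>)"
      by (simp add: abs_mult power3_eq_cube power2_eq_square)
    also have "\<dots> \<le> (?F \<gamma>)\<^sup>2 * 1"
      using F u by (intro mult_left_mono) (auto intro: mult_le_one)
    finally have "(?F \<gamma>) ^ 3 * est vs x \<gamma> \<le> (?F \<gamma>)\<^sup>2" by simp
    then show "4 * (?F \<gamma>) ^ 3 * est vs x \<gamma> - 3 * (?F \<gamma>) ^ 4 \<le> 4 * (?F \<gamma>)\<^sup>2"
      using zero_le_even_power[of 4 "?F \<gamma>", OF even_numeral] by (simp only: mult.assoc)
  qed
  also have "\<dots> \<le> 4 * (\<Sum>\<gamma>\<in>cube n. (?F \<gamma>)\<^sup>2)"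
    using H finite_bit_carrier_vec by (auto simp: sum_distrib_left[symmetric] intro: sum_mono2)
  finally have 2: "(\<Sum>\<gamma>\<in>H. 4 * (?F \<gamma>) ^ 3 * est vs x \<gamma> - 3 * (?F \<gamma>) ^ 4) \<le> 4"
    by (simp add: parseval[OF boolean])
  have "0 \<le> (\<Sum>a<2 ^ k. (coset_coeff f vs x a) ^ 4)" "0 \<le> (\<Sum>\<gamma>\<in>H. (est vs x \<gamma> - ?F \<gamma>)\<^sup>2)"
    by (intro sum_nonneg; simp)+
  with 1 2 show ?thesis unfolding potential_def by linarith
qed

text \<open>The left side is the tangent of the convex function \<open>u ^ 4\<close> at
  \<open>c\<close>; the gap has the double root \<open>c\<close>, and the remaining quadratic factor
  is a sum of squares.\<close>

lemma fourth_power_tangent: "4 * c ^ 3 * u - 3 * c ^ 4 \<le> u ^ 4" for c u :: real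
proof -
  have "u ^ 4 - (4 * c ^ 3 * u - 3 * c ^ 4) = (u - c)\<^sup>2 * ((u + c)\<^sup>2 + 2 * c\<^sup>2)"
    by (simp add: power4_eq_xxxx power3_eq_cube power2_eq_square algebra_simps)
  also have "\<dots> \<ge> 0" by (intro mult_nonneg_nonneg) auto
  finally show ?thesis by simp
qed

text \<open>Distinct heavy frequencies own distinct table entries here, so the tangent bound charges
  each linearised term to its own entry. The entries left over and the deviations survive as a lower
  bound.\<close>

lemma injective_potential_ge:
  assumes H: "H \<subseteq> cube n" and vs: "vs \<in> tuples n k" and inj: "inj_on (hash vs) H"
  shows "(\<Sum>a\<in>{..<2 ^ k} - hash vs ` H. (coset_coeff f vs x a) ^ 4)
         + (\<Sum>\<gamma>\<in>H. (est vs x \<gamma> - fourier n f \<gamma>)\<^sup>2) \<le> potential H k vs x"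
proof -
  let ?F = "fourier n f"
  have sub: "hash vs ` H \<subseteq> {..<2 ^ k}" using vs hash_less by (auto simp: tuples_def)
  have "(\<Sum>\<gamma>\<in>H. 4 * (?F \<gamma>) ^ 3 * est vs x \<gamma> - 3 * (?F \<gamma>) ^ 4) \<le> (\<Sum>\<gamma>\<in>H. (est vs x \<gamma>) ^ 4)"
    by (intro sum_mono fourth_power_tangent)
  also have "\<dots> = (\<Sum>\<gamma>\<in>H. (coset_coeff f vs x (hash vs \<gamma>)) ^ 4)"
  proof (intro sum.cong refl)
    fix \<gamma> show "(est vs x \<gamma>) ^ 4 = (coset_coeff f vs x (hash vs \<gamma>)) ^ 4"
      using chi_cases[of \<gamma> x] by (auto simp: est_def)
  qed
  also have "\<dots> = (\<Sum>a\<in>hash vs ` H. (coset_coeff f vs x a) ^ 4)"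
    by (simp add: sum.reindex[OF inj])
  finally have "(\<Sum>\<gamma>\<in>H. 4 * (?F \<gamma>) ^ 3 * est vs x \<gamma> - 3 * (?F \<gamma>) ^ 4)
      \<le> (\<Sum>a\<in>hash vs ` H. (coset_coeff f vs x a) ^ 4)" .
  moreover have "(\<Sum>a\<in>{..<2 ^ k} - hash vs ` H. (coset_coeff f vs x a) ^ 4)
      = (\<Sum>a<2 ^ k. (coset_coeff f vs x a) ^ 4) - (\<Sum>a\<in>hash vs ` H. (coset_coeff f vs x a) ^ 4)"
    by (rule sum_diff) (use sub in auto)
  moreover have "0 \<le> (\<Sum>\<gamma>\<in>H. \<Sum>\<beta>\<in>H - {\<gamma>}. of_bool (hash vs \<gamma> = hash vs \<beta>) :: real)"
    by (intro sum_nonneg) simp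
  ultimately show ?thesis unfolding potential_def by linarith
qed

lemma potential_nonneg:
  assumes H: "H \<subseteq> cube n" and vs: "vs \<in> tuples n k" and x: "x \<in> cube n"
  shows "potential H k vs x \<ge> 0"
proof (cases "inj_on (hash vs) H")
  case True
  have "0 \<le> (\<Sum>a\<in>{..<2 ^ k} - hash vs ` H. (coset_coeff f vs x a) ^ 4)"
    "0 \<le> (\<Sum>\<gamma>\<in>H. (est vs x \<gamma> - fourier n f \<gamma>)\<^sup>2)"
    by (intro sum_nonneg; simp)+
  with injective_potential_ge[OF H vs True, of x] show ?thesis by linarith
next
  case False
  then show ?thesis using collision_potential_ge_1[OF H vs x] by simp
qed

text \<open>A sum of nonnegative terms below \<open>\<epsilon> ^ 4\<close> bounds each term: light
  entries via fourth roots, heavy deviations via square roots and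
  \<open>\<epsilon> ^ 4 \<le> \<epsilon>\<^sup>2\<close>. As \<open>\<epsilon> ^ 4 \<le> 1\<close>,
  a collision alone would exceed the budget.\<close>

lemma small_potential:
  assumes H: "H \<subseteq> cube n" and vs: "vs \<in> tuples n k" and x: "x \<in> cube n"
    and small: "potential H k vs x < \<epsilon> ^ 4" and eps: "0 < \<epsilon>" "\<epsilon> \<le> 1"
  shows "inj_on (hash vs) H"
    and "\<And>\<gamma>. \<gamma> \<in> H \<Longrightarrow> \<bar>\<bar>coset_coeff f vs x (hash vs \<gamma>)\<bar> - \<bar>fourier n f \<gamma>\<bar>\<bar> < \<epsilon>"
    and "\<And>a. a < 2 ^ k \<Longrightarrow> a \<notin> hash vs ` H \<Longrightarrow> \<bar>coset_coeff f vs x a\<bar> < \<epsilon>"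
proof -
  have "\<epsilon> ^ 4 \<le> 1" "\<epsilon> ^ 4 \<le> \<epsilon>\<^sup>2" using eps by (auto intro: power_le_one power_decreasing)
  then show inj: "inj_on (hash vs) H"
    using collision_potential_ge_1[OF H vs x] small by fastforce
  have fin: "finite H" using H finite_bit_carrier_vec finite_subset by blast
  note ge = injective_potential_ge[OF H vs inj, of x]
  have nn: "0 \<le> (\<Sum>a\<in>{..<2 ^ k} - hash vs ` H. (coset_coeff f vs x a) ^ 4)"
    "0 \<le> (\<Sum>\<gamma>\<in>H. (est vs x \<gamma> - fourier n f \<gamma>)\<^sup>2)"
    by (intro sum_nonneg; simp)+
  show "\<bar>\<bar>coset_coeff f vs x (hash vs \<gamma>)\<bar> - \<bar>fourier n f \<gamma>\<bar>\<bar> < \<epsilon>" if \<gamma>: "\<gamma> \<in> H" for \<gamma>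
  proof -
    have "(est vs x \<gamma> - fourier n f \<gamma>)\<^sup>2 \<le> (\<Sum>\<gamma>\<in>H. (est vs x \<gamma> - fourier n f \<gamma>)\<^sup>2)"
      using \<gamma> fin by (intro member_le_sum) auto
    then have "(est vs x \<gamma> - fourier n f \<gamma>)\<^sup>2 < \<epsilon>\<^sup>2"
      using ge nn small \<open>\<epsilon> ^ 4 \<le> \<epsilon>\<^sup>2\<close> by linarith
    then have "\<bar>est vs x \<gamma> - fourier n f \<gamma>\<bar> < \<epsilon>"
      using eps abs_le_square_iff[of \<epsilon> "est vs x \<gamma> - fourier n f \<gamma>"] by linarith
    moreover have "\<bar>est vs x \<gamma>\<bar> = \<bar>coset_coeff f vs x (hash vs \<gamma>)\<bar>"
      by (simp add: est_def abs_mult)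
    ultimately show ?thesis by linarith
  qed
  show "\<bar>coset_coeff f vs x a\<bar> < \<epsilon>" if a: "a < 2 ^ k" "a \<notin> hash vs ` H" for a
  proof -
    have "(coset_coeff f vs x a) ^ 4 \<le> (\<Sum>a\<in>{..<2 ^ k} - hash vs ` H. (coset_coeff f vs x a) ^ 4)"
      using a by (intro member_le_sum) auto
    then have "(coset_coeff f vs x a) ^ 4 < \<epsilon> ^ 4"
      using ge nn small by linarith
    then have "\<bar>coset_coeff f vs x a\<bar> ^ 4 < \<epsilon> ^ 4" by (simp only: power_even_abs_numeral even_numeral)
    then show ?thesis by (rule power_less_imp_less_base) (use eps in simp)
  qed
qed

end

subsection \<open>Success probability of a round and its amplification\<close>

text \<open>Stands for the sorted table: counting positions from 0, the entry at position
  \<open>i\<close> of the descending list of absolute values is at least \<open>u\<close> exactly if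
  \<open>i < level_count f vs x u\<close>. Counts avoid sorting both in the program and in the
  proof.\<close>

definition level_count :: "(bit Matrix.vec \<Rightarrow> int) \<Rightarrow> bit Matrix.vec list \<Rightarrow> bit Matrix.vec \<Rightarrow> nat \<Rightarrow> nat" where
  "level_count f vs x u = card {a. a < 2 ^ length vs \<and> int u \<le> \<bar>butterfly f vs x a\<bar>}"

text \<open>Closeness of the sorted table to the sorted coefficients, expressed one threshold
  \<open>u\<close> at a time. The entries are integers, so an entry below \<open>u\<close> is at
  most \<open>u - 1\<close>. Quantifying over every list of top frequencies settles ties and makes
  the property independent of \<open>t\<close>.\<close>

definition faithful :: "nat \<Rightarrow> (bit Matrix.vec \<Rightarrow> int) \<Rightarrow> real \<Rightarrow> bit Matrix.vec list \<Rightarrow> bit Matrix.vec \<Rightarrow> bool" where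
  "faithful n f \<epsilon> vs x \<longleftrightarrow>
     (\<forall>t \<gamma>s i u. top_frequencies n f t \<gamma>s \<longrightarrow> i < t \<longrightarrow> 1 \<le> u \<longrightarrow>
        (if i < level_count f vs x u then real u / 2 ^ length vs - \<epsilon> \<le> \<bar>fourier n f (\<gamma>s ! i)\<bar>
         else \<bar>fourier n f (\<gamma>s ! i)\<bar> \<le> (real u - 1) / 2 ^ length vs + \<epsilon>))"

lemma faithful_lower:
  "faithful n f \<epsilon> vs x \<Longrightarrow> top_frequencies n f t \<gamma>s \<Longrightarrow> i < t \<Longrightarrow> 1 \<le> u \<Longrightarrow> i < level_count f vs x u \<Longrightarrow>
    real u / 2 ^ length vs - \<epsilon> \<le> \<bar>fourier n f (\<gamma>s ! i)\<bar>"
  unfolding faithful_def by meson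

lemma faithful_upper:
  "faithful n f \<epsilon> vs x \<Longrightarrow> top_frequencies n f t \<gamma>s \<Longrightarrow> i < t \<Longrightarrow> 1 \<le> u \<Longrightarrow> \<not> i < level_count f vs x u \<Longrightarrow>
    \<bar>fourier n f (\<gamma>s ! i)\<bar> \<le> (real u - 1) / 2 ^ length vs + \<epsilon>"
  unfolding faithful_def by meson

lemma top_frequencies_antimono:
  assumes "top_frequencies n f t \<gamma>s" "i \<le> j" "j < t"
  shows "\<bar>fourier n f (\<gamma>s ! j)\<bar> \<le> \<bar>fourier n f (\<gamma>s ! i)\<bar>"
  using assms by (cases "i = j") (auto simp: top_frequencies_def sorted_wrt_iff_nth_less)

lemma top_frequencies_larger:
  assumes top: "top_frequencies n f t \<gamma>s" and i: "i < t" and \<gamma>: "\<gamma> \<in> cube n"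
    and gt: "\<bar>fourier n f (\<gamma>s ! i)\<bar> < \<bar>fourier n f \<gamma>\<bar>"
  shows "\<gamma> \<in> (!) \<gamma>s ` {..<i}"
proof -
  have len: "length \<gamma>s = t" using top by (simp add: top_frequencies_def)
  then have "\<gamma>s ! i \<in> set \<gamma>s" using i by simp
  then have "\<gamma> \<in> set \<gamma>s"
    using top \<gamma> gt unfolding top_frequencies_def by (meson DiffI not_less)
  then obtain j where j: "j < t" "\<gamma> = \<gamma>s ! j" using len by (auto simp: in_set_conv_nth)
  have "j < i"
    using top_frequencies_antimono[OF top, of i j] j gt by (cases "j < i") auto
  then show ?thesis using j by auto
qed

text \<open>Both bounds are pigeonhole arguments. If more than \<open>i\<close> entries reach level
  \<open>u\<close> while the coefficient at position \<open>i\<close> is too small, each of them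
  comes from its own heavy frequency with a strictly larger coefficient, but only \<open>i\<close>
  frequencies can have one. If that coefficient is too large, the first \<open>i + 1\<close> top
  frequencies hash to distinct entries reaching level \<open>u\<close>.\<close>

lemma faithful_if_separated:
  assumes vs: "vs \<in> tuples n k"
    and H: "H \<subseteq> cube n" "\<And>\<gamma>. \<gamma> \<in> cube n \<Longrightarrow> \<epsilon> < \<bar>fourier n f \<gamma>\<bar> \<Longrightarrow> \<gamma> \<in> H"
    and inj: "inj_on (hash vs) H"
    and heavy: "\<And>\<gamma>. \<gamma> \<in> H \<Longrightarrow> \<bar>\<bar>coset_coeff f vs x (hash vs \<gamma>)\<bar> - \<bar>fourier n f \<gamma>\<bar>\<bar> < \<epsilon>"
    and light: "\<And>a. a < 2 ^ k \<Longrightarrow> a \<notin> hash vs ` H \<Longrightarrow> \<bar>coset_coeff f vs x a\<bar> < \<epsilon>"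
  shows "faithful n f \<epsilon> vs x"
  unfolding faithful_def
proof (intro allI impI)
  fix t \<gamma>s and i u :: nat
  assume top: "top_frequencies n f t \<gamma>s" and i: "i < t" and u: "1 \<le> u"
  let ?F = "\<lambda>\<gamma>. \<bar>fourier n f \<gamma>\<bar>"
  have len: "length vs = k" using vs by (simp add: tuples_def)
  have \<gamma>s: "length \<gamma>s = t" "distinct \<gamma>s" "set \<gamma>s \<subseteq> cube n" using top by (auto simp: top_frequencies_def)
  have finH: "finite H" using H(1) finite_bit_carrier_vec finite_subset by blast
  define A where "A = {a. a < 2 ^ k \<and> int u \<le> \<bar>butterfly f vs x a\<bar>}"
  have cA: "level_count f vs x u = card A" by (simp add: level_count_def A_def len)
  have finA: "finite A" by (simp add: A_def)
  have coeff: "\<bar>coset_coeff f vs x a\<bar> = real_of_int \<bar>butterfly f vs x a\<bar> / 2 ^ k" for a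
    by (simp add: coset_coeff_def len)
  show "if i < level_count f vs x u then real u / 2 ^ length vs - \<epsilon> \<le> ?F (\<gamma>s ! i)
         else ?F (\<gamma>s ! i) \<le> (real u - 1) / 2 ^ length vs + \<epsilon>"
  proof (split if_split, intro conjI impI)
    assume cnt: "i < level_count f vs x u"
    show "real u / 2 ^ length vs - \<epsilon> \<le> ?F (\<gamma>s ! i)"
    proof (rule ccontr)
      assume "\<not> ?thesis"
      then have neg: "?F (\<gamma>s ! i) < real u / 2 ^ k - \<epsilon>" by (simp add: len)
      have A_ge: "real u / 2 ^ k \<le> \<bar>coset_coeff f vs x a\<bar>" if "a \<in> A" for a
      proof -
        have "real_of_int (int u) \<le> real_of_int \<bar>butterfly f vs x a\<bar>"
          using that unfolding of_int_le_iff by (simp add: A_def)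
        then show ?thesis unfolding coeff by (intro divide_right_mono) auto
      qed
      define B where "B = {\<gamma> \<in> H. hash vs \<gamma> \<in> A}"
      have "A \<subseteq> hash vs ` B"
      proof
        fix a assume a: "a \<in> A"
        \<comment> \<open>Absolute values are nonnegative, so \<open>neg\<close> forces
          \<open>\<epsilon> < real u / 2 ^ k\<close>, and a light entry cannot reach the
          level.\<close>
        then have "\<not> \<bar>coset_coeff f vs x a\<bar> < \<epsilon>" using A_ge[OF a] neg by linarith
        then have "a \<in> hash vs ` H" using light[of a] a by (auto simp: A_def)
        then show "a \<in> hash vs ` B" using a by (auto simp: B_def)
      qed
      then have "card A \<le> card B"
        by (rule surj_card_le[rotated]) (simp add: B_def finH)
      moreover have "B \<subseteq> (!) \<gamma>s ` {..<i}"
      proof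
        fix \<gamma> assume \<gamma>: "\<gamma> \<in> B"
        then have "?F (\<gamma>s ! i) < ?F \<gamma>"
          using heavy[of \<gamma>] A_ge[of "hash vs \<gamma>"] neg by (auto simp: B_def)
        then show "\<gamma> \<in> (!) \<gamma>s ` {..<i}"
          using top_frequencies_larger[OF top i] \<gamma> H(1) by (auto simp: B_def)
      qed
      then have "card B \<le> i" using surj_card_le[of "{..<i}" B] by simp
      ultimately show False using cnt cA by simp
    qed
  next
    assume cnt: "\<not> i < level_count f vs x u"
    show "?F (\<gamma>s ! i) \<le> (real u - 1) / 2 ^ length vs + \<epsilon>"
    proof (rule ccontr)
      assume "\<not> ?thesis"
      then have neg: "(real u - 1) / 2 ^ k + \<epsilon> < ?F (\<gamma>s ! i)" by (simp add: len)
      have u0: "0 \<le> (real u - 1) / 2 ^ k" using u by simp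
      have j: "\<gamma>s ! j \<in> H \<and> hash vs (\<gamma>s ! j) \<in> A" if "j \<le> i" for j
      proof -
        have big: "(real u - 1) / 2 ^ k + \<epsilon> < ?F (\<gamma>s ! j)"
          using top_frequencies_antimono[OF top that i] neg by linarith
        have "\<gamma>s ! j \<in> set \<gamma>s" using that i \<gamma>s(1) by simp
        then have "\<gamma>s ! j \<in> cube n" using \<gamma>s(3) by blast
        then have inH: "\<gamma>s ! j \<in> H" using H(2) big u0 by auto
        let ?a = "hash vs (\<gamma>s ! j)"
        have "(real u - 1) / 2 ^ k < \<bar>coset_coeff f vs x ?a\<bar>"
          using heavy[OF inH] big by linarith
        then have "real u - 1 < real_of_int \<bar>butterfly f vs x ?a\<bar>"
          unfolding coeff by (simp add: divide_less_cancel)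
        \<comment> \<open>Integrality: an integer above \<open>u - 1\<close> is at least
          \<open>u\<close>.\<close>
        then have "int u \<le> \<bar>butterfly f vs x ?a\<bar>" by linarith
        then show ?thesis using inH hash_less[of vs] by (simp add: A_def len)
      qed
      have "inj_on (\<lambda>j. hash vs (\<gamma>s ! j)) {..i}"
      proof (rule inj_onI)
        fix l m assume lm: "l \<in> {..i}" "m \<in> {..i}" "hash vs (\<gamma>s ! l) = hash vs (\<gamma>s ! m)"
        then have "\<gamma>s ! l = \<gamma>s ! m" using j inj by (auto dest: inj_onD)
        then show "l = m" using lm i \<gamma>s by (simp add: nth_eq_iff_index_eq)
      qed
      then have "card {..i} \<le> card A"
        using j finA by (intro card_inj_on_le) auto
      then show False using cnt cA by simp
    qed
  qed
qed

text \<open>The budget \<open>1 / (16 * e ^ 4)\<close> is split evenly. The threshold in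
  \<open>H\<close> makes the light fourth powers at most \<open>1 / (32 * e ^ 4)\<close>, and
  Parseval gives \<open>card H \<le> 32 * e ^ 4\<close>. The errors then sum to at most
  \<open>8192 * e ^ 8\<close>, and \<open>262144 = 32 * 8192\<close> makes their quotient by
  \<open>2 ^ k\<close> the other half.\<close>

lemma potential_mean_le:
  assumes boolean: "\<forall>x\<in>cube n. f x \<in> {- 1, 1}"
    and e: "1 \<le> e" "2 ^ k = 262144 * e ^ 12"
    and H: "H = {\<gamma> \<in> cube n. 1 / (32 * e ^ 4) < (fourier n f \<gamma>)\<^sup>2}"
  shows "avgs n k (\<lambda>vs. avg n (potential n f H k vs)) \<le> 1 / 16 * (1 / e) ^ 4"
proof -
  let ?F = "fourier n f"
  have HV: "H \<subseteq> cube n" by (auto simp: H)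
  have "card H * (1 / (32 * e ^ 4)) \<le> (\<Sum>\<gamma>\<in>H. (?F \<gamma>)\<^sup>2)"
    by (rule sum_bounded_below[where 'a = real]) (simp add: H)
  also have "\<dots> \<le> (\<Sum>\<gamma>\<in>cube n. (?F \<gamma>)\<^sup>2)"
    using HV by (intro sum_mono2) (auto simp: finite_bit_carrier_vec)
  finally have card: "real (card H) \<le> 32 * e ^ 4"
    using e(1) by (simp add: parseval[OF boolean] field_simps)
  have "(\<Sum>\<gamma>\<in>cube n - H. (?F \<gamma>) ^ 4) \<le> (\<Sum>\<gamma>\<in>cube n - H. 1 / (32 * e ^ 4) * (?F \<gamma>)\<^sup>2)"
  proof (rule sum_mono)
    fix \<gamma> assume "\<gamma> \<in> cube n - H"
    then have "(?F \<gamma>)\<^sup>2 * (?F \<gamma>)\<^sup>2 \<le> 1 / (32 * e ^ 4) * (?F \<gamma>)\<^sup>2"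
      by (intro mult_right_mono) (auto simp: H)
    then show "(?F \<gamma>) ^ 4 \<le> 1 / (32 * e ^ 4) * (?F \<gamma>)\<^sup>2" by (simp flip: power_add)
  qed
  also have "\<dots> \<le> (\<Sum>\<gamma>\<in>cube n. 1 / (32 * e ^ 4) * (?F \<gamma>)\<^sup>2)"
    using e(1) by (intro sum_mono2) (auto simp: finite_bit_carrier_vec)
  finally have light: "(\<Sum>\<gamma>\<in>cube n - H. (?F \<gamma>) ^ 4) \<le> 1 / (32 * e ^ 4)"
    by (simp add: parseval[OF boolean] flip: sum_divide_distrib)
  have e8: "1 \<le> e ^ 8" "e ^ 4 \<le> e ^ 8" "e ^ 4 * e ^ 4 = e ^ 8" "e ^ 4 * e ^ 8 = e ^ 12"
    using e(1) by (auto intro: power_increasing one_le_power simp flip: power_add)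
  have "(real (card H))\<^sup>2 \<le> (32 * e ^ 4)\<^sup>2" using card by (intro power_mono) auto
  then have "3 + 5 * (real (card H))\<^sup>2 + real (card H) \<le> 8192 * e ^ 8"
    using card e8 by (simp add: power_mult_distrib power2_eq_square)
  then have "(3 + 5 * (real (card H))\<^sup>2 + real (card H)) / 2 ^ k \<le> 8192 * e ^ 8 / 2 ^ k"
    by (intro divide_right_mono) auto
  also have "\<dots> = 1 / (32 * e ^ 4)"
    unfolding e(2) e8(4)[symmetric] using e8(1) e(1) by (simp add: field_simps)
  finally show ?thesis
    using potential_mean[OF boolean HV, of k] light by (simp add: power_divide)
qed

section \<open>From averages to probabilities\<close>

lemma expectation_replicate_cube:
  "measure_pmf.expectation (replicate_pmf k (pmf_of_set (cube n))) F = avgs n k F"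
proof (induction k arbitrary: F)
  case 0
  then show ?case by simp
next
  case (Suc k)
  have ne: "cube n \<noteq> ({} :: bit Matrix.vec set)" using zero_carrier_vec by blast
  have fin: "finite (set_pmf (replicate_pmf k (pmf_of_set (cube n :: bit Matrix.vec set))))"
    unfolding set_replicate_pmf set_pmf_of_set[OF ne finite_bit_carrier_vec]
    using finite_lists_length_eq[OF finite_bit_carrier_vec, of n k] by (simp add: lists_eq_set conj_commute)
  have "measure_pmf.expectation (replicate_pmf (Suc k) (pmf_of_set (cube n))) F
      = (\<Sum>v\<in>cube n. measure_pmf.expectation (replicate_pmf k (pmf_of_set (cube n))) (\<lambda>vs. F (v # vs)) / 2 ^ n)"
    unfolding replicate_pmf.simps
    by (subst pmf_expectation_bind_pmf_of_set)
      (use ne fin in \<open>auto simp: finite_bit_carrier_vec card_bit_carrier_vec map_pmf_def[symmetric]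
        divide_inverse mult.commute intro!: sum.cong\<close>)
  also have "\<dots> = avg n (\<lambda>v. avgs n k (\<lambda>vs. F (v # vs)))"
    by (simp add: Suc avg_def sum_divide_distrib)
  \<comment> \<open>\<open>replicate_pmf\<close> draws the head first while \<open>avgs\<close>
    averages it innermost, hence the exchange.\<close>
  finally show ?case by (simp add: avgs_avg_swap)
qed

text \<open>Markov's inequality: the potential is nonnegative, an unfaithful round has potential at
  least \<open>(1 / e) ^ 4\<close>, and the mean is at most a sixteenth of that. The head of
  \<open>w\<close> is the origin and its tail the directions; \<open>18 + 12 * q\<close> is chosen
  so that \<open>2 ^ k = 2 ^ 18 * e ^ 12\<close>.\<close>

lemma prob_unfaithful_le:
  assumes boolean: "\<forall>x\<in>cube n. f x \<in> {- 1, 1}" and k: "k = 18 + 12 * q"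
  shows "measure_pmf.prob (replicate_pmf (Suc k) (pmf_of_set (cube n)))
    {w. \<not> faithful n f (1 / 2 ^ q) (tl w) (hd w)} \<le> 1 / 16"
proof -
  let ?W = "replicate_pmf (Suc k) (pmf_of_set (cube n :: bit Matrix.vec set))"
  define e :: real where "e = 2 ^ q"
  have "(2::real) ^ k = 2 ^ 18 * (2 ^ q) ^ 12"
    by (simp only: k power_add power_mult[symmetric] mult.commute)
  then have e: "1 \<le> e" "2 ^ k = 262144 * e ^ 12"
    by (simp_all add: e_def)
  define H where "H = {\<gamma> \<in> cube n. 1 / (32 * e ^ 4) < (fourier n f \<gamma>)\<^sup>2}"
  have HV: "H \<subseteq> cube n" by (auto simp: H_def)
  have ne: "cube n \<noteq> ({} :: bit Matrix.vec set)" using zero_carrier_vec by blast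
  have sup: "hd w \<in> cube n" "tl w \<in> tuples n k" if "w \<in> set_pmf ?W" for w
    using that unfolding set_replicate_pmf set_pmf_of_set[OF ne finite_bit_carrier_vec]
    by (cases w; force simp: tuples_def)+
  have bad: "\<not> faithful n f (1 / 2 ^ q) (tl w) (hd w) \<Longrightarrow> 1 \<le> e ^ 4 * potential n f H k (tl w) (hd w)"
    if w: "w \<in> set_pmf ?W" for w
  proof (rule ccontr)
    assume nf: "\<not> faithful n f (1 / 2 ^ q) (tl w) (hd w)"
      and "\<not> 1 \<le> e ^ 4 * potential n f H k (tl w) (hd w)"
    then have small: "potential n f H k (tl w) (hd w) < (1 / e) ^ 4"
      using e(1) by (simp add: power_divide field_simps)
    have "0 < 1 / e" "1 / e \<le> 1" using e(1) by auto
    note sep = small_potential[OF boolean HV sup(2,1)[OF w] small this]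
    have "faithful n f (1 / e) (tl w) (hd w)"
    proof (rule faithful_if_separated[OF sup(2)[OF w] HV _ sep])
      \<comment> \<open>Heaviness is decided at the finer threshold \<open>1 / (32 * e ^ 4)\<close>
        for squares, which lies below \<open>1 / e ^ 2\<close>.\<close>
      fix \<gamma> assume \<gamma>: "\<gamma> \<in> cube n" "1 / e < \<bar>fourier n f \<gamma>\<bar>"
      have "e\<^sup>2 \<le> 32 * e ^ 4"
        using e(1) power_increasing[of 2 4 e] one_le_power[of e 4] by linarith
      then have "1 / (32 * e ^ 4) \<le> (1 / e)\<^sup>2"
        using e(1) by (simp add: power_divide field_simps)
      also have "\<dots> < (fourier n f \<gamma>)\<^sup>2"
        using \<gamma>(2) e(1) power_strict_mono[of "1 / e" "\<bar>fourier n f \<gamma>\<bar>" 2] by simp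
      finally show "\<gamma> \<in> H" using \<gamma> by (simp add: H_def)
    qed
    then show False using nf by (simp add: e_def)
  qed
  have fin: "finite (set_pmf ?W)"
    unfolding set_replicate_pmf set_pmf_of_set[OF ne finite_bit_carrier_vec]
    using finite_lists_length_eq[OF finite_bit_carrier_vec, of n "Suc k"]
    by (simp add: lists_eq_set conj_commute)
  have int: "integrable (measure_pmf ?W) g" for g :: "bit Matrix.vec list \<Rightarrow> real"
    by (rule integrable_measure_pmf_finite[OF fin])
  have "measure_pmf.prob ?W {w. \<not> faithful n f (1 / 2 ^ q) (tl w) (hd w)}
      = measure_pmf.expectation ?W (indicator {w. \<not> faithful n f (1 / 2 ^ q) (tl w) (hd w)})"
    by simp
  also have "\<dots> \<le> measure_pmf.expectation ?W (\<lambda>w. e ^ 4 * potential n f H k (tl w) (hd w))"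
  proof (rule integral_mono_AE[OF int int])
    show "AE w in measure_pmf ?W. indicator {w. \<not> faithful n f (1 / 2 ^ q) (tl w) (hd w)} w
        \<le> e ^ 4 * potential n f H k (tl w) (hd w)"
      unfolding AE_measure_pmf_iff
    proof
      fix w assume w: "w \<in> set_pmf ?W"
      show "indicator {w. \<not> faithful n f (1 / 2 ^ q) (tl w) (hd w)} w
        \<le> e ^ 4 * potential n f H k (tl w) (hd w)"
        using bad[OF w] potential_nonneg[OF boolean HV sup(2)[OF w] sup(1)[OF w]] e(1)
        by (cases "faithful n f (1 / 2 ^ q) (tl w) (hd w)") auto
    qed
  qed
  also have "\<dots> = e ^ 4 * avgs n k (\<lambda>vs. avg n (potential n f H k vs))"
    by (simp add: expectation_replicate_cube avgs_cmult avg_cmult del: replicate_pmf.simps)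
  also have "\<dots> \<le> e ^ 4 * (1 / 16 * (1 / e) ^ 4)"
    using e by (intro mult_left_mono potential_mean_le[OF boolean]) (auto simp: H_def)
  also have "\<dots> = 1 / 16" using e(1) by (simp add: power_divide)
  finally show ?thesis .
qed

text \<open>Exponential moments: each round multiplies the mean of \<open>16 ^ #failures\<close> by at most 2, whereas
  a lost majority makes it at least \<open>4 ^ r\<close>.\<close>

lemma majority_amplification:
  assumes bad: "measure_pmf.prob p {x. \<not> P x} \<le> 1 / 16"
  shows "measure_pmf.prob (replicate_pmf r p) {xs. 2 * length (filter P xs) \<le> r} \<le> 1 / 2 ^ r"
proof -
  define c where "c xs = length (filter (\<lambda>x. \<not> P x) xs)" for xs
  have "(\<integral>\<^sup>+xs. 16 ^ c xs \<partial>measure_pmf (replicate_pmf r p)) \<le> 2 ^ r"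
  proof (induction r)
    case 0
    then show ?case by (simp add: c_def)
  next
    case (Suc r)
    let ?I = "\<integral>\<^sup>+xs. 16 ^ c xs \<partial>measure_pmf (replicate_pmf r p)"
    have "(\<integral>\<^sup>+xs. 16 ^ c xs \<partial>measure_pmf (replicate_pmf (Suc r) p))
        = (\<integral>\<^sup>+x. \<integral>\<^sup>+xs. 16 ^ c (x # xs) \<partial>measure_pmf (replicate_pmf r p) \<partial>measure_pmf p)"
      by (simp add: map_pmf_def[symmetric])
    also have "\<dots> = (\<integral>\<^sup>+x. (1 + 15 * indicator {x. \<not> P x} x) * ?I \<partial>measure_pmf p)"
    proof (rule nn_integral_cong)
      fix x
      have "(16::ennreal) ^ c (x # xs) = (1 + 15 * indicator {x. \<not> P x} x) * 16 ^ c xs" for xs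
        by (simp add: c_def)
      then show "(\<integral>\<^sup>+xs. 16 ^ c (x # xs) \<partial>measure_pmf (replicate_pmf r p))
          = (1 + 15 * indicator {x. \<not> P x} x) * ?I"
        by (simp add: nn_integral_cmult)
    qed
    also have "\<dots> = (1 + 15 * emeasure (measure_pmf p) {x. \<not> P x}) * ?I"
      by (simp add: nn_integral_multc nn_integral_add nn_integral_cmult)
    also have "\<dots> \<le> 2 * 2 ^ r"
    proof (rule mult_mono)
      have "1 + 15 * emeasure (measure_pmf p) {x. \<not> P x} = ennreal (1 + 15 * measure_pmf.prob p {x. \<not> P x})"
        by (simp add: measure_pmf.emeasure_eq_measure ennreal_mult)
      also have "\<dots> \<le> ennreal 2" using bad by (intro ennreal_leI) simp
      finally show "1 + 15 * emeasure (measure_pmf p) {x. \<not> P x} \<le> 2" by simp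
    qed (use Suc in auto)
    finally show ?case by simp
  qed
  moreover have "4 ^ r * emeasure (measure_pmf (replicate_pmf r p)) {xs. 2 * length (filter P xs) \<le> r}
      \<le> (\<integral>\<^sup>+xs. 16 ^ c xs \<partial>measure_pmf (replicate_pmf r p))"
  proof -
    have "4 ^ r * emeasure (measure_pmf (replicate_pmf r p)) {xs. 2 * length (filter P xs) \<le> r}
        = (\<integral>\<^sup>+xs. 4 ^ r * indicator {xs. 2 * length (filter P xs) \<le> r} xs \<partial>measure_pmf (replicate_pmf r p))"
      by (simp add: nn_integral_cmult)
    also have "\<dots> \<le> (\<integral>\<^sup>+xs. 16 ^ c xs \<partial>measure_pmf (replicate_pmf r p))"
    proof (rule nn_integral_mono_AE, unfold AE_measure_pmf_iff, rule ballI)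
      fix xs assume "xs \<in> set_pmf (replicate_pmf r p)"
      then have "length xs = r" by (simp add: set_replicate_pmf)
      then have len: "length (filter P xs) + c xs = r"
        unfolding c_def using sum_length_filter_compl[of P xs] by simp
      show "4 ^ r * indicator {xs. 2 * length (filter P xs) \<le> r} xs \<le> (16::ennreal) ^ c xs"
      proof (cases "2 * length (filter P xs) \<le> r")
        case True
        then have "(4::ennreal) ^ r \<le> 4 ^ (2 * c xs)"
          using len by (intro power_increasing) auto
        moreover have "(4::ennreal) ^ (2 * c xs) = 16 ^ c xs" by (simp add: power_mult)
        ultimately show ?thesis using True by (simp only: indicator_simps mem_Collect_eq mult_1_right)
      qed simp
    qed
    finally show ?thesis .
  qed
  ultimately have "4 ^ r * emeasure (measure_pmf (replicate_pmf r p)) {xs. 2 * length (filter P xs) \<le> r} \<le> 2 ^ r"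
    by (rule order_trans[rotated])
  then have "ennreal (4 ^ r * measure_pmf.prob (replicate_pmf r p) {xs. 2 * length (filter P xs) \<le> r}) \<le> ennreal (2 ^ r)"
    by (simp add: measure_pmf.emeasure_eq_measure ennreal_mult flip: ennreal_power ennreal_numeral)
  then have "4 ^ r * measure_pmf.prob (replicate_pmf r p) {xs. 2 * length (filter P xs) \<le> r} \<le> 2 ^ r"
    by (simp add: ennreal_le_iff)
  moreover have "(4::real) ^ r = 2 ^ r * 2 ^ r" by (simp flip: power_mult_distrib)
  ultimately show ?thesis by (simp add: field_simps)
qed

subsection \<open>A calculus for running programs\<close>

text \<open>A Hoare triple with a step budget for deterministic execution. The stack below and the
  remaining steps are universally quantified so that runs can be chained; the exact step count is
  hidden behind the bound \<open>T\<close>, so branches of unequal length can share one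
  triple.\<close>

definition exec :: "nat \<Rightarrow> (bit Matrix.vec \<Rightarrow> int) \<Rightarrow> com \<Rightarrow> state \<Rightarrow> nat \<Rightarrow> (state \<Rightarrow> bool) \<Rightarrow> bool" where
  "exec n f c s T Q \<longleftrightarrow>
     (\<exists>s' t. t \<le> T \<and> Q s' \<and> (\<forall>cs k. run n f (t + k) (c # cs, s) = run n f k (cs, s')))"

lemma execI:
  assumes "t \<le> T" "Q s'" "\<And>cs k. run n f (t + k) (c # cs, s) = run n f k (cs, s')"
  shows "exec n f c s T Q"
  using assms unfolding exec_def by blast

lemma exec_mono:
  assumes "exec n f c s T Q" "T \<le> T'" "\<And>s'. Q s' \<Longrightarrow> Q' s'"
  shows "exec n f c s T' Q'"
  using assms unfolding exec_def by (meson order_trans)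

lemma exec_Seq:
  assumes "exec n f c s Tc (\<lambda>s'. exec n f d s' Td Q)"
  shows "exec n f (Seq c d) s (Tc + Td + 1) Q"
proof -
  obtain s1 t1 where 1: "t1 \<le> Tc" "exec n f d s1 Td Q"
      "\<And>cs k. run n f (t1 + k) (c # cs, s) = run n f k (cs, s1)"
    using assms unfolding exec_def[of n f c] by blast
  obtain s2 t2 where 2: "t2 \<le> Td" "Q s2"
      "\<And>cs k. run n f (t2 + k) (d # cs, s1) = run n f k (cs, s2)"
    using 1(2) unfolding exec_def by blast
  show ?thesis
  proof (rule execI)
    show "Suc (t1 + t2) \<le> Tc + Td + 1" "Q s2" using 1 2 by auto
    show "run n f (Suc (t1 + t2) + k) (Seq c d # cs, s) = run n f k (cs, s2)" for cs k
      using 1(3)[of "t2 + k"] 2(3)[of k] by (simp add: bind_return_pmf add.assoc)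
  qed
qed

text \<open>Loops and coin tosses are outside the scope of this calculus and get the dummy value \<open>False\<close>.\<close>

fun wp :: "nat \<Rightarrow> (bit Matrix.vec \<Rightarrow> int) \<Rightarrow> com \<Rightarrow> (state \<Rightarrow> bool) \<Rightarrow> state \<Rightarrow> bool" where
  "wp n f Skip Q s = Q s"
| "wp n f (Assign r a) Q s = Q (s\<lparr>regs := (regs s)(r := eval_exp s a)\<rparr>)"
| "wp n f (Store a b) Q s = Q (s\<lparr>mem := (mem s)(eval_exp s a := eval_exp s b)\<rparr>)"
| "wp n f (Query r a) Q s = Q (s\<lparr>
       regs := (regs s)(r := f (Matrix.vec n (\<lambda>i. of_int (mem s (eval_exp s a + int i))))),
       num_queries := num_queries s + 1\<rparr>)"
| "wp n f (Output a b) Q s = Q (s\<lparr>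
       outputs := outputs s @ [real_of_int (eval_exp s a) / real_of_int (eval_exp s b)]\<rparr>)"
| "wp n f (Seq c d) Q s = wp n f c (wp n f d Q) s"
| "wp n f (IfPos a c d) Q s = (if eval_exp s a > 0 then wp n f c Q s else wp n f d Q s)"
| "wp n f (Flip r) Q s = False"
| "wp n f (WhilePos a c) Q s = False"

fun cost :: "com \<Rightarrow> nat" where
  "cost (Seq c d) = cost c + cost d + 1"
| "cost (IfPos a c d) = max (cost c) (cost d) + 1"
| "cost _ = 1"

lemma exec_step:
  assumes "\<And>cs. step n f (c # cs, s) = return_pmf (cs, s')" "Q s'"
  shows "exec n f c s (Suc 0) Q"
  by (rule execI[of 1]) (use assms in \<open>auto simp: bind_return_pmf\<close>)

lemma exec_wp:
  assumes "wp n f c Q s" "cost c \<le> T"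
  shows "exec n f c s T Q"
proof -
  have "exec n f c s (cost c) Q"
    using assms(1)
  proof (induction c arbitrary: Q s)
    case (Seq c d)
    have "exec n f c s (cost c) (wp n f d Q)" using Seq by simp
    then have "exec n f c s (cost c) (\<lambda>s'. exec n f d s' (cost d) Q)"
      by (rule exec_mono) (simp_all add: Seq)
    then show ?case using exec_Seq by simp
  next
    case (IfPos a c d)
    have "exec n f (if eval_exp s a > 0 then c else d) s (max (cost c) (cost d)) Q"
    proof (cases "eval_exp s a > 0")
      case True
      then have "exec n f c s (cost c) Q" using IfPos by simp
      then show ?thesis using True by (auto elim: exec_mono)
    next
      case False
      then have "exec n f d s (cost d) Q" using IfPos by simp
      then show ?thesis using False by (auto elim: exec_mono)
    qed
    then obtain s' t where t: "t \<le> max (cost c) (cost d)" "Q s'"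
      "\<And>cs k. run n f (t + k) ((if eval_exp s a > 0 then c else d) # cs, s) = run n f k (cs, s')"
      unfolding exec_def by blast
    show ?case
      by (rule execI[of "Suc t"]) (use t in \<open>auto simp: bind_return_pmf simp del: if_split\<close>)
  next
    case (Query r a)
    show ?case
      unfolding cost.simps One_nat_def
      by (rule exec_step, rule step.simps) (use Query in simp)
  qed (auto intro: exec_step[OF step.simps(2)] exec_step[OF step.simps(3)] exec_step[OF step.simps(4)]
      exec_step[OF step.simps(7)])
  then show ?thesis using assms(2) by (rule exec_mono)
qed

lemma exec_wp_Seq:
  assumes "wp n f c (\<lambda>s'. exec n f d s' T Q) s"
  shows "exec n f (Seq c d) s (cost c + T + 1) Q"
  using assms by (intro exec_Seq exec_wp) auto

text \<open>The invariant is indexed by the number of completed iterations, so termination comes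
  with it. Each iteration pays one step for its test, and the final summand 1 is the failing
  test.\<close>

lemma exec_While:
  assumes init: "I 0 s"
    and body: "\<And>j s. j < N \<Longrightarrow> I j s \<Longrightarrow> eval_exp s a > 0 \<and> exec n f c s T (I (Suc j))"
    and exit: "\<And>s. I N s \<Longrightarrow> eval_exp s a \<le> 0 \<and> Q s"
  shows "exec n f (WhilePos a c) s (N * (T + 1) + 1) Q"
proof -
  have "exec n f (WhilePos a c) s ((N - j) * (T + 1) + 1) Q" if "I j s" "j \<le> N" for j s
    using that
  proof (induction "N - j" arbitrary: j s)
    case 0
    then have "eval_exp s a \<le> 0 \<and> Q s" using exit[of s] by simp
    then show ?case by (intro execI[of 1]) (auto simp: bind_return_pmf)
  next
    case (Suc m)
    then have j: "j < N" by simp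
    obtain s1 t1 where 1: "t1 \<le> T" "I (Suc j) s1"
        "\<And>cs k. run n f (t1 + k) (c # cs, s) = run n f k (cs, s1)"
      using body[OF j Suc.prems(1)] unfolding exec_def by blast
    have "exec n f (WhilePos a c) s1 ((N - Suc j) * (T + 1) + 1) Q"
      using Suc 1(2) by (intro Suc.hyps(1)) auto
    then obtain s2 t2 where 2: "t2 \<le> (N - Suc j) * (T + 1) + 1" "Q s2"
        "\<And>cs k. run n f (t2 + k) (WhilePos a c # cs, s1) = run n f k (cs, s2)"
      unfolding exec_def by blast
    show ?case
    proof (rule execI)
      have "N - j = Suc (N - Suc j)" using j by simp
      then show "Suc (t1 + t2) \<le> (N - j) * (T + 1) + 1" using 1 2 by simp
      show "run n f (Suc (t1 + t2) + k) (WhilePos a c # cs, s) = run n f k (cs, s2)" for cs k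
        using 1(3)[of "t2 + k"] 2(3)[of k] body[OF j Suc.prems(1)]
        by (simp add: bind_return_pmf add.assoc)
    qed (rule 2(2))
  qed
  from this[OF init] show ?thesis by simp
qed

lemma exec_While':
  assumes "I 0 s"
    and "\<And>j s. j < N \<Longrightarrow> I j s \<Longrightarrow> eval_exp s a > 0 \<and> exec n f c s T (I (Suc j))"
    and "\<And>s. I N s \<Longrightarrow> eval_exp s a \<le> 0 \<and> Q s" and "N * (T + 1) + 1 \<le> T'"
  shows "exec n f (WhilePos a c) s T' Q"
  using exec_While[OF assms(1-3)] assms(4) by (rule exec_mono)

lemma exec_Seq':
  assumes "exec n f c s Tc P" "\<And>s'. P s' \<Longrightarrow> exec n f d s' Td Q" "Tc + Td + 1 \<le> T"
  shows "exec n f (Seq c d) s T Q"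
proof -
  have "exec n f c s Tc (\<lambda>s'. exec n f d s' Td Q)"
    using assms(1) by (rule exec_mono) (use assms(2) in auto)
  from exec_Seq[OF this] show ?thesis by (rule exec_mono) (use assms(3) in auto)
qed

lemma exec_wp_Seq':
  assumes "wp n f c (\<lambda>s'. exec n f d s' Td Q) s" "cost c + Td + 1 \<le> T"
  shows "exec n f (Seq c d) s T Q"
  using exec_wp_Seq[OF assms(1)] by (rule exec_mono) (use assms(2) in auto)

fun block :: "com list \<Rightarrow> com" where
  "block [] = Skip"
| "block [c] = c"
| "block (c # cs) = Seq c (block cs)"

definition arr :: "(int \<Rightarrow> int) \<Rightarrow> int \<Rightarrow> nat \<Rightarrow> (nat \<Rightarrow> int) \<Rightarrow> bool" where
  "arr m b N g \<longleftrightarrow> (\<forall>j<N. m (b + int j) = g j)"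

lemma arr_0 [simp]: "arr m b 0 g"
  by (simp add: arr_def)

lemma arr_cong: "arr m b N g \<Longrightarrow> (\<And>j. j < N \<Longrightarrow> m' (b + int j) = m (b + int j)) \<Longrightarrow> arr m' b N g"
  by (simp add: arr_def)

lemma arr_append: "arr m b N g \<Longrightarrow> x = b + int N \<Longrightarrow> y = g N \<Longrightarrow> arr (m(x := y)) b (Suc N) g"
  by (auto simp: arr_def less_Suc_eq)

text \<open>Frame condition on registers and outputs. Memory and the query counter stay outside
  because each program states its own effect on them.\<close>

definition keeps :: "nat set \<Rightarrow> state \<Rightarrow> state \<Rightarrow> bool" where
  "keeps A s s' \<longleftrightarrow> (\<forall>r. r \<notin> A \<longrightarrow> regs s' r = regs s r) \<and> outputs s' = outputs s"

subsection \<open>The program for one round\<close>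

text \<open>Register layout: 0 to 3 inputs, 4 the power of two bounding the reciprocal accuracy,
  5 the table size \<open>K\<close>, 6 its logarithm \<open>k\<close>, 7 \<open>K / 2\<close>, 8 the number of random bits, 11 the first
  free memory cell, 12 the next unused random bit, 13 the remaining rounds, 14 the number of cells
  a round occupies. Registers from 20 on are scratch space.\<close>

definition copy_origin :: com where
  "copy_origin = block [
     Assign 20 (Num 0),
     WhilePos (Sub (Reg 0) (Reg 20)) (block [
       Store (Add (Reg 11) (Reg 20)) (Mem (Add (Reg 12) (Reg 20))),
       Assign 20 (Add (Reg 20) (Num 1))])]"

lemma exec_copy_origin:
  assumes "regs s 0 = int n" "regs s 11 = b" "regs s 12 = q" "q + int n \<le> b" "arr (mem s) q n g"
  shows "exec n f copy_origin s (4 * n + 3) (\<lambda>s'. keeps {20} s s' \<and> num_queries s' = num_queries s \<and>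
     (\<forall>x<b. mem s' x = mem s x) \<and> arr (mem s') b n g)"
  unfolding copy_origin_def block.simps
  apply (rule exec_wp_Seq'[where Td = "4 * n + 1"])
   apply (simp only: wp.simps)
   apply (rule exec_While'[where T = 3 and N = n and I = "\<lambda>j s'. keeps {20} s s' \<and> num_queries s' = num_queries s \<and>
     (\<forall>x<b. mem s' x = mem s x) \<and> arr (mem s') b j g \<and> regs s' 20 = int j"])
  subgoal by (simp add: keeps_def)
  subgoal for j s' using assms
    by (auto intro!: exec_wp simp: keeps_def intro!: arr_append) (simp add: arr_def)
  subgoal using assms by (simp add: keeps_def)
  subgoal by simp
  subgoal by simp
  done

text \<open>Cell \<open>y * n + c\<close> holds coordinate \<open>c\<close> of the point with index
  \<open>y\<close>. Block 0 of the random bits \<open>g\<close> is the origin and block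
  \<open>i\<close> the \<open>i\<close>-th direction; adding a direction appends a shifted copy of
  the whole table. The sums are not reduced modulo 2, because a query looks only at
  parities.\<close>

primrec point_cell :: "nat \<Rightarrow> (nat \<Rightarrow> int) \<Rightarrow> nat \<Rightarrow> nat \<Rightarrow> int" where
  "point_cell n g 0 j = g j"
| "point_cell n g (Suc i) j =
     (if j < 2 ^ i * n then point_cell n g i j
      else point_cell n g i (j - 2 ^ i * n) + g (Suc i * n + j mod n))"

text \<open>Register 24 tracks the coordinate \<open>j mod n\<close> by wrapping around, as the
  machine cannot divide.\<close>

definition double_points :: com where
  "double_points = block [
     Assign 23 (Num 0),
     Assign 24 (Num 0),
     WhilePos (Sub (Reg 21) (Reg 23)) (block [
       Store (Add (Add (Reg 11) (Reg 21)) (Reg 23))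
         (Add (Mem (Add (Reg 11) (Reg 23))) (Mem (Add (Reg 25) (Reg 24)))),
       Assign 24 (Add (Reg 24) (Num 1)),
       IfPos (Sub (Reg 0) (Reg 24)) Skip (Assign 24 (Num 0)),
       Assign 23 (Add (Reg 23) (Num 1))])]"

lemma exec_double_points:
  assumes s: "regs s 0 = int n" "regs s 11 = b" "regs s 21 = int (2 ^ i * n)" "regs s 25 = v"
    and v: "v + int n \<le> b" "arr (mem s) v n (\<lambda>c. g (Suc i * n + c))"
    and arr: "arr (mem s) b (2 ^ i * n) (point_cell n g i)"
  shows "exec n f double_points s (9 * (2 ^ i * n) + 5) (\<lambda>s'. keeps {23, 24} s s' \<and>
     num_queries s' = num_queries s \<and> (\<forall>x<b. mem s' x = mem s x) \<and>
     arr (mem s') b (2 ^ Suc i * n) (point_cell n g (Suc i)))"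
proof -
  define L where "L = 2 ^ i * n"
  have L2: "2 ^ Suc i * n = L + L" by (simp add: L_def)
  have old: "arr (mem s) b L (point_cell n g (Suc i))"
    using arr by (simp add: arr_def L_def)
  have new: "point_cell n g (Suc i) (L + j) = point_cell n g (Suc i) j + g (Suc i * n + j mod n)"
    if "j < L" for j
    using that by (simp add: L_def)
  note [simp del] = point_cell.simps
  show ?thesis
    unfolding double_points_def block.simps L2 L_def[symmetric]
    apply (rule exec_wp_Seq'[where Td = "9 * L + 3"])
     apply (simp only: wp.simps)
     apply (rule exec_wp_Seq'[where Td = "9 * L + 1"])
      apply (simp only: wp.simps)
      apply (rule exec_While'[where T = 8 and N = L and I = "\<lambda>j s'. keeps {23, 24} s s' \<and>
         num_queries s' = num_queries s \<and> (\<forall>x<b. mem s' x = mem s x) \<and>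
         arr (mem s') b (L + j) (point_cell n g (Suc i)) \<and> regs s' 23 = int j \<and> regs s' 24 = int (j mod n)"])
    subgoal using old by (simp add: keeps_def)
    subgoal for j s'
    proof -
      assume j: "j < L" and I: "keeps {23, 24} s s' \<and>
         num_queries s' = num_queries s \<and> (\<forall>x<b. mem s' x = mem s x) \<and>
         arr (mem s') b (L + j) (point_cell n g (Suc i)) \<and> regs s' 23 = int j \<and> regs s' 24 = int (j mod n)"
      then have regs: "regs s' 0 = int n" "regs s' 11 = b" "regs s' 21 = int L" "regs s' 25 = v"
        using s by (auto simp: keeps_def L_def)
      have n: "0 < n" using j by (cases n) (auto simp: L_def)
      then have jn: "j mod n < n" by simp
      have rd1: "mem s' (b + int j) = point_cell n g (Suc i) j" using I j by (simp add: arr_def)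
      have "mem s (v + int (j mod n)) = g (Suc i * n + j mod n)" using v(2) jn by (simp add: arr_def)
      moreover have "v + int (j mod n) < b" using v(1) jn by linarith
      ultimately have rd2: "mem s' (v + int (j mod n)) = g (Suc i * n + j mod n)" using I by simp
      have "arr ((mem s')(b + int L + int j := point_cell n g (Suc i) j + g (Suc i * n + j mod n)))
          b (Suc (L + j)) (point_cell n g (Suc i))"
        using I new[OF j] by (intro arr_append) auto
      moreover have "int (Suc j mod n) = (if int n - (int (j mod n) + 1) > 0 then int (j mod n) + 1 else 0)"
        using jn by (auto simp: mod_Suc)
      ultimately show ?thesis
        using I j regs rd1 rd2 by (auto intro!: exec_wp simp: keeps_def)
    qed
    subgoal using s(3) by (simp add: keeps_def L_def)
    subgoal by simp
    subgoal by simp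
    subgoal by simp
    done
qed

definition make_points :: com where
  "make_points = block [
     Assign 21 (Reg 0),
     Assign 25 (Add (Reg 12) (Reg 0)),
     Assign 22 (Reg 6),
     WhilePos (Reg 22) (Seq double_points (block [
       Assign 25 (Add (Reg 25) (Reg 0)),
       Assign 21 (Add (Reg 21) (Reg 21)),
       Assign 22 (Sub (Reg 22) (Num 1))]))]"

lemma exec_make_points:
  assumes s: "regs s 0 = int n" "regs s 6 = int k" "regs s 11 = b" "regs s 12 = q"
    and q: "q + int (Suc k * n) \<le> b" "arr (mem s) q (Suc k * n) g"
    and arr: "arr (mem s) b n g"
  shows "exec n f make_points s (k * (9 * (2 ^ k * n) + 12) + 7) (\<lambda>s'. keeps {21, 22, 23, 24, 25} s s' \<and>
     num_queries s' = num_queries s \<and> (\<forall>x<b. mem s' x = mem s x) \<and>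
     arr (mem s') b (2 ^ k * n) (point_cell n g k) \<and> regs s' 21 = int (2 ^ k * n) \<and>
     regs s' 25 = q + int (Suc k * n))"
proof -
  define T where "T = 9 * (2 ^ k * n) + 12"
  let ?I = "\<lambda>i s'. keeps {21, 22, 23, 24, 25} s s' \<and>
     num_queries s' = num_queries s \<and> (\<forall>x<b. mem s' x = mem s x) \<and>
     arr (mem s') b (2 ^ i * n) (point_cell n g i) \<and> regs s' 21 = int (2 ^ i * n) \<and>
     regs s' 22 = int k - int i \<and> regs s' 25 = q + int (Suc i * n)"
  have body: "exec n f (Seq double_points (block [
       Assign 25 (Add (Reg 25) (Reg 0)),
       Assign 21 (Add (Reg 21) (Reg 21)),
       Assign 22 (Sub (Reg 22) (Num 1))])) s' (T - 1) (?I (Suc i))" if i: "i < k" and I: "?I i s'" for i s'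
  proof (rule exec_Seq'[OF exec_double_points])
    show "regs s' 0 = int n" "regs s' 11 = b" using I s by (auto simp: keeps_def)
    show "regs s' 21 = int (2 ^ i * n)" "regs s' 25 = q + int (Suc i * n)"
      "arr (mem s') b (2 ^ i * n) (point_cell n g i)" using I by auto
    have le: "Suc i * n + n \<le> Suc k * n" using i mult_le_mono1[of "Suc (Suc i)" "Suc k" n] by simp
    then show le': "q + int (Suc i * n) + int n \<le> b" using q(1) by linarith
    show "arr (mem s') (q + int (Suc i * n)) n (\<lambda>c. g (Suc i * n + c))"
      unfolding arr_def
    proof (intro allI impI)
      fix j assume j: "j < n"
      then have "q + int (Suc i * n) + int j < b" using le' by linarith
      then have "mem s' (q + int (Suc i * n) + int j) = mem s (q + int (Suc i * n + j))"
        using I by (simp add: add.assoc)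
      also have "\<dots> = g (Suc i * n + j)"
        using q(2) le j unfolding arr_def by (metis add_less_cancel_left less_le_trans)
      finally show "mem s' (q + int (Suc i * n) + int j) = g (Suc i * n + j)" .
    qed
  next
    fix s''
    assume "keeps {23, 24} s' s'' \<and> num_queries s'' = num_queries s' \<and> (\<forall>x<b. mem s'' x = mem s' x) \<and>
     arr (mem s'') b (2 ^ Suc i * n) (point_cell n g (Suc i))"
    then show "exec n f (block [
       Assign 25 (Add (Reg 25) (Reg 0)),
       Assign 21 (Add (Reg 21) (Reg 21)),
       Assign 22 (Sub (Reg 22) (Num 1))]) s'' 5 (?I (Suc i))"
      using I s by (auto intro!: exec_wp simp: keeps_def algebra_simps)
  next
    have "2 ^ i * n \<le> 2 ^ k * n" using i by (intro mult_le_mono1 power_increasing) auto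
    then show "9 * (2 ^ i * n) + 5 + 5 + 1 \<le> T - 1" by (simp add: T_def)
  qed
  show ?thesis
    unfolding make_points_def block.simps
    apply (rule exec_wp_Seq'[where Td = "k * T + 5"])
     apply (simp only: wp.simps)
     apply (rule exec_wp_Seq'[where Td = "k * T + 3"])
      apply (simp only: wp.simps)
      apply (rule exec_wp_Seq'[where Td = "k * T + 1"])
       apply (simp only: wp.simps)
       apply (rule exec_While'[where T = "T - 1" and N = k and I = ?I])
    subgoal using s arr by (simp add: keeps_def arr_def)
    subgoal for i s' using body[of i s'] by simp
    subgoal by simp
    subgoal by (simp add: T_def)
    subgoal by simp
    subgoal by simp
    subgoal by (simp add: T_def)
    done
qed

definition query_points :: com where
  "query_points = block [
     Assign 20 (Reg 11),
     Assign 26 (Add (Reg 11) (Reg 21)),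
     Assign 23 (Num 0),
     WhilePos (Sub (Reg 5) (Reg 23)) (block [
       Query 24 (Reg 20),
       Store (Add (Reg 26) (Reg 23)) (Reg 24),
       Assign 20 (Add (Reg 20) (Reg 0)),
       Assign 23 (Add (Reg 23) (Num 1))])]"

lemma exec_query_points:
  assumes s: "regs s 0 = int n" "regs s 5 = int K" "regs s 11 = b" "regs s 21 = int (K * n)"
    and arr: "arr (mem s) b (K * n) p"
  shows "exec n f query_points s (8 * K + 7) (\<lambda>s'. keeps {20, 23, 24, 26} s s' \<and>
     num_queries s' = num_queries s + K \<and> (\<forall>x<b + int (K * n). mem s' x = mem s x) \<and>
     regs s' 26 = b + int (K * n) \<and>
     arr (mem s') (b + int (K * n)) K (\<lambda>y. f (Matrix.vec n (\<lambda>i. of_int (p (y * n + i))))))"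
proof -
  define w where "w = b + int (K * n)"
  let ?g = "\<lambda>y. f (Matrix.vec n (\<lambda>i. of_int (p (y * n + i))))"
  show ?thesis
    unfolding query_points_def block.simps w_def[symmetric]
    apply (rule exec_wp_Seq'[where Td = "8 * K + 5"])
     apply (simp only: wp.simps)
     apply (rule exec_wp_Seq'[where Td = "8 * K + 3"])
      apply (simp only: wp.simps)
      apply (rule exec_wp_Seq'[where Td = "8 * K + 1"])
       apply (simp only: wp.simps)
       apply (rule exec_While'[where T = 7 and N = K and I = "\<lambda>j s'. keeps {20, 23, 24, 26} s s' \<and>
          num_queries s' = num_queries s + j \<and> (\<forall>x<w. mem s' x = mem s x) \<and>
          regs s' 26 = w \<and> arr (mem s') w j ?g \<and> regs s' 23 = int j \<and> regs s' 20 = b + int (j * n)"])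
    subgoal using s by (simp add: keeps_def w_def)
    subgoal for j s'
    proof -
      assume j: "j < K" and I: "keeps {20, 23, 24, 26} s s' \<and>
          num_queries s' = num_queries s + j \<and> (\<forall>x<w. mem s' x = mem s x) \<and>
          regs s' 26 = w \<and> arr (mem s') w j ?g \<and> regs s' 23 = int j \<and> regs s' 20 = b + int (j * n)"
      then have regs: "regs s' 0 = int n" "regs s' 5 = int K"
        using s by (auto simp: keeps_def)
      have "mem s' (b + int (j * n) + int i) = p (j * n + i)" if i: "i < n" for i
      proof -
        have "j * n + i < K * n"
          using i j mult_le_mono1[of "Suc j" K n] by simp
        moreover from this have "b + int (j * n + i) < w" by (simp only: w_def)
        ultimately have "mem s' (b + int (j * n + i)) = p (j * n + i)"
          using I arr unfolding arr_def by metis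
        then show ?thesis by (simp add: add.assoc)
      qed
      then have q: "Matrix.vec n (\<lambda>i. of_int (mem s' (b + int (j * n) + int i)))
          = (Matrix.vec n (\<lambda>i. of_int (p (j * n + i))) :: bit Matrix.vec)"
        by (intro eq_vecI) auto
      have "arr ((mem s')(w + int j := ?g j)) w (Suc j) ?g"
        using I by (intro arr_append) auto
      then show ?thesis
        using I j regs q by (auto intro!: exec_wp simp: keeps_def algebra_simps)
    qed
    subgoal using s(2) by (simp add: keeps_def)
    subgoal by simp
    subgoal by simp
    subgoal by simp
    subgoal by simp
    done
qed

text \<open>The constant-geometry form of the Walsh-Hadamard transform: every stage combines the
  positions \<open>j\<close> and \<open>j + H\<close> into \<open>2 * j\<close> and
  \<open>2 * j + 1\<close>, so the program needs no stage-dependent strides.\<close>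

definition stage_fun :: "nat \<Rightarrow> (nat \<Rightarrow> int) \<Rightarrow> nat \<Rightarrow> int" where
  "stage_fun H a j = (if even j then a (j div 2) + a (j div 2 + H) else a (j div 2) - a (j div 2 + H))"

definition transform_stage :: com where
  "transform_stage = block [
     Assign 23 (Num 0),
     Assign 24 (Add (Reg 26) (Reg 5)),
     WhilePos (Sub (Reg 7) (Reg 23)) (block [
       Store (Reg 24) (Add (Mem (Add (Reg 26) (Reg 23))) (Mem (Add (Add (Reg 26) (Reg 23)) (Reg 7)))),
       Store (Add (Reg 24) (Num 1))
         (Sub (Mem (Add (Reg 26) (Reg 23))) (Mem (Add (Add (Reg 26) (Reg 23)) (Reg 7)))),
       Assign 24 (Add (Reg 24) (Num 2)),
       Assign 23 (Add (Reg 23) (Num 1))])]"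

lemma exec_transform_stage:
  assumes s: "regs s 5 = int (2 * H)" "regs s 7 = int H" "regs s 26 = w"
    and arr: "arr (mem s) w (2 * H) a"
  shows "exec n f transform_stage s (8 * H + 5) (\<lambda>s'. keeps {23, 24} s s' \<and>
     num_queries s' = num_queries s \<and> (\<forall>x<w + int (2 * H). mem s' x = mem s x) \<and>
     arr (mem s') (w + int (2 * H)) (2 * H) (stage_fun H a))"
proof -
  define d where "d = w + int (2 * H)"
  show ?thesis
    unfolding transform_stage_def block.simps d_def[symmetric]
    apply (rule exec_wp_Seq'[where Td = "8 * H + 3"])
     apply (simp only: wp.simps)
     apply (rule exec_wp_Seq'[where Td = "8 * H + 1"])
      apply (simp only: wp.simps)
      apply (rule exec_While'[where T = 7 and N = H and I = "\<lambda>j s'. keeps {23, 24} s s' \<and>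
         num_queries s' = num_queries s \<and> (\<forall>x<d. mem s' x = mem s x) \<and>
         arr (mem s') d (2 * j) (stage_fun H a) \<and> regs s' 23 = int j \<and> regs s' 24 = d + 2 * int j"])
    subgoal using s by (simp add: keeps_def d_def)
    subgoal for j s'
    proof -
      assume j: "j < H" and I: "keeps {23, 24} s s' \<and>
         num_queries s' = num_queries s \<and> (\<forall>x<d. mem s' x = mem s x) \<and>
         arr (mem s') d (2 * j) (stage_fun H a) \<and> regs s' 23 = int j \<and> regs s' 24 = d + 2 * int j"
      then have regs: "regs s' 7 = int H" "regs s' 26 = w" using s by (auto simp: keeps_def)
      have "mem s (w + int (j + H)) = a (j + H)" "mem s (w + int j) = a j"
        using arr j unfolding arr_def by (simp_all del: of_nat_add)
      then have rd: "mem s' (w + int j + int H) = a (j + H)" "mem s' (w + int j) = a j"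
        using I j by (auto simp: d_def add.assoc)
      have "arr ((mem s')(d + 2 * int j := a j + a (j + H), d + 2 * int j + 1 := a j - a (j + H)))
          d (Suc (Suc (2 * j))) (stage_fun H a)"
        using I by (intro arr_append) (auto simp: stage_fun_def)
      then show ?thesis
        using I j regs rd by (auto intro!: exec_wp simp: keeps_def d_def algebra_simps)
    qed
    subgoal using s(2) by (simp add: keeps_def)
    subgoal by simp
    subgoal by simp
    subgoal by simp
    done
qed

definition transform :: com where
  "transform = block [
     Assign 22 (Reg 6),
     WhilePos (Reg 22) (Seq transform_stage (block [
       Assign 26 (Add (Reg 26) (Reg 5)),
       Assign 22 (Sub (Reg 22) (Num 1))]))]"

lemma exec_transform:
  assumes s: "regs s 5 = int (2 * H)" "regs s 6 = int k" "regs s 7 = int H" "regs s 26 = w"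
    and arr: "arr (mem s) w (2 * H) a"
  shows "exec n f transform s (k * (8 * H + 10) + 3) (\<lambda>s'. keeps {22, 23, 24, 26} s s' \<and>
     num_queries s' = num_queries s \<and> (\<forall>x<w. mem s' x = mem s x) \<and>
     regs s' 26 = w + int (k * (2 * H)) \<and>
     arr (mem s') (w + int (k * (2 * H))) (2 * H) ((stage_fun H ^^ k) a))"
proof -
  let ?I = "\<lambda>i s'. keeps {22, 23, 24, 26} s s' \<and>
     num_queries s' = num_queries s \<and> (\<forall>x<w. mem s' x = mem s x) \<and>
     regs s' 22 = int k - int i \<and> regs s' 26 = w + int (i * (2 * H)) \<and>
     arr (mem s') (w + int (i * (2 * H))) (2 * H) ((stage_fun H ^^ i) a)"
  have body: "exec n f (Seq transform_stage (block [
       Assign 26 (Add (Reg 26) (Reg 5)),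
       Assign 22 (Sub (Reg 22) (Num 1))])) s' (8 * H + 9) (?I (Suc i))" if i: "i < k" and I: "?I i s'" for i s'
  proof (rule exec_Seq'[OF exec_transform_stage[where a = "(stage_fun H ^^ i) a"]])
    show "regs s' 5 = int (2 * H)" "regs s' 7 = int H" using I s by (auto simp: keeps_def)
    show "regs s' 26 = w + int (i * (2 * H))"
      "arr (mem s') (w + int (i * (2 * H))) (2 * H) ((stage_fun H ^^ i) a)" using I by auto
  next
    fix s''
    assume post: "keeps {23, 24} s' s'' \<and> num_queries s'' = num_queries s' \<and>
     (\<forall>x<w + int (i * (2 * H)) + int (2 * H). mem s'' x = mem s' x) \<and>
     arr (mem s'') (w + int (i * (2 * H)) + int (2 * H)) (2 * H) (stage_fun H ((stage_fun H ^^ i) a))"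
    have eq: "w + int (i * (2 * H)) + int (2 * H) = w + int (Suc i * (2 * H))" by simp
    have "\<forall>x<w. mem s'' x = mem s x"
    proof (intro allI impI)
      fix x assume "x < w"
      moreover from this have "x < w + int (i * (2 * H)) + int (2 * H)" by linarith
      ultimately show "mem s'' x = mem s x" using post I by simp
    qed
    then show "exec n f (block [
       Assign 26 (Add (Reg 26) (Reg 5)),
       Assign 22 (Sub (Reg 22) (Num 1))]) s'' 3 (?I (Suc i))"
      using I s post unfolding eq by (auto intro!: exec_wp simp: keeps_def algebra_simps)
  qed simp
  show ?thesis
    unfolding transform_def block.simps(2,3)
    apply (rule exec_wp_Seq'[where Td = "k * (8 * H + 10) + 1"])
     apply (simp only: wp.simps)
     apply (rule exec_While'[where T = "8 * H + 9" and N = k and I = ?I])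
    subgoal using s arr by (simp add: keeps_def)
    subgoal for i s' using body[of i s'] by simp
    subgoal by simp
    subgoal by simp
    subgoal by simp
    done
qed

definition one_round :: com where
  "one_round = block [copy_origin, make_points, query_points, transform, block [
     Assign 14 (Sub (Add (Reg 26) (Reg 5)) (Reg 11)),
     Assign 11 (Add (Reg 26) (Reg 5)),
     Assign 12 (Reg 25),
     Assign 13 (Sub (Reg 13) (Num 1))]]"

definition round_table :: "nat \<Rightarrow> (bit Matrix.vec \<Rightarrow> int) \<Rightarrow> nat \<Rightarrow> nat \<Rightarrow> (nat \<Rightarrow> int) \<Rightarrow> nat \<Rightarrow> int" where
  "round_table n f k H g = (stage_fun H ^^ k)
     (\<lambda>y. f (Matrix.vec n (\<lambda>i. of_int (point_cell n g k (y * n + i)))))"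

text \<open>The points take \<open>2 ^ k * n\<close> cells. They are followed by
  \<open>Suc k\<close> tables: the queried values and the outputs of the \<open>k\<close> stages,
  each written to fresh cells. The final table ends the region.\<close>

definition round_size :: "nat \<Rightarrow> nat \<Rightarrow> nat" where
  "round_size n k = 2 ^ k * n + Suc k * 2 ^ k"

definition round_time :: "nat \<Rightarrow> nat \<Rightarrow> nat" where
  "round_time n k = 4 * n + k * (9 * (2 ^ k * n) + 12) + 8 * 2 ^ k + k * (4 * 2 ^ k + 10) + 31"

abbreviation scratch :: "nat set" where
  "scratch \<equiv> {11, 12, 13, 14, 20, 21, 22, 23, 24, 25, 26}"

lemma exec_one_round:
  assumes s: "regs s 0 = int n" "regs s 5 = int (2 ^ k)" "regs s 6 = int k" "regs s 7 = int H"
      "regs s 11 = b" "regs s 12 = q"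
    and H: "2 * H = 2 ^ k" and q: "q + int (Suc k * n) \<le> b" "arr (mem s) q (Suc k * n) g"
  shows "exec n f one_round s (round_time n k) (\<lambda>s'. keeps scratch s s' \<and>
     num_queries s' = num_queries s + 2 ^ k \<and> (\<forall>x<b. mem s' x = mem s x) \<and>
     regs s' 11 = b + int (round_size n k) \<and> regs s' 12 = q + int (Suc k * n) \<and>
     regs s' 13 = regs s 13 - 1 \<and> regs s' 14 = int (round_size n k) \<and>
     arr (mem s') (b + int (round_size n k) - int (2 ^ k)) (2 ^ k) (round_table n f k H g))"
proof -
  define w where "w = b + int (2 ^ k * n)"
  define G where "G = (\<lambda>y. f (Matrix.vec n (\<lambda>i. of_int (point_cell n g k (y * n + i)))))"
  define d where "d = w + int (k * 2 ^ k)"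
  have d: "b + int (round_size n k) = d + int (2 ^ k)"
    by (simp add: d_def w_def round_size_def algebra_simps)
  have qn: "q + int n \<le> b" using q(1) of_nat_mono[of n "Suc k * n"] by (simp del: of_nat_mult)
  have "arr (mem s) q n g" using q(2) by (simp add: arr_def)
  note 1 = exec_copy_origin[where f = f, OF s(1,5,6) qn this]
  define tail where "tail = block [
     Assign 14 (Sub (Add (Reg 26) (Reg 5)) (Reg 11)),
     Assign 11 (Add (Reg 26) (Reg 5)),
     Assign 12 (Reg 25),
     Assign 13 (Sub (Reg 13) (Num 1))]"
  let ?Q = "\<lambda>s'. keeps scratch s s' \<and>
     num_queries s' = num_queries s + 2 ^ k \<and> (\<forall>x<b. mem s' x = mem s x) \<and>
     regs s' 11 = d + int (2 ^ k) \<and> regs s' 12 = q + int (Suc k * n) \<and>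
     regs s' 13 = regs s 13 - 1 \<and> regs s' 14 = int (round_size n k) \<and>
     arr (mem s') (d + int (2 ^ k) - int (2 ^ k)) (2 ^ k) (round_table n f k H g)"
  have "exec n f (Seq copy_origin (Seq make_points (Seq query_points (Seq transform tail)))) s (round_time n k) ?Q"
  proof (rule exec_Seq'[where Td = "round_time n k - (4 * n + 4)", OF 1])
    fix s1 assume I1: "keeps {20} s s1 \<and> num_queries s1 = num_queries s \<and>
      (\<forall>x<b. mem s1 x = mem s x) \<and> arr (mem s1) b n g"
    have r1: "regs s1 0 = int n" "regs s1 6 = int k" "regs s1 11 = b" "regs s1 12 = q"
      using I1 s by (auto simp: keeps_def)
    have q1: "arr (mem s1) q (Suc k * n) g"
    proof (rule arr_cong[OF q(2)])
      fix j assume "j < Suc k * n"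
      then have "q + int j < b" using q(1) by linarith
      then show "mem s1 (q + int j) = mem s (q + int j)" using I1 by blast
    qed
    have b1: "arr (mem s1) b n g" using I1 by simp
    note 2 = exec_make_points[where f = f, OF r1 q(1) q1 b1]
    show "exec n f (Seq make_points (Seq query_points (Seq transform tail))) s1
      (round_time n k - (4 * n + 4)) ?Q"
    proof (rule exec_Seq'[where Td = "8 * 2 ^ k + k * (4 * 2 ^ k + 10) + 19", OF 2])
      fix s2 assume I2: "keeps {21, 22, 23, 24, 25} s1 s2 \<and>
        num_queries s2 = num_queries s1 \<and> (\<forall>x<b. mem s2 x = mem s1 x) \<and>
        arr (mem s2) b (2 ^ k * n) (point_cell n g k) \<and> regs s2 21 = int (2 ^ k * n) \<and>
        regs s2 25 = q + int (Suc k * n)"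
      have r2: "regs s2 0 = int n" "regs s2 5 = int (2 ^ k)" "regs s2 11 = b"
        "regs s2 21 = int (2 ^ k * n)"
        using I1 I2 s by (auto simp: keeps_def)
      have b2: "arr (mem s2) b (2 ^ k * n) (point_cell n g k)" using I2 by simp
      note 3 = exec_query_points[where f = f, OF r2 b2, folded G_def w_def]
      show "exec n f (Seq query_points (Seq transform tail)) s2
        (8 * 2 ^ k + k * (4 * 2 ^ k + 10) + 19) ?Q"
      proof (rule exec_Seq'[where Td = "k * (4 * 2 ^ k + 10) + 11", OF 3])
        fix s3 assume I3: "keeps {20, 23, 24, 26} s2 s3 \<and>
          num_queries s3 = num_queries s2 + 2 ^ k \<and> (\<forall>x<w. mem s3 x = mem s2 x) \<and>
          regs s3 26 = w \<and> arr (mem s3) w (2 ^ k) G"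
        have r3: "regs s3 5 = int (2 * H)" "regs s3 6 = int k" "regs s3 7 = int H" "regs s3 26 = w"
          "arr (mem s3) w (2 * H) G"
          using I1 I2 I3 s by (auto simp: keeps_def H)
        have bw: "b \<le> w" by (simp add: w_def)
        note 4 = exec_transform[where f = f, OF r3]
        show "exec n f (Seq transform tail) s3 (k * (4 * 2 ^ k + 10) + 11) ?Q"
        proof (rule exec_Seq'[where Td = 7, OF 4])
          fix s4 assume I4: "keeps {22, 23, 24, 26} s3 s4 \<and>
            num_queries s4 = num_queries s3 \<and> (\<forall>x<w. mem s4 x = mem s3 x) \<and>
            regs s4 26 = w + int (k * (2 * H)) \<and>
            arr (mem s4) (w + int (k * (2 * H))) (2 * H) ((stage_fun H ^^ k) G)"
          have m4: "\<forall>x<b. mem s4 x = mem s x" using I1 I2 I3 I4 bw by simp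
          have a4: "arr (mem s4) d (2 ^ k) (round_table n f k H g)" "regs s4 26 = d"
            using I4 by (simp_all add: d_def H round_table_def G_def)
          have r4: "regs s4 5 = int (2 ^ k)" "regs s4 11 = b" "regs s4 25 = q + int (Suc k * n)"
            "regs s4 13 = regs s 13"
            using I1 I2 I3 I4 s by (auto simp: keeps_def)
          have k4: "\<forall>r. r \<notin> scratch \<longrightarrow> regs s4 r = regs s r" "outputs s4 = outputs s"
            using I1 I2 I3 I4 by (auto simp: keeps_def)
          have rs: "d + 2 ^ k - b = int (round_size n k)" using d by simp
          show "exec n f tail s4 7 ?Q"
            unfolding tail_def
            by (rule exec_wp) (use m4 a4 r4 k4 rs I1 I2 I3 I4 in \<open>simp_all add: keeps_def\<close>)
        next
          have "8 * H = 4 * 2 ^ k" using H by simp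
          then show "k * (8 * H + 10) + 3 + 7 + 1 \<le> k * (4 * 2 ^ k + 10) + 11" by simp
        qed
      next
        show "8 * 2 ^ k + 7 + (k * (4 * 2 ^ k + 10) + 11) + 1 \<le> 8 * 2 ^ k + k * (4 * 2 ^ k + 10) + 19"
          by simp
      qed
    next
      show "k * (9 * (2 ^ k * n) + 12) + 7 + (8 * 2 ^ k + k * (4 * 2 ^ k + 10) + 19) + 1
        \<le> round_time n k - (4 * n + 4)"
        by (simp add: round_time_def)
    qed
  next
    show "4 * n + 3 + (round_time n k - (4 * n + 4)) + 1 \<le> round_time n k"
      by (simp add: round_time_def)
  qed
  then show ?thesis
    unfolding one_round_def block.simps(2,3) d tail_def .
qed

section \<open>Counts over the tables and majority levels\<close>

definition count_level :: com where
  "count_level = block [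
     Assign 26 (Num 0),
     Assign 27 (Num 0),
     WhilePos (Sub (Reg 5) (Reg 27)) (block [
       Assign 28 (Mem (Add (Reg 24) (Reg 27))),
       IfPos (Sub (Add (Reg 28) (Num 1)) (Reg 22)) (Assign 26 (Add (Reg 26) (Num 1)))
         (IfPos (Sub (Sub (Num 1) (Reg 28)) (Reg 22)) (Assign 26 (Add (Reg 26) (Num 1))) Skip),
       Assign 27 (Add (Reg 27) (Num 1))])]"

definition table_count :: "nat \<Rightarrow> (nat \<Rightarrow> int) \<Rightarrow> nat \<Rightarrow> nat" where
  "table_count K w u = card {a. a < K \<and> int u \<le> \<bar>w a\<bar>}"

lemma card_less_Suc: "card {a. a < Suc j \<and> P a} = card {a. a < j \<and> P a} + of_bool (P j)"
proof -
  have "{a. a < Suc j \<and> P a} = (if P j then insert j {a. a < j \<and> P a} else {a. a < j \<and> P a})"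
    by (auto simp: less_Suc_eq)
  then show ?thesis by simp
qed

text \<open>The machine only tests for positivity, so \<open>u \<le> \<bar>w\<bar>\<close> becomes
  \<open>w + 1 - u > 0\<close> or \<open>1 - w - u > 0\<close>; nesting the conditionals counts an
  entry once even if both tests succeed.\<close>

lemma exec_count_level:
  assumes s: "regs s 5 = int K" "regs s 22 = int u" "regs s 24 = p" and w: "arr (mem s) p K w"
  shows "exec n f count_level s (9 * K + 5) (\<lambda>s'. keeps {26, 27, 28} s s' \<and> mem s' = mem s \<and>
     num_queries s' = num_queries s \<and> regs s' 26 = int (table_count K w u))"
  unfolding count_level_def block.simps table_count_def
  apply (rule exec_wp_Seq'[where Td = "9 * K + 3"])
   apply (simp only: wp.simps)
   apply (rule exec_wp_Seq'[where Td = "9 * K + 1"])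
    apply (simp only: wp.simps)
    apply (rule exec_While'[where T = 8 and N = K and I = "\<lambda>j s'. keeps {26, 27, 28} s s' \<and> mem s' = mem s \<and>
       num_queries s' = num_queries s \<and> regs s' 27 = int j \<and>
       regs s' 26 = int (card {a. a < j \<and> int u \<le> \<bar>w a\<bar>})"])
  subgoal by (simp add: keeps_def)
  subgoal for j s'
  proof -
    assume j: "j < K" and I: "keeps {26, 27, 28} s s' \<and> mem s' = mem s \<and>
       num_queries s' = num_queries s \<and> regs s' 27 = int j \<and>
       regs s' 26 = int (card {a. a < j \<and> int u \<le> \<bar>w a\<bar>})"
    then have "regs s' 5 = int K" "regs s' 22 = int u" "regs s' 24 = p" "mem s' (p + int j) = w j"
      using s w by (auto simp: keeps_def arr_def)
    then show ?thesis
      using I j by (auto intro!: exec_wp simp: keeps_def card_less_Suc)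
  qed
  subgoal using s by (simp add: keeps_def)
  subgoal by simp
  subgoal by simp
  subgoal by simp
  done

text \<open>Register 8, the number of random bits, is also the address at which the round regions
  start. Each region has the size in register 14 and ends with its table, so adding that size moves
  from one table to the next.\<close>

definition count_rounds :: com where
  "count_rounds = block [
     Assign 23 (Num 0),
     Assign 24 (Sub (Add (Reg 8) (Reg 14)) (Reg 5)),
     Assign 25 (Reg 3),
     WhilePos (Reg 25) (Seq count_level (block [
       IfPos (Sub (Add (Reg 26) (Num 1)) (Reg 20)) (Assign 23 (Add (Reg 23) (Num 1))) Skip,
       Assign 24 (Add (Reg 24) (Reg 14)),
       Assign 25 (Sub (Reg 25) (Num 1))]))]"

definition round_count :: "nat \<Rightarrow> nat \<Rightarrow> (nat \<Rightarrow> nat \<Rightarrow> int) \<Rightarrow> nat \<Rightarrow> nat \<Rightarrow> nat" where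
  "round_count R K W i u = card {r. r < R \<and> i \<le> table_count K (W r) u}"

lemma exec_count_rounds:
  assumes s: "regs s 3 = int R" "regs s 5 = int K" "regs s 8 = M" "regs s 14 = S"
      "regs s 20 = int i" "regs s 22 = int u"
    and W: "\<And>r. r < R \<Longrightarrow> arr (mem s) (M + (int r + 1) * S - int K) K (W r)"
  shows "exec n f count_rounds s (R * (9 * K + 13) + 7) (\<lambda>s'. keeps {23, 24, 25, 26, 27, 28} s s' \<and>
     mem s' = mem s \<and> num_queries s' = num_queries s \<and> regs s' 23 = int (round_count R K W i u))"
proof -
  let ?I = "\<lambda>r s'. keeps {23, 24, 25, 26, 27, 28} s s' \<and> mem s' = mem s \<and>
       num_queries s' = num_queries s \<and> regs s' 24 = M + (int r + 1) * S - int K \<and>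
       regs s' 25 = int R - int r \<and> regs s' 23 = int (card {r'. r' < r \<and> i \<le> table_count K (W r') u})"
  have body: "exec n f (Seq count_level (block [
       IfPos (Sub (Add (Reg 26) (Num 1)) (Reg 20)) (Assign 23 (Add (Reg 23) (Num 1))) Skip,
       Assign 24 (Add (Reg 24) (Reg 14)),
       Assign 25 (Sub (Reg 25) (Num 1))])) s' (9 * K + 12) (?I (Suc r))" if r: "r < R" and I: "?I r s'" for r s'
  proof (rule exec_Seq'[where Td = 6, OF exec_count_level])
    show "regs s' 5 = int K" "regs s' 22 = int u" "regs s' 24 = M + (int r + 1) * S - int K"
      "arr (mem s') (M + (int r + 1) * S - int K) K (W r)"
      using I s W[OF r] by (auto simp: keeps_def)
  next
    fix s'' assume "keeps {26, 27, 28} s' s'' \<and> mem s'' = mem s' \<and>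
     num_queries s'' = num_queries s' \<and> regs s'' 26 = int (table_count K (W r) u)"
    then show "exec n f (block [
       IfPos (Sub (Add (Reg 26) (Num 1)) (Reg 20)) (Assign 23 (Add (Reg 23) (Num 1))) Skip,
       Assign 24 (Add (Reg 24) (Reg 14)),
       Assign 25 (Sub (Reg 25) (Num 1))]) s'' 6 (?I (Suc r))"
      using I s by (auto intro!: exec_wp simp: keeps_def card_less_Suc algebra_simps)
  qed simp
  show ?thesis
    unfolding count_rounds_def block.simps(2,3) round_count_def
    apply (rule exec_wp_Seq'[where Td = "R * (9 * K + 13) + 5"])
     apply (simp only: wp.simps)
     apply (rule exec_wp_Seq'[where Td = "R * (9 * K + 13) + 3"])
      apply (simp only: wp.simps)
      apply (rule exec_wp_Seq'[where Td = "R * (9 * K + 13) + 1"])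
       apply (simp only: wp.simps)
       apply (rule exec_While'[where T = "9 * K + 12" and N = R and I = ?I])
    subgoal using s by (simp add: keeps_def)
    subgoal for r s' using body[of r s'] by simp
    subgoal by simp
    subgoal by simp
    subgoal by simp
    subgoal by simp
    subgoal by simp
    done
qed

definition scan_levels :: com where
  "scan_levels = block [
     Assign 21 (Num 0),
     Assign 22 (Num 0),
     WhilePos (Sub (Reg 5) (Reg 22)) (Seq (Assign 22 (Add (Reg 22) (Num 1))) (Seq count_rounds
       (IfPos (Sub (Add (Reg 23) (Reg 23)) (Reg 3)) (Assign 21 (Reg 22)) Skip)))]"

text \<open>When all entries are at most \<open>K\<close> in absolute value, scanning up to
  \<open>u = K\<close> gives the lower median over the rounds of the \<open>i\<close>-th largest
  absolute entry, with \<open>i\<close> counted from 1. A position beyond the table size yields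
  0.\<close>

primrec majority_level :: "nat \<Rightarrow> nat \<Rightarrow> (nat \<Rightarrow> nat \<Rightarrow> int) \<Rightarrow> nat \<Rightarrow> nat \<Rightarrow> nat" where
  "majority_level R K W i 0 = 0"
| "majority_level R K W i (Suc u) =
     (if R < 2 * round_count R K W i (Suc u) then Suc u else majority_level R K W i u)"

lemma exec_scan_levels:
  assumes s: "regs s 3 = int R" "regs s 5 = int K" "regs s 8 = M" "regs s 14 = S" "regs s 20 = int i"
    and W: "\<And>r. r < R \<Longrightarrow> arr (mem s) (M + (int r + 1) * S - int K) K (W r)"
  shows "exec n f scan_levels s (K * (R * (9 * K + 13) + 13) + 5)
    (\<lambda>s'. keeps {21, 22, 23, 24, 25, 26, 27, 28} s s' \<and>
     mem s' = mem s \<and> num_queries s' = num_queries s \<and> regs s' 21 = int (majority_level R K W i K))"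
proof -
  let ?I = "\<lambda>u s'. keeps {21, 22, 23, 24, 25, 26, 27, 28} s s' \<and> mem s' = mem s \<and>
       num_queries s' = num_queries s \<and> regs s' 22 = int u \<and> regs s' 21 = int (majority_level R K W i u)"
  have body: "exec n f (Seq (Assign 22 (Add (Reg 22) (Num 1))) (Seq count_rounds
       (IfPos (Sub (Add (Reg 23) (Reg 23)) (Reg 3)) (Assign 21 (Reg 22)) Skip))) s'
       (R * (9 * K + 13) + 12) (?I (Suc u))" if u: "u < K" and I: "?I u s'" for u s'
    apply (rule exec_wp_Seq'[where Td = "R * (9 * K + 13) + 10"])
     apply (simp only: wp.simps)
     apply (rule exec_Seq'[where Td = 2, OF exec_count_rounds[where R = R and K = K and u = "Suc u" and W = W]])
              apply (rule refl | use I s W in \<open>simp add: keeps_def\<close>; fail)+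
    subgoal for s'' using I s
      by (auto intro!: exec_wp simp: keeps_def)
    subgoal by simp
    subgoal by simp
    done
  show ?thesis
    unfolding scan_levels_def block.simps(2,3)
    apply (rule exec_wp_Seq'[where Td = "K * (R * (9 * K + 13) + 13) + 3"])
     apply (simp only: wp.simps)
     apply (rule exec_wp_Seq'[where Td = "K * (R * (9 * K + 13) + 13) + 1"])
      apply (simp only: wp.simps)
      apply (rule exec_While'[where T = "R * (9 * K + 13) + 12" and N = K and I = ?I])
    subgoal by (simp add: keeps_def)
    subgoal for u s' using body[of u s'] s by (simp add: keeps_def)
    subgoal using s by (simp add: keeps_def)
    subgoal by simp
    subgoal by simp
    subgoal by simp
    done
qed

definition report :: com where
  "report = block [
     Assign 20 (Num 0),
     WhilePos (Sub (Reg 1) (Reg 20)) (Seq (Assign 20 (Add (Reg 20) (Num 1))) (Seq scan_levels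
       (Output (Reg 21) (Reg 5))))]"

lemma exec_report:
  assumes s: "regs s 1 = int t" "regs s 3 = int R" "regs s 5 = int K" "regs s 8 = M" "regs s 14 = S"
    and W: "\<And>r. r < R \<Longrightarrow> arr (mem s) (M + (int r + 1) * S - int K) K (W r)"
  shows "exec n f report s (t * (K * (R * (9 * K + 13) + 13) + 10) + 3)
    (\<lambda>s'. num_queries s' = num_queries s \<and>
      outputs s' = outputs s @ map (\<lambda>i. real (majority_level R K W (Suc i) K) / real K) [0..<t])"
proof -
  let ?T = "K * (R * (9 * K + 13) + 13)"
  let ?I = "\<lambda>i s'. (\<forall>r. r \<notin> {20, 21, 22, 23, 24, 25, 26, 27, 28} \<longrightarrow> regs s' r = regs s r) \<and> mem s' = mem s \<and>
       num_queries s' = num_queries s \<and> regs s' 20 = int i \<and>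
       outputs s' = outputs s @ map (\<lambda>i. real (majority_level R K W (Suc i) K) / real K) [0..<i]"
  have body: "exec n f (Seq (Assign 20 (Add (Reg 20) (Num 1))) (Seq scan_levels
       (Output (Reg 21) (Reg 5)))) s'
       (?T + 9) (?I (Suc i))" if i: "i < t" and I: "?I i s'" for i s'
    apply (rule exec_wp_Seq'[where Td = "?T + 7"])
     apply (simp only: wp.simps)
     apply (rule exec_Seq'[where Td = 1, OF exec_scan_levels[where R = R and K = K and i = "Suc i" and W = W]])
             apply (rule refl | use I s W in \<open>simp; fail\<close>)+
    subgoal for s'' using I s
      by (auto intro!: exec_wp simp: keeps_def)
    subgoal by simp
    subgoal by simp
    done
  show ?thesis
    unfolding report_def block.simps(2,3)
    apply (rule exec_wp_Seq'[where Td = "t * (?T + 10) + 1"])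
     apply (simp only: wp.simps)
     apply (rule exec_While'[where T = "?T + 9" and N = t and I = ?I])
    subgoal by simp
    subgoal for i s' using body[of i s'] s by simp
    subgoal using s by simp
    subgoal by simp
    subgoal by simp
    done
qed

subsection \<open>The complete program\<close>

definition double :: "exp \<Rightarrow> exp" where
  "double a = Add a a"

lemma eval_double_power [simp]: "eval_exp s ((double ^^ m) a) = 2 ^ m * eval_exp s a"
  by (induction m) (auto simp: double_def)

text \<open>Doubling the accuracy in register 4 multiplies the table size by \<open>2 ^ 12\<close>.
  The half size in register 7 is carried along since the machine cannot divide: eleven doublings of
  the old size give the new half. A negative number of rounds, possible for
  \<open>\<delta> > 1\<close>, is reset to 0.\<close>

definition choose_size :: com where
  "choose_size = block [
     IfPos (Reg 3) Skip (Assign 3 (Num 0)),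
     Assign 4 (Num 1),
     Assign 5 (Num (2 ^ 18)),
     Assign 7 (Num (2 ^ 17)),
     Assign 6 (Num 18),
     WhilePos (Sub (Reg 2) (Reg 4)) (block [
       Assign 4 (double (Reg 4)),
       Assign 7 ((double ^^ 11) (Reg 5)),
       Assign 5 (double (Reg 7)),
       Assign 6 (Add (Reg 6) (Num 12))])]"

text \<open>The reciprocal accuracy is rounded up to a power of two because the table size is one;
  for \<open>E \<ge> 1\<close> this costs less than a factor 2.\<close>

definition accuracy_bits :: "int \<Rightarrow> nat" where
  "accuracy_bits E = (LEAST q. E \<le> 2 ^ q)"

lemma le_two_power: "E \<le> 2 ^ nat E" for E :: int
proof (cases "E \<ge> 0")
  case True
  have "int (nat E) < int (2 ^ nat E)" by (simp only: of_nat_less_iff less_exp)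
  then show ?thesis using True by simp
next
  case False
  then show ?thesis by (smt (verit) zero_less_power)
qed

lemma accuracy_bits_ge: "E \<le> 2 ^ accuracy_bits E"
  unfolding accuracy_bits_def by (rule LeastI[of _ "nat E"]) (rule le_two_power)

lemma less_accuracy_bits: "q < accuracy_bits E \<Longrightarrow> 2 ^ q < E"
  unfolding accuracy_bits_def using not_less_Least by fastforce

lemma accuracy_bits_less: "1 \<le> E \<Longrightarrow> 2 ^ accuracy_bits E < 2 * E"
  using less_accuracy_bits[of "accuracy_bits E - 1" E]
  by (cases "accuracy_bits E") auto

lemma exec_choose_size:
  assumes q: "q = accuracy_bits (regs s 2)"
  shows "exec n f choose_size s (8 * q + 14) (\<lambda>s'. keeps {3, 4, 5, 6, 7} s s' \<and> mem s' = mem s \<and>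
    num_queries s' = num_queries s \<and> regs s' 3 = max 0 (regs s 3) \<and> regs s' 6 = int (18 + 12 * q) \<and>
    regs s' 5 = int (2 ^ (18 + 12 * q)) \<and> regs s' 7 = int (2 ^ (17 + 12 * q)))"
  unfolding choose_size_def block.simps
  apply (rule exec_Seq'[where Tc = 2 and Td = "8 * q + 10" and P = "\<lambda>s'. keeps {3} s s' \<and> mem s' = mem s \<and>
      num_queries s' = num_queries s \<and> regs s' 3 = max 0 (regs s 3)"])
  subgoal by (rule exec_wp) (auto simp: keeps_def)
  subgoal for s1
    apply (rule exec_wp_Seq'[where Td = "8 * q + 7 + 1"])
     apply (simp only: wp.simps)
     apply (rule exec_wp_Seq'[where Td = "8 * q + 5 + 1"])
      apply (simp only: wp.simps)
      apply (rule exec_wp_Seq'[where Td = "8 * q + 3 + 1"])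
       apply (simp only: wp.simps)
       apply (rule exec_wp_Seq'[where Td = "8 * q + 1"])
        apply (simp only: wp.simps)
        apply (rule exec_While'[where T = 7 and N = q and I = "\<lambda>j s'. keeps {3, 4, 5, 6, 7} s s' \<and> mem s' = mem s \<and>
           num_queries s' = num_queries s \<and> regs s' 3 = max 0 (regs s 3) \<and> regs s' 6 = int (18 + 12 * j) \<and>
           regs s' 4 = 2 ^ j \<and>
           regs s' 5 = int (2 ^ (18 + 12 * j)) \<and> regs s' 7 = int (2 ^ (17 + 12 * j))"])
    subgoal by (auto simp: keeps_def)
    subgoal for j s' using less_accuracy_bits[of j "regs s 2"]
      by (auto intro!: exec_wp simp: keeps_def q double_def power_add)
    subgoal using accuracy_bits_ge[of "regs s 2"] by (auto simp: keeps_def q)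
    subgoal by simp
    subgoal by simp
    subgoal by simp
    subgoal by simp
    subgoal by simp
    done
  subgoal by simp
  done

definition count_bits :: com where
  "count_bits = block [
     Assign 21 (Num 0),
     Assign 20 (Add (Reg 6) (Num 1)),
     WhilePos (Reg 20) (block [Assign 21 (Add (Reg 21) (Reg 0)), Assign 20 (Sub (Reg 20) (Num 1))]),
     Assign 8 (Num 0),
     Assign 13 (Reg 3),
     WhilePos (Reg 13) (block [Assign 8 (Add (Reg 8) (Reg 21)), Assign 13 (Sub (Reg 13) (Num 1))]),
     Assign 9 (Num 0)]"

lemma exec_count_bits:
  assumes s: "regs s 0 = int n" "regs s 3 = int R" "regs s 6 = int k"
  shows "exec n f count_bits s (4 * k + 4 * R + 20) (\<lambda>s'. keeps {8, 9, 13, 20, 21} s s' \<and> mem s' = mem s \<and>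
    num_queries s' = num_queries s \<and> regs s' 8 = int (R * (Suc k * n)) \<and> regs s' 9 = 0)"
  unfolding count_bits_def block.simps
  apply (rule exec_wp_Seq'[where Td = "4 * k + 4 * R + 18"])
   apply (simp only: wp.simps)
   apply (rule exec_wp_Seq'[where Td = "4 * k + 4 * R + 16"])
    apply (simp only: wp.simps)
    apply (rule exec_Seq'[where Td = "4 * R + 10"])
      apply (rule exec_While'[where T = 3 and N = "Suc k" and T' = "4 * Suc k + 1"
         and I = "\<lambda>j s'. keeps {8, 9, 13, 20, 21} s s' \<and> mem s' = mem s \<and>
          num_queries s' = num_queries s \<and> regs s' 20 = int (Suc k) - int j \<and> regs s' 21 = int (j * n)"
         and Q = "\<lambda>s'. keeps {8, 9, 13, 20, 21} s s' \<and> mem s' = mem s \<and>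
          num_queries s' = num_queries s \<and> regs s' 21 = int (Suc k * n)"])
  subgoal using s by (simp add: keeps_def)
  subgoal for j s' using s by (auto intro!: exec_wp simp: keeps_def algebra_simps)
  subgoal by simp
  subgoal by simp
  subgoal for s1
    apply (rule exec_wp_Seq'[where Td = "4 * R + 8"])
     apply (simp only: wp.simps)
     apply (rule exec_wp_Seq'[where Td = "4 * R + 6"])
      apply (simp only: wp.simps)
      apply (rule exec_Seq'[where Td = 1])
        apply (rule exec_While'[where T = 3 and N = R and T' = "4 * R + 1"
           and I = "\<lambda>j s'. keeps {8, 9, 13, 20, 21} s s' \<and> mem s' = mem s \<and>
            num_queries s' = num_queries s \<and> regs s' 13 = int R - int j \<and> regs s' 21 = int (Suc k * n) \<and>
            regs s' 8 = int (j * (Suc k * n))"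
           and Q = "\<lambda>s'. keeps {8, 9, 13, 20, 21} s s' \<and> mem s' = mem s \<and>
            num_queries s' = num_queries s \<and> regs s' 8 = int (R * (Suc k * n))"])
    subgoal using s by (simp add: keeps_def)
    subgoal for j s' using s by (auto intro!: exec_wp simp: keeps_def algebra_simps)
    subgoal by simp
    subgoal by simp
    subgoal by (auto intro!: exec_wp simp: keeps_def)
    subgoal by simp
    subgoal by simp
    subgoal by simp
    done
  subgoal by simp
  subgoal by simp
  subgoal by simp
  done

section \<open>Tossing all coins in advance\<close>

definition sample :: com where
  "sample = WhilePos (Sub (Reg 8) (Reg 9)) (Seq (Flip 10) (Seq (Store (Reg 9) (Reg 10))
     (Assign 9 (Add (Reg 9) (Num 1)))))"

fun store_bits :: "state \<Rightarrow> bool list \<Rightarrow> state" where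
  "store_bits s [] = s"
| "store_bits s (b # bs) = store_bits
     (s\<lparr>mem := (mem s)(regs s 9 := of_bool b), regs := (regs s)(10 := of_bool b, 9 := regs s 9 + 1)\<rparr>) bs"

text \<open>Randomness enters only here, before any query; everything afterwards is a deterministic
  function of the bits. The step count is exact, six per coin and one for the exit, so that all
  outcomes continue with the same number of remaining steps.\<close>

lemma run_sample:
  assumes "regs s 8 = regs s 9 + int m"
  shows "run n f (6 * m + 1 + j) (sample # cs, s)
    = bind_pmf (replicate_pmf m (bernoulli_pmf (1 / 2))) (\<lambda>bs. run n f j (cs, store_bits s bs))"
  using assms
proof (induction m arbitrary: s)
  case 0
  then show ?case by (simp add: sample_def bind_return_pmf)
next
  case (Suc m)
  let ?s = "\<lambda>b. s\<lparr>mem := (mem s)(regs s 9 := of_bool b), regs := (regs s)(10 := of_bool b, 9 := regs s 9 + 1)\<rparr>"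
  have unroll: "run n f (Suc (Suc (Suc (Suc (Suc (Suc N)))))) (sample # cs, s)
      = bind_pmf (bernoulli_pmf (1 / 2)) (\<lambda>b. run n f N (sample # cs, ?s b))" for N
    using Suc.prems
    by (simp add: sample_def bind_return_pmf map_pmf_def bind_assoc_pmf of_bool_def)
  have "6 * Suc m + 1 + j = Suc (Suc (Suc (Suc (Suc (Suc (6 * m + 1 + j))))))" by simp
  then have "run n f (6 * Suc m + 1 + j) (sample # cs, s)
      = bind_pmf (bernoulli_pmf (1 / 2)) (\<lambda>b. run n f (6 * m + 1 + j) (sample # cs, ?s b))"
    by (simp only: unroll)
  also have "\<dots> = bind_pmf (bernoulli_pmf (1 / 2)) (\<lambda>b. bind_pmf (replicate_pmf m (bernoulli_pmf (1 / 2)))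
      (\<lambda>bs. run n f j (cs, store_bits (?s b) bs)))"
    using Suc.prems by (intro bind_pmf_cong refl Suc.IH) simp
  finally show ?case by (simp add: bind_assoc_pmf bind_return_pmf)
qed

lemma store_bits:
  shows "regs s 9 = b \<Longrightarrow> arr (mem s) 0 N g \<Longrightarrow> b = int N \<Longrightarrow> (\<And>j. g (N + j) = of_bool (bs ! j)) \<Longrightarrow>
    keeps {9, 10} s (store_bits s bs) \<and> num_queries (store_bits s bs) = num_queries s \<and>
    arr (mem (store_bits s bs)) 0 (N + length bs) g"
proof (induction bs arbitrary: s b N)
  case (Cons x bs)
  let ?s = "s\<lparr>mem := (mem s)(regs s 9 := of_bool x), regs := (regs s)(10 := of_bool x, 9 := regs s 9 + 1)\<rparr>"
  have "keeps {9, 10} ?s (store_bits ?s bs) \<and> num_queries (store_bits ?s bs) = num_queries ?s \<and>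
    arr (mem (store_bits ?s bs)) 0 (Suc N + length bs) g"
  proof (rule Cons.IH[of _ "int (Suc N)"])
    show "arr (mem ?s) 0 (Suc N) g" using Cons.prems(1-3) Cons.prems(4)[of 0] by (auto intro: arr_append)
    show "g (Suc N + j) = of_bool (bs ! j)" for j using Cons.prems(4)[of "Suc j"] by simp
  qed (use Cons.prems in auto)
  then show ?case by (auto simp: keeps_def)
qed (simp add: keeps_def)

definition process :: com where
  "process = block [
     Assign 11 (Reg 8),
     Assign 12 (Num 0),
     Assign 13 (Reg 3),
     WhilePos (Reg 13) one_round,
     report]"

definition process_time :: "nat \<Rightarrow> nat \<Rightarrow> nat \<Rightarrow> nat \<Rightarrow> nat" where
  "process_time n t R k =
     R * (round_time n k + 1) + t * (2 ^ k * (R * (9 * 2 ^ k + 13) + 13) + 10) + 11"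

lemma exec_process:
  fixes f
  assumes s: "regs s 0 = int n" "regs s 1 = int t" "regs s 3 = int R" "regs s 5 = int (2 ^ k)"
      "regs s 6 = int k" "regs s 7 = int H" "regs s 8 = int (R * (Suc k * n))"
    and H: "2 * H = 2 ^ k" and g: "arr (mem s) 0 (R * (Suc k * n)) g"
  defines "W \<equiv> \<lambda>r. round_table n f k H (\<lambda>j. g (r * (Suc k * n) + j))"
  shows "exec n f process s (process_time n t R k) (\<lambda>s'. num_queries s' = num_queries s + R * 2 ^ k \<and>
    outputs s' = outputs s @ map (\<lambda>i. real (majority_level R (2 ^ k) W (Suc i) (2 ^ k)) / real (2 ^ k)) [0..<t])"
proof -
  define w where "w = Suc k * n"
  define M where "M = int (R * w)"
  define S where "S = int (round_size n k)"
  have S: "int (2 ^ k) \<le> S" unfolding S_def of_nat_le_iff by (simp add: round_size_def)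
  \<comment> \<open>Register 14 receives the region size only when a round runs, hence the guard
    \<open>0 < r\<close>; for \<open>R = 0\<close> there is no table to address.\<close>
  let ?I = "\<lambda>r s'. keeps scratch s s' \<and> num_queries s' = num_queries s + r * 2 ^ k \<and>
     (\<forall>x<M. mem s' x = mem s x) \<and> regs s' 11 = M + int r * S \<and> regs s' 12 = int (r * w) \<and>
     regs s' 13 = int R - int r \<and> (0 < r \<longrightarrow> regs s' 14 = S) \<and>
     (\<forall>r'<r. arr (mem s') (M + (int r' + 1) * S - int (2 ^ k)) (2 ^ k) (W r'))"
  have body: "exec n f one_round s' (round_time n k) (?I (Suc r))" if r: "r < R" and I: "?I r s'" for r s'
  proof (rule exec_mono[OF exec_one_round[where g = "\<lambda>j. g (r * w + j)"]])
    show "regs s' 0 = int n" "regs s' 5 = int (2 ^ k)" "regs s' 6 = int k" "regs s' 7 = int H"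
      "regs s' 11 = M + int r * S" "regs s' 12 = int (r * w)"
      using I s by (auto simp: keeps_def)
    show "2 * H = 2 ^ k" by (rule H)
    have le: "r * w + w \<le> R * w" using r mult_le_mono1[of "Suc r" R w] by simp
    then have "int (r * w) + int w \<le> M" unfolding M_def by linarith
    moreover have S0: "0 \<le> int r * S" by (simp add: S_def)
    ultimately show "int (r * w) + int (Suc k * n) \<le> M + int r * S" unfolding w_def by linarith
    show "arr (mem s') (int (r * w)) (Suc k * n) (\<lambda>j. g (r * w + j))"
      unfolding arr_def w_def[symmetric]
    proof (intro allI impI)
      fix j assume j: "j < w"
      then have lt: "r * w + j < R * w" using le by linarith
      then have "int (r * w) + int j < M" unfolding M_def by linarith
      then have "mem s' (int (r * w) + int j) = mem s (0 + int (r * w + j))" using I by simp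
      also have "\<dots> = g (r * w + j)" using g lt unfolding arr_def w_def by blast
      finally show "mem s' (int (r * w) + int j) = g (r * w + j)" .
    qed
  next
    fix s'' assume post: "keeps scratch s' s'' \<and> num_queries s'' = num_queries s' + 2 ^ k \<and>
     (\<forall>x<M + int r * S. mem s'' x = mem s' x) \<and>
     regs s'' 11 = M + int r * S + int (round_size n k) \<and>
     regs s'' 12 = int (r * w) + int (Suc k * n) \<and> regs s'' 13 = regs s' 13 - 1 \<and>
     regs s'' 14 = int (round_size n k) \<and>
     arr (mem s'') (M + int r * S + int (round_size n k) - int (2 ^ k)) (2 ^ k)
       (round_table n f k H (\<lambda>j. g (r * w + j)))"
    have S0: "0 \<le> int r * S" by (simp add: S_def)
    have new: "arr (mem s'') (M + (int r + 1) * S - int (2 ^ k)) (2 ^ k) (W r)"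
      using post by (simp add: W_def w_def S_def algebra_simps)
    have old: "arr (mem s'') (M + (int r' + 1) * S - int (2 ^ k)) (2 ^ k) (W r')" if r': "r' < r" for r'
    proof (rule arr_cong)
      show "arr (mem s') (M + (int r' + 1) * S - int (2 ^ k)) (2 ^ k) (W r')" using I r' by blast
      fix j :: nat assume "j < 2 ^ k"
      then have "int j < int (2 ^ k)" by (simp only: of_nat_less_iff)
      moreover have "(int r' + 1) * S \<le> int r * S"
        using r' by (intro mult_right_mono) (auto simp: S_def)
      ultimately have "M + (int r' + 1) * S - int (2 ^ k) + int j < M + int r * S" by linarith
      then show "mem s'' (M + (int r' + 1) * S - int (2 ^ k) + int j)
          = mem s' (M + (int r' + 1) * S - int (2 ^ k) + int j)" using post by blast
    qed
    have "arr (mem s'') (M + (int r' + 1) * S - int (2 ^ k)) (2 ^ k) (W r')" if "r' < Suc r" for r'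
      using old new that by (cases "r' = r") auto
    moreover have "\<forall>x<M. mem s'' x = mem s x" using post I S0 by simp
    moreover have "keeps scratch s s''" using post I by (simp add: keeps_def)
    moreover have "regs s'' 11 = M + int (Suc r) * S" "regs s'' 12 = int (Suc r * w)"
      "regs s'' 13 = int R - int (Suc r)" "regs s'' 14 = S"
      using post I by (simp_all add: S_def w_def algebra_simps)
    ultimately show "?I (Suc r) s''" using post I by simp
  qed simp
  show ?thesis
    unfolding process_def block.simps process_time_def
    apply (rule exec_wp_Seq'[where Td = "R * (round_time n k + 1) + t * (2 ^ k * (R * (9 * 2 ^ k + 13) + 13) + 10) + 9"])
     apply (simp only: wp.simps)
     apply (rule exec_wp_Seq'[where Td = "R * (round_time n k + 1) + t * (2 ^ k * (R * (9 * 2 ^ k + 13) + 13) + 10) + 7"])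
      apply (simp only: wp.simps)
      apply (rule exec_wp_Seq'[where Td = "R * (round_time n k + 1) + t * (2 ^ k * (R * (9 * 2 ^ k + 13) + 13) + 10) + 5"])
       apply (simp only: wp.simps)
       apply (rule exec_Seq'[where Td = "t * (2 ^ k * (R * (9 * 2 ^ k + 13) + 13) + 10) + 3"])
         apply (rule exec_While'[where T = "round_time n k" and N = R and I = ?I and Q = "?I R"
           and T' = "R * (round_time n k + 1) + 1"])
    subgoal using s by (simp add: keeps_def M_def w_def)
    subgoal for r s' using body[of r s'] by simp
    subgoal by simp
    subgoal by simp
    subgoal premises I for s'
    proof -
      have M: "regs s' 8 = M" using I s by (simp add: keeps_def M_def w_def)
      have W: "arr (mem s') (M + (int r + 1) * regs s' 14 - int (2 ^ k)) (2 ^ k) (W r)" if "r < R" for r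
        using I that by simp
      have "regs s' 1 = int t" "regs s' 3 = int R" "regs s' 5 = int (2 ^ k)"
        using I s by (auto simp: keeps_def)
      from exec_report[OF this M refl W, of n f] show ?thesis
        by (rule exec_mono) (use I in \<open>auto simp: keeps_def\<close>)
    qed
    subgoal by simp
    subgoal by simp
    subgoal by simp
    subgoal by simp
    done
qed

subsection \<open>Correctness of the computed tables\<close>

definition bits_vec :: "nat \<Rightarrow> bool list \<Rightarrow> bit Matrix.vec" where
  "bits_vec n bs = Matrix.vec n (\<lambda>i. of_bool (bs ! i))"

text \<open>Two independent uniform draws are uniform on the product, and \<open>Cons\<close> is a
  bijection from that product onto the longer lists.\<close>

lemma replicate_pmf_of_set:
  assumes "finite A" "A \<noteq> {}"
  shows "replicate_pmf n (pmf_of_set A) = pmf_of_set {xs. set xs \<subseteq> A \<and> length xs = n}"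
proof (induction n)
  case 0
  have "{xs. set xs \<subseteq> A \<and> length xs = 0} = {[]}" by auto
  then show ?case by (simp add: pmf_of_set_singleton)
next
  case (Suc n)
  let ?B = "{xs. set xs \<subseteq> A \<and> length xs = n}"
  have B: "finite ?B" "?B \<noteq> {}"
    using assms by (auto simp: finite_lists_length_eq intro!: exI[of _ "replicate n (SOME x. x \<in> A)"]
      some_in_eq[THEN iffD2])
  have "replicate_pmf (Suc n) (pmf_of_set A)
      = map_pmf (\<lambda>(x, xs). x # xs) (pair_pmf (pmf_of_set A) (pmf_of_set ?B))"
    by (simp add: Suc pair_pmf_def map_bind_pmf map_return_pmf bind_assoc_pmf bind_return_pmf
        case_prod_beta)
  also have "pair_pmf (pmf_of_set A) (pmf_of_set ?B) = pmf_of_set (A \<times> ?B)"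
  proof (rule pmf_eqI)
    fix z :: "'a \<times> 'a list"
    show "pmf (pair_pmf (pmf_of_set A) (pmf_of_set ?B)) z = pmf (pmf_of_set (A \<times> ?B)) z"
      using pmf_of_set[OF assms(2,1)] pmf_of_set[OF B(2,1)] pmf_of_set[of "A \<times> ?B"] assms B
      by (cases z) (simp add: pmf_pair indicator_times card_cartesian_product del: mem_Collect_eq)
  qed
  also have "map_pmf (\<lambda>(x, xs). x # xs) (pmf_of_set (A \<times> ?B)) = pmf_of_set {xs. set xs \<subseteq> A \<and> length xs = Suc n}"
    by (rule map_pmf_of_set_bij_betw, rule bij_betw_byWitness[where f' = "\<lambda>xs. (hd xs, tl xs)"])
      (use assms B in \<open>auto simp: length_Suc_conv\<close>)
  finally show ?case .
qed

lemma map_bits_vec_coins: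
  "map_pmf (bits_vec n) (replicate_pmf n (bernoulli_pmf (1 / 2))) = pmf_of_set (cube n)"
proof -
  have "bij_betw (bits_vec n) {xs. length xs = n} (cube n)"
  proof (rule bij_betw_byWitness[where f' = "\<lambda>v. map (\<lambda>i. vec_index v i = 1) [0..<n]"])
    show "\<forall>xs\<in>{xs. length xs = n}. map (\<lambda>i. vec_index (bits_vec n xs) i = 1) [0..<n] = xs"
      by (auto simp: bits_vec_def intro!: nth_equalityI)
    show "\<forall>v\<in>cube n. bits_vec n (map (\<lambda>i. vec_index v i = 1) [0..<n]) = v"
    proof
      fix v :: "bit Matrix.vec" assume "v \<in> cube n"
      moreover have "of_bool (b = 1) = b" for b :: bit by (cases b) auto
      ultimately show "bits_vec n (map (\<lambda>i. vec_index v i = 1) [0..<n]) = v"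
        by (intro eq_vecI) (auto simp: bits_vec_def)
    qed
  qed (auto simp: bits_vec_def)
  then show ?thesis
    unfolding bernoulli_pmf_half_conv_pmf_of_set
    using finite_lists_length_eq[of "UNIV :: bool set" n] Ex_list_of_length[of n]
    by (subst replicate_pmf_of_set) (auto intro!: map_pmf_of_set_bij_betw)
qed

lemma map_replicate_pmf: "map_pmf (map g) (replicate_pmf k p) = replicate_pmf k (map_pmf g p)"
proof (induction k)
  case (Suc k)
  have "map_pmf (map g) (replicate_pmf (Suc k) p)
      = bind_pmf p (\<lambda>x. bind_pmf (map_pmf (map g) (replicate_pmf k p)) (\<lambda>ys. return_pmf (g x # ys)))"
    by (simp add: map_bind_pmf map_return_pmf bind_map_pmf)
  then show ?case by (simp add: Suc bind_map_pmf)
qed simp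

lemma concat_replicate_pmf:
  "map_pmf concat (replicate_pmf r (replicate_pmf m p)) = replicate_pmf (r * m) p"
proof (induction r)
  case (Suc r)
  have "map_pmf concat (replicate_pmf (Suc r) (replicate_pmf m p))
      = bind_pmf (replicate_pmf m p) (\<lambda>xs. bind_pmf (map_pmf concat (replicate_pmf r (replicate_pmf m p)))
          (\<lambda>ys. return_pmf (xs @ ys)))"
    by (simp add: map_bind_pmf map_return_pmf bind_map_pmf)
  then show ?case by (simp add: Suc replicate_pmf_distrib)
qed simp

lemma nth_concat_uniform:
  assumes "\<And>xs. xs \<in> set xss \<Longrightarrow> length xs = m" "r < length xss" "j < m"
  shows "concat xss ! (r * m + j) = xss ! r ! j"
  using assms
proof (induction xss arbitrary: r)
  case (Cons xs xss)
  show ?case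
  proof (cases r)
    case (Suc r')
    then have "concat xss ! (r' * m + j) = xss ! r' ! j" using Cons.prems by (intro Cons.IH) auto
    then show ?thesis using Cons.prems(1)[of xs] Suc by (simp add: nth_append)
  qed (use Cons.prems in \<open>simp add: nth_append\<close>)
qed simp

text \<open>Reduction modulo 2 of the integer cells: \<open>of_int\<close> into \<open>bit\<close>
  turns the accumulated sums into vector addition.\<close>

definition point_vec :: "nat \<Rightarrow> (nat \<Rightarrow> int) \<Rightarrow> nat \<Rightarrow> nat \<Rightarrow> bit Matrix.vec" where
  "point_vec n g i y = Matrix.vec n (\<lambda>c. of_int (point_cell n g i (y * n + c)))"

definition chunk_vec :: "nat \<Rightarrow> (nat \<Rightarrow> int) \<Rightarrow> nat \<Rightarrow> bit Matrix.vec" where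
  "chunk_vec n g i = Matrix.vec n (\<lambda>c. of_int (g (i * n + c)))"

lemma point_vec_Suc:
  assumes "y < 2 ^ i"
  shows "point_vec n g (Suc i) y = point_vec n g i y"
    and "point_vec n g (Suc i) (y + 2 ^ i) = point_vec n g i y + chunk_vec n g (Suc i)"
proof -
  have lt: "y * n + c < 2 ^ i * n" if "c < n" for c
    using that assms mult_le_mono1[of "Suc y" "2 ^ i" n] by simp
  show "point_vec n g (Suc i) y = point_vec n g i y"
    unfolding point_vec_def using lt by (intro eq_vecI) auto
  have eq: "(y + 2 ^ i) * n + c = 2 ^ i * n + (y * n + c)" for c by (simp add: algebra_simps)
  show "point_vec n g (Suc i) (y + 2 ^ i) = point_vec n g i y + chunk_vec n g (Suc i)"
    unfolding point_vec_def chunk_vec_def eq by (intro eq_vecI) auto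
qed

lemma point_vec_mono:
  assumes "y < 2 ^ i" "i \<le> k"
  shows "point_vec n g k y = point_vec n g i y"
  using assms(2)
proof (induction k rule: dec_induct)
  case (step j)
  have "(2::nat) ^ i \<le> 2 ^ j" using step by (intro power_increasing) auto
  then have "y < 2 ^ j" using assms(1) by linarith
  then show ?case using step by (simp add: point_vec_Suc(1))
qed simp

text \<open>Stage \<open>m\<close> of the transform has processed the top \<open>m\<close> digits of \<open>y\<close>: each stage removes the
  leading digit of the point and appends a low-order digit to the frequency.\<close>

lemma stage_fun_butterfly:
  assumes "m \<le> k" "z < 2 ^ (k - m)" "a < 2 ^ m" "2 * H = 2 ^ k"
  shows "(stage_fun H ^^ m) (\<lambda>y. f (point_vec n g k y)) (z * 2 ^ m + a)
    = butterfly f (map (\<lambda>j. chunk_vec n g (Suc j)) [k - m..<k]) (point_vec n g k z) a"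
  using assms(1-3)
proof (induction m arbitrary: z a)
  case 0
  then show ?case by simp
next
  case (Suc m)
  define i where "i = k - Suc m"
  have i: "k - m = Suc i" "Suc i \<le> k" "k = Suc (i + m)" using Suc.prems by (auto simp: i_def)
  have z: "z < 2 ^ i" using Suc.prems by (simp add: i_def)
  \<comment> \<open>In an index \<open>z * 2 ^ m + a\<close> the offset \<open>H\<close> changes the
    point index by \<open>2 ^ i\<close>, which adds direction \<open>Suc i\<close> to the
    point.\<close>
  have H: "H = 2 ^ i * 2 ^ m" using assms(4) i(3) by (simp add: power_add)
  define j where "j = z * 2 ^ Suc m + a"
  have j: "even j \<longleftrightarrow> even a" "j div 2 = z * 2 ^ m + a div 2" "j div 2 + H = (z + 2 ^ i) * 2 ^ m + a div 2"
  proof -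
    show "even j \<longleftrightarrow> even a" by (simp add: j_def)
    show half: "j div 2 = z * 2 ^ m + a div 2" by (simp add: j_def)
    show "j div 2 + H = (z + 2 ^ i) * 2 ^ m + a div 2" by (simp add: half H algebra_simps)
  qed
  have a: "a div 2 < 2 ^ m" using Suc.prems by auto
  define B where "B = butterfly f (map (\<lambda>j. chunk_vec n g (Suc j)) [Suc i..<k])"
  have IH: "(stage_fun H ^^ m) (\<lambda>y. f (point_vec n g k y)) (y * 2 ^ m + a div 2)
      = B (point_vec n g k y) (a div 2)" if "y < 2 ^ Suc i" for y
    using Suc.IH[of y "a div 2"] Suc.prems(1) a that i(1) by (simp add: B_def)
  have zi: "point_vec n g k (z + 2 ^ i) = point_vec n g k z + chunk_vec n g (Suc i)"
    using point_vec_mono[of "z + 2 ^ i" "Suc i" k n g] point_vec_mono[of z i k n g] z i(2)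
      point_vec_Suc(2)[OF z, of n g] by simp
  have "(stage_fun H ^^ Suc m) (\<lambda>y. f (point_vec n g k y)) j
      = (if even a then B (point_vec n g k z) (a div 2) + B (point_vec n g k z + chunk_vec n g (Suc i)) (a div 2)
         else B (point_vec n g k z) (a div 2) - B (point_vec n g k z + chunk_vec n g (Suc i)) (a div 2))"
    using IH[of z] IH[of "z + 2 ^ i", folded j(3)] z
    by (simp add: stage_fun_def j(1) zi flip: j(2))
  moreover have "[i..<k] = i # [Suc i..<k]" using i(2) by (simp add: upt_conv_Cons)
  ultimately show ?case unfolding j_def i_def[symmetric] by (simp add: B_def)
qed

lemma round_table_eq_butterfly:
  assumes "length bss = Suc k" "\<And>bs. bs \<in> set bss \<Longrightarrow> length bs = n" "2 * H = 2 ^ k" "a < 2 ^ k"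
    and g: "\<And>j. j < Suc k * n \<Longrightarrow> g j = of_bool (concat bss ! j)"
  shows "round_table n f k H g a = butterfly f (tl (map (bits_vec n) bss)) (hd (map (bits_vec n) bss)) a"
proof -
  have chunk: "chunk_vec n g i = bits_vec n (bss ! i)" if "i < Suc k" for i
    unfolding chunk_vec_def bits_vec_def
  proof (rule eq_vecI)
    fix c assume "c < dim_vec (Matrix.vec n (\<lambda>c. of_bool (bss ! i ! c) :: bit))"
    then have c: "c < n" by simp
    have "Suc i * n \<le> Suc k * n" using that by (intro mult_le_mono1) simp
    moreover have "i * n + c < Suc i * n" using c by simp
    ultimately have "i * n + c < Suc k * n" by linarith
    then have "g (i * n + c) = of_bool (bss ! i ! c)"
      using g nth_concat_uniform[of bss n i c] assms(1,2) that c by simp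
    then show "vec_index (Matrix.vec n (\<lambda>c. of_int (g (i * n + c)) :: bit)) c
        = vec_index (Matrix.vec n (\<lambda>c. of_bool (bss ! i ! c))) c" using c by simp
  qed simp
  have "point_vec n g k 0 = point_vec n g 0 0" by (rule point_vec_mono) auto
  also have "\<dots> = chunk_vec n g 0" by (simp add: point_vec_def chunk_vec_def)
  also have "\<dots> = hd (map (bits_vec n) bss)"
    using assms(1) chunk[of 0] by (cases bss) auto
  finally have p0: "point_vec n g k 0 = hd (map (bits_vec n) bss)" .
  have "tl (map (bits_vec n) bss) = map (\<lambda>j. chunk_vec n g (Suc j)) [0..<k]"
    by (rule nth_equalityI) (use assms(1) chunk in \<open>auto simp: nth_tl\<close>)
  then show ?thesis
    using stage_fun_butterfly[of k k 0 a H f n g] assms(3,4)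
    by (simp add: round_table_def point_vec_def[symmetric] p0)
qed

section \<open>The majority level as a median\<close>

lemma majority_level_le: "majority_level R K W i u \<le> u"
  by (induction u) auto

lemma majority_level_majority:
  "majority_level R K W i u \<noteq> 0 \<Longrightarrow> R < 2 * round_count R K W i (majority_level R K W i u)"
  by (induction u) auto

lemma majority_level_maximal:
  "majority_level R K W i u < v \<Longrightarrow> v \<le> u \<Longrightarrow> 2 * round_count R K W i v \<le> R"
  by (induction u) (auto simp: le_Suc_eq split: if_splits)

lemma majority_level_antimono:
  assumes "i \<le> j"
  shows "majority_level R K W j u \<le> majority_level R K W i u"
proof (induction u)
  case (Suc u)
  have "round_count R K W j v \<le> round_count R K W i v" for v
    unfolding round_count_def using assms by (intro card_mono) auto
  then have "2 * round_count R K W j (Suc u) \<le> 2 * round_count R K W i (Suc u)" by simp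
  then show ?case using Suc majority_level_le[of R K W j u] by auto
qed simp

text \<open>The faithful rounds \<open>G\<close> form a majority. The rounds reaching level
  \<open>l\<close> form one too if \<open>l \<noteq> 0\<close>, so the two meet and a common round
  gives the lower bound. The rounds reaching level \<open>l + 1\<close> form no majority, so a round
  of \<open>G\<close> outside them gives the upper bound. Different positions may use different
  rounds.\<close>

lemma majority_level_accurate:
  assumes boolean: "\<forall>x\<in>cube n. f x \<in> {- 1, 1}" and eps: "0 \<le> \<epsilon>"
    and W: "\<And>r u. r < R \<Longrightarrow> table_count (2 ^ k) (W r) u = level_count f (vs r) (x r) u"
    and len: "\<And>r. r < R \<Longrightarrow> length (vs r) = k"
    and maj: "R < 2 * card {r. r < R \<and> faithful n f \<epsilon> (vs r) (x r)}"
    and top: "top_frequencies n f t \<gamma>s" and i: "i < t"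
  shows "\<bar>\<bar>fourier n f (\<gamma>s ! i)\<bar> - real (majority_level R (2 ^ k) W (Suc i) (2 ^ k)) / 2 ^ k\<bar> \<le> \<epsilon>"
proof -
  let ?F = "\<bar>fourier n f (\<gamma>s ! i)\<bar>"
  define l where "l = majority_level R (2 ^ k) W (Suc i) (2 ^ k)"
  define G where "G = {r. r < R \<and> faithful n f \<epsilon> (vs r) (x r)}"
  define A where "A u = {r. r < R \<and> i < level_count f (vs r) (x r) u}" for u
  have rc: "round_count R (2 ^ k) W (Suc i) u = card (A u)" for u
    unfolding round_count_def A_def by (rule arg_cong[of _ _ card]) (auto simp: W Suc_le_eq)
  have fin: "finite G" "finite (A u)" for u by (auto simp: G_def A_def)
  have upper: "?F \<le> real l / 2 ^ k + \<epsilon>"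
  proof (cases "l < 2 ^ k")
    case True
    then have "2 * card (A (Suc l)) \<le> R"
      using majority_level_maximal[of R "2 ^ k" W "Suc i" "2 ^ k" "Suc l"] rc by (simp add: l_def)
    then have "\<not> G \<subseteq> A (Suc l)"
      using maj card_mono[OF fin(2), of G "Suc l"] unfolding G_def[symmetric] by linarith
    then obtain r where "r < R" "faithful n f \<epsilon> (vs r) (x r)" "\<not> i < level_count f (vs r) (x r) (Suc l)"
      by (auto simp: G_def A_def)
    then show ?thesis using faithful_upper[OF _ top i, of \<epsilon> "vs r" "x r" "Suc l"] len[of r] by simp
  next
    case False
    \<comment> \<open>At the top level the output is 1, which bounds every coefficient.\<close>
    then have "l = 2 ^ k" using majority_level_le[of R "2 ^ k" W "Suc i" "2 ^ k"] by (simp add: l_def)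
    have "\<gamma>s ! i \<in> cube n" using top i by (auto simp: top_frequencies_def)
    then show ?thesis using fourier_abs_le_1[OF boolean] eps \<open>l = 2 ^ k\<close> by force
  qed
  have lower: "real l / 2 ^ k - \<epsilon> \<le> ?F"
  proof (cases "l = 0")
    case False
    then have "R < 2 * card (A l)"
      using majority_level_majority[of R "2 ^ k" W "Suc i" "2 ^ k"] rc by (simp add: l_def)
    moreover have "card (G \<union> A l) \<le> R"
      using card_mono[of "{..<R}" "G \<union> A l"] by (auto simp: G_def A_def)
    moreover have "card (G \<union> A l) + card (G \<inter> A l) = card G + card (A l)"
      using card_Un_Int[OF fin] by simp
    ultimately have "card (G \<inter> A l) \<noteq> 0" using maj unfolding G_def[symmetric] by linarith
    then have "G \<inter> A l \<noteq> {}" by auto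
    then obtain r where "r < R" "faithful n f \<epsilon> (vs r) (x r)" "i < level_count f (vs r) (x r) l"
      by (auto simp: G_def A_def)
    then show ?thesis using faithful_lower[OF _ top i, of \<epsilon> "vs r" "x r" l] len[of r] False by simp
  qed (use eps in simp)
  show ?thesis using upper lower unfolding l_def by linarith
qed

section \<open>The complete run and its success probability\<close>

definition algorithm :: com where
  "algorithm = Seq (Seq choose_size count_bits) (Seq sample process)"

lemma run_halted: "run n f k ([], s) = return_pmf ([], s)"
  by (induction k) (auto simp: bind_return_pmf)

definition total_time :: "nat \<Rightarrow> nat \<Rightarrow> nat \<Rightarrow> nat \<Rightarrow> nat \<Rightarrow> nat" where
  "total_time n t R q k =
     8 * q + 4 * k + 4 * R + 6 * (R * (Suc k * n)) + process_time n t R k + 40"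

text \<open>The run is the image of fair coins under a deterministic function \<open>fin\<close>, so
  later arguments concern lists of coins only.\<close>

lemma run_algorithm:
  fixes f n
  assumes q: "q = accuracy_bits \<lceil>1 / \<epsilon>\<rceil>" and k: "k = 18 + 12 * q" and R: "R = nat \<lceil>log 2 (1 / \<delta>)\<rceil>"
  defines "W \<equiv> \<lambda>bs r. round_table n f k (2 ^ (17 + 12 * q)) (\<lambda>j. of_bool (bs ! (r * (Suc k * n) + j)))"
  obtains T fin where "T \<le> total_time n t R q k"
    and "run n f T (init_config algorithm n t \<epsilon> \<delta>)
      = map_pmf (Pair [] \<circ> fin) (replicate_pmf (R * (Suc k * n)) (bernoulli_pmf (1 / 2)))"
    and "\<And>bs. length bs = R * (Suc k * n) \<Longrightarrow> num_queries (fin bs) = R * 2 ^ k \<and>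
      outputs (fin bs) = map (\<lambda>i. real (majority_level R (2 ^ k) (W bs) (Suc i) (2 ^ k)) / 2 ^ k) [0..<t]"
proof -
  define m where "m = R * (Suc k * n)"
  obtain s0 where init: "init_config algorithm n t \<epsilon> \<delta> = ([algorithm], s0)"
    and s0: "regs s0 0 = int n" "regs s0 1 = int t" "regs s0 2 = \<lceil>1 / \<epsilon>\<rceil>" "regs s0 3 = \<lceil>log 2 (1 / \<delta>)\<rceil>"
      "num_queries s0 = 0" "outputs s0 = []"
    by (simp add: init_config_def)
  have "exec n f (Seq choose_size count_bits) s0 (8 * q + 4 * k + 4 * R + 35) (\<lambda>s1.
      regs s1 0 = int n \<and> regs s1 1 = int t \<and> regs s1 3 = int R \<and> regs s1 5 = int (2 ^ k) \<and>
      regs s1 6 = int k \<and> regs s1 7 = int (2 ^ (17 + 12 * q)) \<and> regs s1 8 = int m \<and> regs s1 9 = 0 \<and>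
      num_queries s1 = 0 \<and> outputs s1 = [])"
  proof (rule exec_Seq'[OF exec_choose_size[of q]])
    show "q = accuracy_bits (regs s0 2)" by (simp add: q s0)
  next
    fix s1 assume 1: "keeps {3, 4, 5, 6, 7} s0 s1 \<and> mem s1 = mem s0 \<and>
      num_queries s1 = num_queries s0 \<and> regs s1 3 = max 0 (regs s0 3) \<and> regs s1 6 = int (18 + 12 * q) \<and>
      regs s1 5 = int (2 ^ (18 + 12 * q)) \<and> regs s1 7 = int (2 ^ (17 + 12 * q))"
    then have r1: "regs s1 0 = int n" "regs s1 3 = int R" "regs s1 6 = int k"
      using s0 by (simp_all add: keeps_def R k)
    show "exec n f count_bits s1 (4 * k + 4 * R + 20) (\<lambda>s1.
      regs s1 0 = int n \<and> regs s1 1 = int t \<and> regs s1 3 = int R \<and> regs s1 5 = int (2 ^ k) \<and>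
      regs s1 6 = int k \<and> regs s1 7 = int (2 ^ (17 + 12 * q)) \<and> regs s1 8 = int m \<and> regs s1 9 = 0 \<and>
      num_queries s1 = 0 \<and> outputs s1 = [])"
      by (rule exec_mono[OF exec_count_bits[OF r1]])
        (use 1 s0 r1 in \<open>auto simp: keeps_def m_def k\<close>)
  qed simp
  then obtain s1 t1 where t1: "t1 \<le> 8 * q + 4 * k + 4 * R + 35"
    and s1: "regs s1 0 = int n" "regs s1 1 = int t" "regs s1 3 = int R" "regs s1 5 = int (2 ^ k)"
      "regs s1 6 = int k" "regs s1 7 = int (2 ^ (17 + 12 * q))" "regs s1 8 = int m" "regs s1 9 = 0"
      "num_queries s1 = 0" "outputs s1 = []"
    and run1: "\<And>cs j. run n f (t1 + j) (Seq choose_size count_bits # cs, s0) = run n f j (cs, s1)"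
    unfolding exec_def by blast
  let ?D = "replicate_pmf m (bernoulli_pmf (1 / 2))"
  have "\<exists>s2. run n f (process_time n t R k) ([process], store_bits s1 bs) = return_pmf ([], s2) \<and>
      num_queries s2 = R * 2 ^ k \<and>
      outputs s2 = map (\<lambda>i. real (majority_level R (2 ^ k) (W bs) (Suc i) (2 ^ k)) / 2 ^ k) [0..<t]"
    if "length bs = m" for bs
  proof -
    let ?s = "store_bits s1 bs"
    have sb: "keeps {9, 10} s1 ?s" "num_queries ?s = num_queries s1"
      "arr (mem ?s) 0 (R * (Suc k * n)) (\<lambda>j. of_bool (bs ! j))"
      using store_bits[of s1 0 0 "\<lambda>j. of_bool (bs ! j)" bs] s1 that by (simp_all add: m_def)
    have "exec n f process ?s (process_time n t R k) (\<lambda>s'. num_queries s' = num_queries ?s + R * 2 ^ k \<and>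
      outputs s' = outputs ?s @ map (\<lambda>i. real (majority_level R (2 ^ k) (W bs) (Suc i) (2 ^ k)) / real (2 ^ k)) [0..<t])"
      unfolding W_def by (rule exec_process) (use s1 sb in \<open>auto simp: keeps_def m_def k power_add\<close>)
    then obtain s2 t2 where 2: "t2 \<le> process_time n t R k" "num_queries s2 = num_queries ?s + R * 2 ^ k"
      "outputs s2 = outputs ?s @ map (\<lambda>i. real (majority_level R (2 ^ k) (W bs) (Suc i) (2 ^ k)) / real (2 ^ k)) [0..<t]"
      "\<And>cs j. run n f (t2 + j) (process # cs, ?s) = run n f j (cs, s2)"
      unfolding exec_def by blast
    \<comment> \<open>A halted configuration absorbs the remaining steps, so all outcomes can be run
      up to one common bound even if their running times differ.\<close>
    have "run n f (process_time n t R k) ([process], ?s) = return_pmf ([], s2)"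
      using 2(4)[of "process_time n t R k - t2" "[]"] 2(1) by (simp add: run_halted)
    then show ?thesis using 2 sb s1 by (intro exI[of _ s2]) (auto simp: keeps_def)
  qed
  then obtain fin where fin: "\<And>bs. length bs = m \<Longrightarrow>
      run n f (process_time n t R k) ([process], store_bits s1 bs) = return_pmf ([], fin bs) \<and>
      num_queries (fin bs) = R * 2 ^ k \<and>
      outputs (fin bs) = map (\<lambda>i. real (majority_level R (2 ^ k) (W bs) (Suc i) (2 ^ k)) / 2 ^ k) [0..<t]"
    by metis
  define T where "T = Suc (t1 + Suc (6 * m + 1 + process_time n t R k))"
  have start: "run n f (Suc (t1 + Suc N)) ([algorithm], s0) = run n f N ([sample, process], s1)" for N
    by (simp add: algorithm_def bind_return_pmf run1 del: add_Suc_right)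
  have "run n f T (init_config algorithm n t \<epsilon> \<delta>)
      = run n f (6 * m + 1 + process_time n t R k) ([sample, process], s1)"
    unfolding init T_def by (rule start)
  also have "\<dots> = bind_pmf ?D (\<lambda>bs. run n f (process_time n t R k) ([process], store_bits s1 bs))"
    using s1 by (intro run_sample) simp
  also have "\<dots> = bind_pmf ?D (\<lambda>bs. return_pmf ([], fin bs))"
    using fin by (intro bind_pmf_cong refl) (auto simp: set_replicate_pmf)
  also have "\<dots> = map_pmf (Pair [] \<circ> fin) ?D"
    by (simp add: map_pmf_def o_def)
  finally have run: "run n f T (init_config algorithm n t \<epsilon> \<delta>) = map_pmf (Pair [] \<circ> fin) ?D" .
  have "T \<le> total_time n t R q k"
    using t1 by (simp add: T_def total_time_def m_def)
  then show ?thesis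
    by (rule that[OF _ run[unfolded m_def]]) (use fin in \<open>simp only: m_def\<close>)
qed

text \<open>The flat list of coins is viewed as the concatenation of \<open>R\<close> independent
  rounds of \<open>Suc k\<close> vectors with \<open>n\<close> bits each. Amplification applies to
  the grouped coins, and the event is transported back along
  \<open>concat \<circ> map concat\<close>.\<close>

lemma algorithm_success:
  assumes boolean: "\<forall>x\<in>cube n. f x \<in> {- 1, 1}" and k: "k = 18 + 12 * q" and H: "2 * H = 2 ^ k"
    and top: "top_frequencies n f t \<gamma>s"
  defines "W \<equiv> \<lambda>bs r. round_table n f k H (\<lambda>j. of_bool (bs ! (r * (Suc k * n) + j)))"
  shows "1 - 1 / 2 ^ R \<le> measure_pmf.prob (replicate_pmf (R * (Suc k * n)) (bernoulli_pmf (1 / 2)))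
    {bs. \<forall>i<t. \<bar>\<bar>fourier n f (\<gamma>s ! i)\<bar> - real (majority_level R (2 ^ k) (W bs) (Suc i) (2 ^ k)) / 2 ^ k\<bar> \<le> 1 / 2 ^ q}"
    (is "_ \<le> measure_pmf.prob ?D ?A")
proof -
  let ?V = "replicate_pmf n (bernoulli_pmf (1 / 2))"
  let ?B = "replicate_pmf (Suc k) ?V"
  let ?E = "replicate_pmf R ?B"
  define P where "P bss \<longleftrightarrow> faithful n f (1 / 2 ^ q) (tl (map (bits_vec n) bss)) (hd (map (bits_vec n) bss))" for bss
  have D: "?D = map_pmf (concat \<circ> map concat) ?E"
  proof -
    have "map_pmf (concat \<circ> map concat) ?E = map_pmf concat (map_pmf (map concat) ?E)"
      by (simp only: map_pmf_comp o_def)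
    also have "\<dots> = ?D" by (simp only: map_replicate_pmf concat_replicate_pmf)
    finally show ?thesis ..
  qed
  have "measure_pmf.prob ?B {bss. \<not> P bss}
      = measure_pmf.prob (map_pmf (map (bits_vec n)) ?B) {w. \<not> faithful n f (1 / 2 ^ q) (tl w) (hd w)}"
    unfolding measure_map_pmf P_def vimage_def by simp
  also have "map_pmf (map (bits_vec n)) ?B = replicate_pmf (Suc k) (pmf_of_set (cube n))"
    by (simp only: map_replicate_pmf map_bits_vec_coins)
  finally have "measure_pmf.prob ?B {bss. \<not> P bss} \<le> 1 / 16"
    using prob_unfaithful_le[OF boolean k] by simp
  then have "measure_pmf.prob ?E {bsss. 2 * length (filter P bsss) \<le> R} \<le> 1 / 2 ^ R"
    by (rule majority_amplification)
  then have "1 - 1 / 2 ^ R \<le> 1 - measure_pmf.prob ?E {bsss. 2 * length (filter P bsss) \<le> R}" by simp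
  also have "\<dots> = measure_pmf.prob ?E (- {bsss. 2 * length (filter P bsss) \<le> R})"
    using measure_pmf.prob_compl[of "{bsss. 2 * length (filter P bsss) \<le> R}" ?E] by (simp add: Compl_eq_Diff_UNIV)
  \<comment> \<open>Restricting to the support supplies the list lengths by which single bits are
    addressed.\<close>
  also have "\<dots> = measure_pmf.prob ?E (- {bsss. 2 * length (filter P bsss) \<le> R} \<inter> set_pmf ?E)"
    by (simp add: measure_Int_set_pmf)
  also have "\<dots> \<le> measure_pmf.prob ?E ((concat \<circ> map concat) -` ?A)"
  proof (rule measure_pmf.finite_measure_mono)
    show "- {bsss. 2 * length (filter P bsss) \<le> R} \<inter> set_pmf ?E \<subseteq> (concat \<circ> map concat) -` ?A"
    proof
      fix bsss assume bsss: "bsss \<in> - {bsss. 2 * length (filter P bsss) \<le> R} \<inter> set_pmf ?E"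
      then have lR: "length bsss = R" by (simp add: set_replicate_pmf)
      have l: "length bss = Suc k" "\<And>bs. bs \<in> set bss \<Longrightarrow> length bs = n" if "bss \<in> set bsss" for bss
        using bsss that by (auto simp: set_replicate_pmf lists_eq_set subset_iff simp del: replicate_pmf.simps)
      have lc: "length (concat bss) = Suc k * n" if "bss \<in> set bsss" for bss
      proof -
        have "map length bss = map (\<lambda>_. n) bss"
          using l(2)[OF that] by simp
        then have "length (concat bss) = length bss * n"
          by (simp only: length_concat sum_list_triv of_nat_id)
        then show ?thesis by (simp only: l(1)[OF that])
      qed
      define bs where "bs = concat (map concat bsss)"
      define vs where "vs r = tl (map (bits_vec n) (bsss ! r))" for r
      define x where "x r = hd (map (bits_vec n) (bsss ! r))" for r
      have len: "length (vs r) = k" if "r < R" for r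
        using l[of "bsss ! r"] that lR by (simp add: vs_def)
      have W: "W bs r a = butterfly f (vs r) (x r) a" if "r < R" "a < 2 ^ k" for r a
        unfolding W_def vs_def x_def
      proof (rule round_table_eq_butterfly)
        show "length (bsss ! r) = Suc k" "\<And>bs. bs \<in> set (bsss ! r) \<Longrightarrow> length bs = n"
          using l[of "bsss ! r"] that lR by auto
        fix j assume j: "j < Suc k * n"
        have "bs ! (r * (Suc k * n) + j) = map concat bsss ! r ! j"
          unfolding bs_def by (rule nth_concat_uniform) (use lc that lR j in auto)
        then show "of_bool (bs ! (r * (Suc k * n) + j)) = (of_bool (concat (bsss ! r) ! j) :: int)"
          using that lR by simp
      qed (use H that in auto)
      have tc: "table_count (2 ^ k) (W bs r) u = level_count f (vs r) (x r) u" if "r < R" for r u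
        unfolding table_count_def level_count_def len[OF that]
        by (rule arg_cong[of _ _ card]) (use W[OF that] in auto)
      have "R < 2 * length (filter P bsss)" using bsss by simp
      also have "length (filter P bsss) = card {r. r < R \<and> faithful n f (1 / 2 ^ q) (vs r) (x r)}"
        by (simp add: length_filter_conv_card lR P_def vs_def x_def)
      finally have "bs \<in> ?A"
        using majority_level_accurate[OF boolean _ tc len _ top, where \<epsilon> = "1 / 2 ^ q"] by simp
      then show "bsss \<in> (concat \<circ> map concat) -` ?A" by (simp add: bs_def)
    qed
  qed simp
  also have "\<dots> = measure_pmf.prob ?D ?A" by (simp only: D measure_map_pmf)
  finally show ?thesis .
qed

subsection \<open>Resource bounds\<close>

text \<open>All parameters are replaced by one bound \<open>Y\<close>. The degree 4 comes from two
  products: \<open>R * k * 2 ^ k * n\<close> for building the points and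
  \<open>t * 2 ^ k * R * 2 ^ k\<close> for scanning the levels.\<close>

lemma total_time_le:
  assumes Y: "n \<le> Y" "t \<le> Y" "R \<le> Y" "q \<le> Y" "k \<le> Y" "2 ^ k \<le> Y" "1 \<le> Y"
  shows "total_time n t R q k \<le> 256 * Y ^ 4"
proof -
  have p: "1 \<le> Y ^ 3" "Y \<le> Y ^ 3" "Y * Y \<le> Y ^ 3" "1 \<le> Y ^ 4" "Y \<le> Y ^ 4" "Y ^ 3 \<le> Y ^ 4"
    "Y * Y \<le> Y ^ 4" "Y * Y * Y = Y ^ 3" "Y * Y ^ 3 = Y ^ 4" "Y ^ 3 * Y = Y ^ 4"
    using Y(7) power_increasing[of 1 3 Y] power_increasing[of 2 3 Y] power_increasing[of 1 4 Y]
      power_increasing[of 2 4 Y] power_increasing[of 3 4 Y]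
    by (simp_all add: power2_eq_square power3_eq_cube power4_eq_xxxx)
  have "round_time n k \<le> 4 * Y + Y * (9 * (Y * Y) + 12) + 8 * Y + Y * (4 * Y + 10) + 31"
    unfolding round_time_def using Y by (intro add_mono mult_mono) auto
  also have "\<dots> = 9 * (Y * Y * Y) + 4 * (Y * Y) + 34 * Y + 31" by (simp add: algebra_simps)
  also have "\<dots> \<le> 78 * Y ^ 3" unfolding p(8) using p(1-3) by linarith
  finally have round: "round_time n k \<le> 78 * Y ^ 3" .
  have "process_time n t R k \<le> Y * (78 * Y ^ 3 + 1) + Y * (Y * (Y * (9 * Y + 13) + 13) + 10) + 11"
    unfolding process_time_def using Y round by (intro add_mono mult_mono) auto
  also have "\<dots> = 78 * (Y * Y ^ 3) + 9 * (Y * Y * Y * Y) + 13 * (Y * Y * Y) + 13 * (Y * Y) + 11 * Y + 11"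
    by (simp add: algebra_simps)
  also have "\<dots> \<le> 135 * Y ^ 4" unfolding p(8-10) using p(4-7) by linarith
  finally have process: "process_time n t R k \<le> 135 * Y ^ 4" .
  have "total_time n t R q k \<le> 8 * Y + 4 * Y + 4 * Y + 6 * (Y * ((Y + Y) * Y)) + 135 * Y ^ 4 + 40"
    unfolding total_time_def using Y process by (intro add_mono mult_mono) auto
  also have "\<dots> = 16 * Y + 12 * (Y * Y * Y) + 135 * Y ^ 4 + 40" by (simp add: algebra_simps)
  also have "\<dots> \<le> 256 * Y ^ 4" unfolding p(8) using p(4-6) by linarith
  finally show ?thesis .
qed

text \<open>Rounding up gives \<open>2 ^ q \<le> 2 * X\<close>; the twelfth power contributes
  another \<open>2 ^ 12\<close> to the factor \<open>2 ^ 18\<close>.\<close>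

lemma table_size_le:
  fixes \<epsilon> X :: real
  assumes "0 < \<epsilon>" "1 + 1 / \<epsilon> \<le> X"
  shows "2 ^ (18 + 12 * accuracy_bits \<lceil>1 / \<epsilon>\<rceil>) \<le> 2 ^ 30 * X ^ 12"
proof -
  let ?q = "accuracy_bits \<lceil>1 / \<epsilon>\<rceil>"
  have "1 \<le> \<lceil>1 / \<epsilon>\<rceil>" using assms(1) by simp
  then have "(2::int) ^ ?q \<le> 2 * \<lceil>1 / \<epsilon>\<rceil>" using accuracy_bits_less by fastforce
  then have "real_of_int (2 ^ ?q) \<le> real_of_int (2 * \<lceil>1 / \<epsilon>\<rceil>)" by (simp only: of_int_le_iff)
  moreover have "real_of_int \<lceil>1 / \<epsilon>\<rceil> \<le> X" using assms(2) by linarith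
  ultimately have "(2::real) ^ ?q \<le> 2 * X" by simp
  then have "(2 ^ ?q) ^ 12 \<le> (2 * X) ^ 12" by (intro power_mono) auto
  moreover have "(2::real) ^ (18 + 12 * ?q) = 2 ^ 18 * (2 ^ ?q) ^ 12"
    by (simp only: power_add power_mult[symmetric] mult.commute)
  ultimately show ?thesis by (simp add: power_mult_distrib)
qed

text \<open>The logarithm to base 2 is at most twice the natural one because
  \<open>ln 2 \<ge> 1 / 2\<close>, and the summand 1 in \<open>X\<close> pays for rounding
  up.\<close>

lemma rounds_le:
  assumes "0 < \<delta>" "1 + max 0 (ln (1 / \<delta>)) \<le> X"
  shows "real (nat \<lceil>log 2 (1 / \<delta>)\<rceil>) \<le> 2 * X"
proof (cases "ln (1 / \<delta>) \<le> 0")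
  case True
  then have "log 2 (1 / \<delta>) \<le> 0" by (simp add: log_def divide_nonpos_pos)
  then have "\<lceil>log 2 (1 / \<delta>)\<rceil> \<le> 0" by simp
  then show ?thesis using assms(2) True by simp
next
  case False
  have "log 2 (1 / \<delta>) \<le> ln (1 / \<delta>) * 2"
    unfolding log_def using False ln2_ge_two_thirds mult_left_mono[of "1/2" "ln 2" "ln (1 / \<delta>)"]
    by (simp add: field_simps)
  then show ?thesis using assms(2) False by linarith
qed

text \<open>For \<open>\<delta> \<ge> 1\<close> the demanded success probability is at most 0, so
  the second alternative is harmless.\<close>

lemma inverse_two_power_le:
  assumes "0 < \<delta>"
  shows "1 / 2 ^ nat \<lceil>log 2 (1 / \<delta>)\<rceil> \<le> \<delta> \<or> 1 \<le> \<delta>"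
proof (cases "1 \<le> \<delta>")
  case False
  have "log 2 (1 / \<delta>) \<le> real (nat \<lceil>log 2 (1 / \<delta>)\<rceil>)" by linarith
  then have "1 / \<delta> \<le> 2 powr real (nat \<lceil>log 2 (1 / \<delta>)\<rceil>)"
    using assms by (simp add: log_le_iff)
  then show ?thesis using assms by (simp add: powr_realpow field_simps)
qed simp

lemma accuracy_le:
  fixes \<epsilon> :: real
  assumes "0 < \<epsilon>"
  shows "1 / 2 ^ accuracy_bits \<lceil>1 / \<epsilon>\<rceil> \<le> \<epsilon>"
proof -
  have "1 / \<epsilon> \<le> real_of_int \<lceil>1 / \<epsilon>\<rceil>" by (rule le_of_int_ceiling)
  also have "\<dots> \<le> real_of_int (2 ^ accuracy_bits \<lceil>1 / \<epsilon>\<rceil>)"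
    unfolding of_int_le_iff by (rule accuracy_bits_ge)
  also have "\<dots> = 2 ^ accuracy_bits \<lceil>1 / \<epsilon>\<rceil>" by simp
  finally have "1 / \<epsilon> \<le> 2 ^ accuracy_bits \<lceil>1 / \<epsilon>\<rceil>" .
  then show ?thesis using assms by (simp add: field_simps)
qed

theorem theorem4p8:
  "\<exists>(p :: com) (C :: real) (d :: nat) (\<eta> :: nat \<Rightarrow> real).
     \<eta> \<longlonglongrightarrow> 0 \<and>
     (\<forall>(\<epsilon> :: real) (\<delta> :: real) (t :: nat) (n :: nat) (f :: bit Matrix.vec \<Rightarrow> int).
        \<epsilon> > 0 \<longrightarrow> \<delta> > 0 \<longrightarrow> (\<forall>x\<in>carrier_vec n. f x \<in> {- 1, 1}) \<longrightarrow>
        (\<exists>T :: nat.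
           real T \<le> C * (1 + real n + real t + 1 / \<epsilon> + max 0 (ln (1 / \<delta>))) ^ d \<and>
           (\<forall>cfg\<in>set_pmf (run n f T (init_config p n t \<epsilon> \<delta>)).
              halted cfg \<and>
              real (num_queries (snd cfg))
                \<le> C * (1 + ln (max 1 (real t)) + 1 / \<epsilon> + max 0 (ln (1 / \<delta>))) ^ d \<and>
              length (outputs (snd cfg)) = t \<and>
              sorted_wrt (\<ge>) (outputs (snd cfg)) \<and>
              set (outputs (snd cfg)) \<subseteq> {0..1}) \<and>
           (\<forall>\<gamma>s. top_frequencies n f t \<gamma>s \<longrightarrow>
              measure_pmf.prob (run n f T (init_config p n t \<epsilon> \<delta>))
                {cfg. \<forall>i<t. \<bar>\<bar>fourier n f (\<gamma>s ! i)\<bar> - outputs (snd cfg) ! i\<bar> \<le> \<epsilon>}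
              \<ge> 1 - \<delta> - \<eta> n)))"
\<comment> \<open>The sum \<open>Y\<close> of the size parameters is at most
  \<open>2 ^ 31 * X ^ 12\<close>, and \<open>256\<close> times its fourth power is
  \<open>2 ^ 132 * X ^ 48\<close>. The same constants cover the queries, whose number is at most
  \<open>2 ^ 31 * Z ^ 13\<close>.\<close>
proof (rule exI[of _ algorithm], rule exI[of _ "2 ^ 132"], rule exI[of _ 48], rule exI[of _ "\<lambda>_. 0"],
    intro conjI allI impI)
  fix \<epsilon> \<delta> :: real and t n :: nat and f :: "bit Matrix.vec \<Rightarrow> int"
  assume eps: "\<epsilon> > 0" and delta: "\<delta> > 0" and boolean: "\<forall>x\<in>carrier_vec n. f x \<in> {- 1, 1}"
  define q where "q = accuracy_bits \<lceil>1 / \<epsilon>\<rceil>"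
  define k where "k = 18 + 12 * q"
  define R where "R = nat \<lceil>log 2 (1 / \<delta>)\<rceil>"
  define m where "m = R * (Suc k * n)"
  define W where "W bs r = round_table n f k (2 ^ (17 + 12 * q)) (\<lambda>j. of_bool (bs ! (r * (Suc k * n) + j)))" for bs r
  let ?D = "replicate_pmf m (bernoulli_pmf (1 / 2))"
  obtain T fin where T: "T \<le> total_time n t R q k"
    and run: "run n f T (init_config algorithm n t \<epsilon> \<delta>) = map_pmf (Pair [] \<circ> fin) ?D"
    and fin: "\<And>bs. length bs = m \<Longrightarrow> num_queries (fin bs) = R * 2 ^ k \<and>
      outputs (fin bs) = map (\<lambda>i. real (majority_level R (2 ^ k) (W bs) (Suc i) (2 ^ k)) / 2 ^ k) [0..<t]"
    using run_algorithm[OF q_def k_def R_def, where f = f and n = n and t = t]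
    unfolding m_def W_def by metis
  have supp: "length bs = m" if "bs \<in> set_pmf ?D" for bs
    using that by (simp add: set_replicate_pmf)
  define X where "X = 1 + real n + real t + 1 / \<epsilon> + max 0 (ln (1 / \<delta>))"
  have X: "1 + 1 / \<epsilon> \<le> X" "1 + max 0 (ln (1 / \<delta>)) \<le> X" "1 \<le> X" "real n + real t \<le> X"
    using eps by (auto simp: X_def)
  have T_le: "real T \<le> 2 ^ 132 * X ^ 48"
  proof -
    define Y where "Y = R + 2 ^ k + (n + t)"
    have "k \<le> 2 ^ k" by (rule less_imp_le[OF less_exp])
    moreover have "q \<le> k" "1 \<le> k" by (simp_all add: k_def)
    ultimately have "q \<le> Y" "k \<le> Y" "n \<le> Y" "t \<le> Y" "R \<le> Y" "2 ^ k \<le> Y" "1 \<le> Y"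
      unfolding Y_def by linarith+
    then have "T \<le> 256 * Y ^ 4" using T total_time_le[of n Y t R q k] by simp
    then have "real T \<le> real (256 * Y ^ 4)" by (simp only: of_nat_le_iff)
    also have "\<dots> = 256 * real Y ^ 4" by simp
    also have "\<dots> \<le> 256 * (2 ^ 31 * X ^ 12) ^ 4"
    proof (intro mult_left_mono power_mono)
      have "X \<le> X ^ 12" using power_increasing[of 1 12 X] X(3) by simp
      then show "real Y \<le> 2 ^ 31 * X ^ 12"
        using table_size_le[OF eps X(1)] rounds_le[OF delta X(2)] X(4)
        by (simp add: Y_def R_def k_def q_def)
    qed auto
    also have "\<dots> = 2 ^ 132 * X ^ 48" using power_mult[of X 12 4] by (simp add: power_mult_distrib)
    finally show ?thesis .
  qed
  define Z where "Z = 1 + ln (max 1 (real t)) + 1 / \<epsilon> + max 0 (ln (1 / \<delta>))"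
  have "0 \<le> ln (max 1 (real t))" by (intro ln_ge_zero) simp
  then have Z: "1 + 1 / \<epsilon> \<le> Z" "1 + max 0 (ln (1 / \<delta>)) \<le> Z" "1 \<le> Z"
    using eps by (auto simp: Z_def)
  have queries: "real (R * 2 ^ k) \<le> 2 ^ 132 * Z ^ 48"
  proof -
    have "real (R * 2 ^ k) = real R * 2 ^ k" by simp
    also have "\<dots> \<le> 2 * Z * (2 ^ 30 * Z ^ 12)"
      unfolding R_def k_def q_def using Z(3)
      by (intro mult_mono rounds_le[OF delta Z(2)] table_size_le[OF eps Z(1)]) auto
    also have "\<dots> = 2 ^ 31 * Z ^ 13" using power_add[of Z 1 12] by simp
    also have "\<dots> \<le> 2 ^ 132 * Z ^ 48"
      using Z(3) by (intro mult_mono power_increasing) auto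
    finally show ?thesis .
  qed
  show "\<exists>T. real T \<le> 2 ^ 132 * (1 + real n + real t + 1 / \<epsilon> + max 0 (ln (1 / \<delta>))) ^ 48 \<and>
           (\<forall>cfg\<in>set_pmf (run n f T (init_config algorithm n t \<epsilon> \<delta>)).
              halted cfg \<and>
              real (num_queries (snd cfg))
                \<le> 2 ^ 132 * (1 + ln (max 1 (real t)) + 1 / \<epsilon> + max 0 (ln (1 / \<delta>))) ^ 48 \<and>
              length (outputs (snd cfg)) = t \<and>
              sorted_wrt (\<ge>) (outputs (snd cfg)) \<and>
              set (outputs (snd cfg)) \<subseteq> {0..1}) \<and>
           (\<forall>\<gamma>s. top_frequencies n f t \<gamma>s \<longrightarrow>
              measure_pmf.prob (run n f T (init_config algorithm n t \<epsilon> \<delta>))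
                {cfg. \<forall>i<t. \<bar>\<bar>fourier n f (\<gamma>s ! i)\<bar> - outputs (snd cfg) ! i\<bar> \<le> \<epsilon>}
              \<ge> 1 - \<delta> - 0)"
    unfolding X_def[symmetric] Z_def[symmetric]
  proof (intro exI[of _ T] conjI ballI allI impI)
    show "real T \<le> 2 ^ 132 * X ^ 48" by (rule T_le)
  next
    fix cfg assume "cfg \<in> set_pmf (run n f T (init_config algorithm n t \<epsilon> \<delta>))"
    then obtain bs where cfg: "cfg = ([], fin bs)" and bs: "length bs = m"
      unfolding run using supp by auto
    note out = fin[OF bs, THEN conjunct2]
    show "halted cfg" by (simp add: halted_def cfg)
    show "real (num_queries (snd cfg)) \<le> 2 ^ 132 * Z ^ 48"
      using fin[OF bs] queries by (simp add: cfg)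
    show "length (outputs (snd cfg)) = t" by (simp add: cfg out)
    show "sorted_wrt (\<ge>) (outputs (snd cfg))"
      by (auto simp: cfg out sorted_wrt_iff_nth_less intro!: divide_right_mono majority_level_antimono)
    show "set (outputs (snd cfg)) \<subseteq> {0..1}"
    proof
      fix \<sigma> assume "\<sigma> \<in> set (outputs (snd cfg))"
      then obtain i where "\<sigma> = real (majority_level R (2 ^ k) (W bs) (Suc i) (2 ^ k)) / 2 ^ k"
        by (auto simp: cfg out)
      moreover have "real (majority_level R (2 ^ k) (W bs) (Suc i) (2 ^ k)) \<le> real (2 ^ k)"
        by (simp only: of_nat_le_iff majority_level_le)
      ultimately show "\<sigma> \<in> {0..1}" by simp
    qed
  next
    fix \<gamma>s assume top: "top_frequencies n f t \<gamma>s"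
    let ?A = "{bs. \<forall>i<t. \<bar>\<bar>fourier n f (\<gamma>s ! i)\<bar>
        - real (majority_level R (2 ^ k) (W bs) (Suc i) (2 ^ k)) / 2 ^ k\<bar> \<le> 1 / 2 ^ q}"
    let ?B = "{cfg :: config. \<forall>i<t. \<bar>\<bar>fourier n f (\<gamma>s ! i)\<bar> - outputs (snd cfg) ! i\<bar> \<le> \<epsilon>}"
    have "2 * 2 ^ (17 + 12 * q) = (2::nat) ^ k" by (simp add: k_def power_add)
    from algorithm_success[OF boolean k_def this top, of R]
    have "1 - 1 / 2 ^ R \<le> measure_pmf.prob ?D ?A" unfolding m_def W_def .
    also have "\<dots> = measure_pmf.prob ?D (?A \<inter> set_pmf ?D)" by (simp add: measure_Int_set_pmf)
    also have "\<dots> \<le> measure_pmf.prob ?D ((Pair [] \<circ> fin) -` ?B)"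
    proof (rule measure_pmf.finite_measure_mono)
      show "?A \<inter> set_pmf ?D \<subseteq> (Pair [] \<circ> fin) -` ?B"
        using accuracy_le[OF eps] fin supp by (force simp: q_def[symmetric])
    qed simp
    also have "\<dots> = measure_pmf.prob (run n f T (init_config algorithm n t \<epsilon> \<delta>)) ?B"
      by (simp add: run)
    finally have "1 - 1 / 2 ^ R \<le> measure_pmf.prob (run n f T (init_config algorithm n t \<epsilon> \<delta>)) ?B" .
    then show "measure_pmf.prob (run n f T (init_config algorithm n t \<epsilon> \<delta>)) ?B \<ge> 1 - \<delta> - 0"
      using inverse_two_power_le[OF delta] measure_nonneg[of "measure_pmf (run n f T (init_config algorithm n t \<epsilon> \<delta>))" ?B]
      unfolding R_def by linarith
  qed
qed (rule tendsto_const)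

end
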